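(* Let $f,g$ be non-negative integers and $\mu\in\mathcal P_{f,g}$. Then in $M^{(f,g)}$, \[s_\mu m=\sum_{\lambda\in\mathcal P_{f,g}}(-1)^{|\lambda|+|\mu|}\mathrm e_{\lambda\mu}\,t_\lambda m.\]
   Context: $\mathbb F$ is any field, $k=f+g$, $\mathfrak S_k$ has Coxeter generators $t_i=(i\ i{+}1)$ and $s_i=t_i-1\in\mathbb F\mathfrak S_k$. $M^{(f,g)}=\langle m\mid t_im=m\ (i\ne f)\rangle$ as an $\mathbb F\mathfrak S_k$-module. $\mathcal P_{f,g}$ is the set of partitions $\lambda$ with at most $g$ nonzero parts, all at most $f$. For $\lambda\in\mathcal P_{f,g}$, $t_\lambda=\prod_{r=1}^{g}(t_{\lambda_r+g-r+1}t_{\lambda_r+g-r+2}\cdots t_{f+g-r})$, the product taken with $r=1$ leftmost (each factor empty if $\lambda_r=f$), and $s_\lambda$ is defined by the same formula with each $t_i$ replaced by $s_i$. Partitions are identified with Young diagrams $\{(a,b)\in\mathbb N^2:b\le\lambda_a\}$; nodes are elements of $\mathbb N^2$; $(a,b)$ has height $a+b$ and lies in column $b-a$ (smaller column = further left). $\mathtt{NE}(\mathfrak n)=\mathfrak n+(0,1)$, $\mathtt{SW}(\mathfrak n)=\mathfrak n-(0,1)$, $\mathtt{SE}(\mathfrak n)=\mathfrak n-(1,0)$. A tile is a finite nonempty set of nodes orderable $\mathfrak n_1,\dots,\mathfrak n_r$ with $\mathfrak n_{i+1}\in\{\mathtt{NE}(\mathfrak n_i),\mathtt{SE}(\mathfrak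 n_i)\}$; start = leftmost node, end = rightmost node; Dyck tile if start and end both attain the maximal height of its nodes. A Dyck tiling of $\lambda\setminus\mu$ ($\lambda\supseteq\mu$) is a partition of it into Dyck tiles; it is cover-expansive if whenever $\mathfrak a,\mathtt{SE}(\mathfrak a)\in\lambda\setminus\mu$, the tile of $\mathtt{SE}(\mathfrak a)$ starts weakly left of the start of the tile of $\mathfrak a$, and whenever $\mathfrak a,\mathtt{SW}(\mathfrak a)\in\lambda\setminus\mu$, the tile of $\mathtt{SW}(\mathfrak a)$ ends weakly right of the end of the tile of $\mathfrak a$. $\mathrm e_{\lambda\mu}$ is the number of cover-expansive Dyck tilings of $\lambda\setminus\mu$ if $\lambda\supseteq\mu$, and $0$ otherwise. *)

theory Defs
  imports "HOL-Combinatorics.Combinatorics" "HOL-Library.Disjoint_Sets" "HOL-Library.Function_Algebras"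
begin

text \<open>An element of F S_k is a function from permutations to F, zero outside
  the permutations of {1..k}.  Product: (x y)(sigma) = sum over tau of
  x(tau) y(tau^-1 o sigma), i.e. the group product is composition (left action).\<close>

definition ga :: "nat \<Rightarrow> ((nat \<Rightarrow> nat) \<Rightarrow> 'a::field) set" where
  "ga k = {x. \<forall>\<sigma>. \<not> \<sigma> permutes {1..k} \<longrightarrow> x \<sigma> = 0}"

definition ga_basis :: "nat \<Rightarrow> (nat \<Rightarrow> nat) \<Rightarrow> (nat \<Rightarrow> nat) \<Rightarrow> 'a::field" where
  "ga_basis k p = (\<lambda>\<sigma>. if \<sigma> = p \<and> p permutes {1..k} then 1 else 0)"

definition ga_one :: "nat \<Rightarrow> (nat \<Rightarrow> nat) \<Rightarrow> 'a::field" where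
  "ga_one k = ga_basis k id"

definition ga_mult :: "nat \<Rightarrow> ((nat \<Rightarrow> nat) \<Rightarrow> 'a::field) \<Rightarrow> ((nat \<Rightarrow> nat) \<Rightarrow> 'a) \<Rightarrow> (nat \<Rightarrow> nat) \<Rightarrow> 'a" where
  "ga_mult k x y = (\<lambda>\<sigma>. if \<sigma> permutes {1..k}
      then (\<Sum>\<tau>\<in>{p. p permutes {1..k}}. x \<tau> * y (inv \<tau> \<circ> \<sigma>)) else 0)"

definition ga_prod :: "nat \<Rightarrow> ((nat \<Rightarrow> nat) \<Rightarrow> 'a::field) list \<Rightarrow> (nat \<Rightarrow> nat) \<Rightarrow> 'a" where
  "ga_prod k xs = foldr (ga_mult k) xs (ga_one k)"

definition gen_t :: "nat \<Rightarrow> nat \<Rightarrow> (nat \<Rightarrow> nat) \<Rightarrow> 'a::field" where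
  "gen_t k i = ga_basis k (Transposition.transpose i (Suc i))"

definition gen_s :: "nat \<Rightarrow> nat \<Rightarrow> (nat \<Rightarrow> nat) \<Rightarrow> 'a::field" where
  "gen_s k i = gen_t k i - ga_one k"

section \<open>The module M^(f,g) = F S_k / (left ideal generated by t_i - 1, i \<noteq> f)\<close>

definition Mrel :: "nat \<Rightarrow> nat \<Rightarrow> ((nat \<Rightarrow> nat) \<Rightarrow> 'a::field) set" where
  "Mrel f g = {x. \<exists>a. (\<forall>i. a i \<in> ga (f+g)) \<and>
      x = (\<Sum>i\<in>{1..<f+g} - {f}. ga_mult (f+g) (a i) (gen_t (f+g) i - ga_one (f+g)))}"

text \<open>Meq f g x y means x m = y m in M^(f,g), m the generator.\<close>
definition Meq :: "nat \<Rightarrow> nat \<Rightarrow> ((nat \<Rightarrow> nat) \<Rightarrow> 'a::field) \<Rightarrow> ((nat \<Rightarrow> nat) \<Rightarrow> 'a) \<Rightarrow> bool" where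
  "Meq f g x y \<longleftrightarrow> x - y \<in> Mrel f g"

text \<open>A partition in P_{f,g} is represented by the list of its first g parts
  (padded with zeros): lambda_r = lam ! (r-1).\<close>
definition Pfg :: "nat \<Rightarrow> nat \<Rightarrow> nat list set" where
  "Pfg f g = {lam. length lam = g \<and> sorted_wrt (\<ge>) lam \<and> (\<forall>x\<in>set lam. x \<le> f)}"

definition part :: "nat list \<Rightarrow> nat \<Rightarrow> nat" where
  "part lam r = (if 1 \<le> r \<and> r \<le> length lam then lam ! (r - 1) else 0)"

definition word :: "nat \<Rightarrow> nat \<Rightarrow> nat list \<Rightarrow> nat list" where
  "word f g lam = concat (map (\<lambda>r. [part lam r + g - r + 1 ..< f + g - r + 1]) [1..<g+1])"

definition t_lam :: "nat \<Rightarrow> nat \<Rightarrow> nat list \<Rightarrow> (nat \<Rightarrow> nat) \<Rightarrow> 'a::field" where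
  "t_lam f g lam = ga_prod (f+g) (map (gen_t (f+g)) (word f g lam))"

definition s_lam :: "nat \<Rightarrow> nat \<Rightarrow> nat list \<Rightarrow> (nat \<Rightarrow> nat) \<Rightarrow> 'a::field" where
  "s_lam f g lam = ga_prod (f+g) (map (gen_s (f+g)) (word f g lam))"

type_synonym node = "int \<times> int"

definition diagram :: "nat list \<Rightarrow> node set" where
  "diagram lam = {(a,b). 1 \<le> a \<and> 1 \<le> b \<and> b \<le> int (part lam (nat a))}"

definition height :: "node \<Rightarrow> int" where "height n = fst n + snd n"
definition column :: "node \<Rightarrow> int" where "column n = snd n - fst n"

definition NE :: "node \<Rightarrow> node" where "NE n = (fst n, snd n + 1)"
definition SW :: "node \<Rightarrow> node" where "SW n = (fst n, snd n - 1)"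
definition SE :: "node \<Rightarrow> node" where "SE n = (fst n - 1, snd n)"

definition is_tile :: "node set \<Rightarrow> bool" where
  "is_tile T \<longleftrightarrow> (\<exists>ns. ns \<noteq> [] \<and> set ns = T \<and>
      (\<forall>i. Suc i < length ns \<longrightarrow> ns ! Suc i \<in> {NE (ns ! i), SE (ns ! i)}))"

definition tile_start :: "node set \<Rightarrow> node" where
  "tile_start T = (THE n. n \<in> T \<and> (\<forall>m\<in>T. column n \<le> column m))"

definition tile_end :: "node set \<Rightarrow> node" where
  "tile_end T = (THE n. n \<in> T \<and> (\<forall>m\<in>T. column m \<le> column n))"

definition is_dyck_tile :: "node set \<Rightarrow> bool" where
  "is_dyck_tile T \<longleftrightarrow> is_tile T \<and>
      (\<forall>m\<in>T. height m \<le> height (tile_start T)) \<and>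
      (\<forall>m\<in>T. height m \<le> height (tile_end T))"

definition dyck_tiling :: "node set \<Rightarrow> node set set \<Rightarrow> bool" where
  "dyck_tiling R D \<longleftrightarrow> partition_on R D \<and> (\<forall>T\<in>D. is_dyck_tile T)"

definition tile_of :: "node set set \<Rightarrow> node \<Rightarrow> node set" where
  "tile_of D x = (THE T. T \<in> D \<and> x \<in> T)"

definition cover_expansive :: "node set \<Rightarrow> node set set \<Rightarrow> bool" where
  "cover_expansive R D \<longleftrightarrow>
     (\<forall>a. a \<in> R \<and> SE a \<in> R \<longrightarrow>
        column (tile_start (tile_of D (SE a))) \<le> column (tile_start (tile_of D a))) \<and>
     (\<forall>a. a \<in> R \<and> SW a \<in> R \<longrightarrow>
        column (tile_end (tile_of D a)) \<le> column (tile_end (tile_of D (SW a))))"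

definition e_coeff :: "nat list \<Rightarrow> nat list \<Rightarrow> nat" where
  "e_coeff lam mu = (if diagram mu \<subseteq> diagram lam then
      card {D. dyck_tiling (diagram lam - diagram mu) D \<and>
               cover_expansive (diagram lam - diagram mu) D}
    else 0)"

end

theory Submission
  imports Defs
begin

text \<open>The module \<open>M\<close> has a basis indexed by the \<open>g\<close>-subsets of \<open>{1..f+g}\<close>, in which \<open>t_lam m\<close>
  is the set of all \<open>lam_r + g - r + 1\<close>.  If \<open>mu'\<close> arises from \<open>mu\<close> by adding a node in the first row
  that is not full, in column \<open>l = i - g\<close>, then \<open>s_mu = s_i s_mu'\<close>.  So the expansion follows by
  induction from a recursion for the coefficients: if \<open>lam'\<close> arises from \<open>lam\<close> by adding a node in
  column \<open>l\<close>, then \<open>e(lam, mu) = e(lam', mu) = e(lam', mu') + e(lam, mu')\<close>, while \<open>e(lam, mu) = 0\<close> if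
  no node of column \<open>l\<close> can be added to or removed from \<open>lam\<close>.

  In a cover-expansive tiling of \<open>lam - mu\<close> the tile of every node of column \<open>l\<close> has a dip there.
  Shifting column \<open>l\<close> upwards by one node turns the dips into peaks and yields the tilings of
  \<open>lam' - mu'\<close>, provided that no dip starts at the maximal height of its tile.  This can only fail
  for the topmost node of the column; cutting its tile there and then shifting yields the tilings
  of \<open>lam - mu'\<close>.\<close>

section \<open>Tiles\<close>

text \<open>The recursion mirrors the algebra. Applying \<open>s_i = t_i - 1\<close> replaces the
  coefficient of a subset \<open>S\<close> by that of \<open>t_i S\<close> minus that of
  \<open>S\<close>, and the signs turn this difference into the sum e(lam', mu') + e(lam, mu'). The
  equality e(lam, mu) = e(lam', mu) reflects \<open>t_i s_i = - s_i\<close>, and the vanishing for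
  \<open>t_i S = S\<close> is a difference of equal coefficients. On tilings the obstacle is that
  cover-expansiveness compares neighbouring nodes, and a shift of column \<open>l\<close> changes
  which nodes are neighbours. With dips, the comparisons across the column say that, going up, its
  tiles start weakly further right and end weakly further left; with peaks they say the same, only
  read off from other neighbours. This condition, \<open>chain\<close>, is what the shift preserves.
  That only the topmost dip can fail to be strict rests on the convexity of skew diagrams: nodes
  enclosed between two consecutive tiles of the strip belong to the region, and cover-expansiveness
  leaves no way to tile them.\<close>

definition NW :: "node \<Rightarrow> node" where "NW n = (fst n + 1, snd n)"

lemma column_simps [simp]:
  "column (NE x) = column x + 1" "column (SE x) = column x + 1"
  "column (SW x) = column x - 1" "column (NW x) = column x - 1"
  by (auto simp: column_def NE_def SE_def SW_def NW_def)

lemma height_simps [simp]: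
  "height (NE x) = height x + 1" "height (SE x) = height x - 1"
  "height (SW x) = height x - 1" "height (NW x) = height x + 1"
  by (auto simp: height_def NE_def SE_def SW_def NW_def)

lemma inverse_steps [simp]:
  "NE (SW x) = x" "SW (NE x) = x" "NW (SE x) = x" "SE (NW x) = x"
  by (auto simp: NE_def SE_def SW_def NW_def)

lemma node_eq_iff: "x = y \<longleftrightarrow> column x = column y \<and> height x = height y"
  by (cases x; cases y) (auto simp: column_def height_def)

lemma even_height_diff: "column x = column y \<Longrightarrow> even (height x - height y)"
  unfolding column_def height_def by presburger

lemma is_tile_imp:
  assumes "is_tile T"
  shows "finite T" "T \<noteq> {}" "inj_on column T"
    "\<And>x y. x \<in> T \<Longrightarrow> y \<in> T \<Longrightarrow> column x < column y \<Longrightarrow> NE x \<in> T \<or> SE x \<in> T"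
proof -
  obtain ns where ns: "ns \<noteq> []" "set ns = T"
    and st: "\<And>i. Suc i < length ns \<Longrightarrow> ns ! Suc i \<in> {NE (ns ! i), SE (ns ! i)}"
    using assms unfolding is_tile_def by blast
  have col: "i < length ns \<Longrightarrow> column (ns ! i) = column (ns ! 0) + int i" for i
  proof (induction i)
    case (Suc i)
    then show ?case using st[of i] by auto
  qed simp
  show "finite T" "T \<noteq> {}" using ns by auto
  show "inj_on column T"
  proof (rule inj_onI)
    fix x y assume "x \<in> T" "y \<in> T" and e: "column x = column y"
    then obtain i j where "i < length ns" "x = ns ! i" "j < length ns" "y = ns ! j"
      using ns(2) by (auto simp: in_set_conv_nth)
    then show "x = y" using col[of i] col[of j] e by simp
  qed
  show "NE x \<in> T \<or> SE x \<in> T" if xy: "x \<in> T" "y \<in> T" "column x < column y" for x y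
  proof -
    obtain i j where ij: "i < length ns" "x = ns ! i" "j < length ns" "y = ns ! j"
      using ns(2) xy(1,2) by (auto simp: in_set_conv_nth)
    then have "i < j" using col[of i] col[of j] xy(3) by simp
    then have "Suc i < length ns" using ij by simp
    then show ?thesis using st[of i] ns ij by (metis insertE nth_mem singletonD)
  qed
qed

lemma is_tile_insert:
  assumes "is_tile T" "n \<in> T" "\<forall>m\<in>T. column n \<le> column m" "n \<in> {NE x, SE x}"
  shows "is_tile (insert x T)"
proof -
  obtain ns where ns: "ns \<noteq> []" "set ns = T"
    and st: "\<And>i. Suc i < length ns \<Longrightarrow> ns ! Suc i \<in> {NE (ns ! i), SE (ns ! i)}"
    using assms unfolding is_tile_def by blast
  obtain k where k: "k < length ns" "ns ! k = n" using assms(2) ns by (metis in_set_conv_nth)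
  have "k = 0"
  proof (rule ccontr)
    assume "k \<noteq> 0"
    then obtain j where j: "k = Suc j" by (cases k) auto
    then have "column (ns ! j) < column n" using st[of j] k by auto
    moreover have "ns ! j \<in> T" using ns k j by (metis Suc_lessD nth_mem)
    ultimately show False using assms(3) by force
  qed
  then have "(x # ns) ! Suc i \<in> {NE ((x # ns) ! i), SE ((x # ns) ! i)}"
    if "Suc i < length (x # ns)" for i
    using that k st assms(4) by (cases i) auto
  then show ?thesis unfolding is_tile_def using ns by (intro exI[of _ "x # ns"]) auto
qed

text \<open>The ordering is recovered by peeling off the leftmost node. The point is a description
  of tiles by sets alone, which is easy to check after a node is exchanged or a tile is cut or
  joined.\<close>

lemma is_tileI:
  assumes "finite T" "T \<noteq> {}" "inj_on column T"
    "\<And>x y. x \<in> T \<Longrightarrow> y \<in> T \<Longrightarrow> column x < column y \<Longrightarrow> NE x \<in> T \<or> SE x \<in> T"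
  shows "is_tile T"
  using assms
proof (induction "card T" arbitrary: T rule: less_induct)
  case less
  have "Min (column ` T) \<in> column ` T" using less.prems by (intro Min_in) auto
  then obtain x where x: "x \<in> T" "column x = Min (column ` T)" by auto
  have xle: "column x \<le> column y" if "y \<in> T" for y using that x less.prems(1) by simp
  have xlt: "column x < column y" if "y \<in> T" "y \<noteq> x" for y
    using xle[OF that(1)] that x(1) less.prems(3) by (metis inj_onD order_le_less)
  show ?case
  proof (cases "T - {x} = {}")
    case True
    then have "T = {x}" using x by auto
    then show ?thesis unfolding is_tile_def by (intro exI[of _ "[x]"]) auto
  next
    case False
    have t: "is_tile (T - {x})"
    proof (rule less.hyps)
      show "card (T - {x}) < card T" using x less.prems(1) by (metis card_Diff1_less)
      show "inj_on column (T - {x})" using less.prems(3) by (rule inj_on_subset) auto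
      fix y z assume yz: "y \<in> T - {x}" "z \<in> T - {x}" "column y < column z"
      then have "NE y \<in> T \<or> SE y \<in> T" using less.prems(4) by blast
      moreover have "NE y \<noteq> x" "SE y \<noteq> x" using xlt[of y] yz by auto
      ultimately show "NE y \<in> T - {x} \<or> SE y \<in> T - {x}" by blast
    qed (use less.prems False in auto)
    obtain z where z: "z \<in> T" "z \<noteq> x" using False by auto
    then have "NE x \<in> T \<or> SE x \<in> T" using less.prems(4)[OF x(1) z(1)] xlt by blast
    then obtain n where n: "n \<in> T" "n \<in> {NE x, SE x}" by blast
    then have cn: "column n = column x + 1" by auto
    then have "n \<noteq> x" by auto
    have "is_tile (insert x (T - {x}))"
    proof (rule is_tile_insert[OF t _ _ n(2)])
      show "\<forall>m\<in>T - {x}. column n \<le> column m" using cn xlt by force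
    qed (use n \<open>n \<noteq> x\<close> in auto)
    then show ?thesis using x by (simp add: insert_absorb)
  qed
qed

lemma is_tile_iff:
  "is_tile T \<longleftrightarrow> finite T \<and> T \<noteq> {} \<and> inj_on column T \<and>
    (\<forall>x\<in>T. \<forall>y\<in>T. column x < column y \<longrightarrow> NE x \<in> T \<or> SE x \<in> T)"
  by (metis is_tile_imp is_tileI)

lemma tile_eqI: "is_tile T \<Longrightarrow> x \<in> T \<Longrightarrow> y \<in> T \<Longrightarrow> column x = column y \<Longrightarrow> x = y"
  by (meson inj_onD is_tile_imp(3))

section \<open>The columns where a tile starts and ends\<close>

definition lcol :: "node set \<Rightarrow> int" where "lcol T = Min (column ` T)"
definition rcol :: "node set \<Rightarrow> int" where "rcol T = Max (column ` T)"

lemma lcol_le: "is_tile T \<Longrightarrow> x \<in> T \<Longrightarrow> lcol T \<le> column x"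
  unfolding lcol_def by (intro Min_le) (auto simp: is_tile_iff)

lemma rcol_ge: "is_tile T \<Longrightarrow> x \<in> T \<Longrightarrow> column x \<le> rcol T"
  unfolding rcol_def by (intro Max_ge) (auto simp: is_tile_iff)

lemma ex_lcol: "is_tile T \<Longrightarrow> \<exists>x\<in>T. column x = lcol T"
  unfolding lcol_def using Min_in[of "column ` T"] is_tile_imp(1,2)[of T] by fastforce

lemma ex_rcol: "is_tile T \<Longrightarrow> \<exists>x\<in>T. column x = rcol T"
  unfolding rcol_def using Max_in[of "column ` T"] is_tile_imp(1,2)[of T] by fastforce

lemma tile_right: "is_tile T \<Longrightarrow> x \<in> T \<Longrightarrow> column x < rcol T \<Longrightarrow> NE x \<in> T \<or> SE x \<in> T"
  by (metis ex_rcol is_tile_imp(4))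

text \<open>The step condition only looks to the right. So take the node in the last column before
  \<open>x\<close>: its successor is not in an earlier column than \<open>x\<close>, hence is
  \<open>x\<close>.\<close>

lemma tile_left:
  assumes "is_tile T" "x \<in> T" "lcol T < column x"
  shows "NW x \<in> T \<or> SW x \<in> T"
proof -
  let ?C = "column ` T \<inter> {..<column x}"
  have fin: "finite ?C" using assms is_tile_imp(1) by blast
  obtain w where "w \<in> T" "column w = lcol T" using ex_lcol[OF assms(1)] by blast
  then have "column w \<in> ?C" using assms(3) by (metis IntI imageI lessThan_iff)
  then have "?C \<noteq> {}" by blast
  then have "Max ?C \<in> ?C" using fin by (intro Max_in)
  then obtain y where y: "y \<in> T" "column y < column x" "column y = Max ?C" by auto
  have "NE y \<in> T \<or> SE y \<in> T" using assms y by (metis is_tile_imp(4))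
  then obtain z where z: "z \<in> T" "z \<in> {NE y, SE y}" by blast
  then have cz: "column z = column y + 1" by auto
  have "\<not> column z < column x"
  proof
    assume "column z < column x"
    then have "column z \<in> ?C" using z by auto
    then have "column z \<le> Max ?C" using fin by (intro Max_ge)
    then show False using cz y(3) by simp
  qed
  then have "z = x" using cz y tile_eqI[OF assms(1) z(1) assms(2)] by simp
  moreover from z(2) have "SW z = y \<or> NW z = y" by auto
  ultimately show ?thesis using y(1) by blast
qed

lemma tile_ex_column:
  assumes "is_tile T" "lcol T \<le> c" "c \<le> rcol T"
  obtains x where "x \<in> T" "column x = c"
proof -
  have "\<exists>x\<in>T. column x = c"
    using assms(2,3)
  proof (induction rule: int_ge_induct)
    case base
    then show ?case using ex_lcol[OF assms(1)] by auto
  next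
    case (step c)
    then obtain x where "x \<in> T" "column x = c" by auto
    then have "NE x \<in> T \<or> SE x \<in> T" "column (NE x) = c + 1" "column (SE x) = c + 1"
      using tile_right[OF assms(1), of x] step.prems by simp_all
    then show ?case by blast
  qed
  then show ?thesis using that by blast
qed

lemma tile_start_eq: "is_tile T \<Longrightarrow> x \<in> T \<Longrightarrow> column x = lcol T \<Longrightarrow> tile_start T = x"
  unfolding tile_start_def
  by (rule the_equality) (metis lcol_le, metis lcol_le order_antisym tile_eqI)

lemma tile_end_eq: "is_tile T \<Longrightarrow> x \<in> T \<Longrightarrow> column x = rcol T \<Longrightarrow> tile_end T = x"
  unfolding tile_end_def
  by (rule the_equality) (metis rcol_ge, metis rcol_ge order_antisym tile_eqI)

lemma column_tile_start [simp]: "is_tile T \<Longrightarrow> column (tile_start T) = lcol T"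
  by (metis ex_lcol tile_start_eq)

lemma column_tile_end [simp]: "is_tile T \<Longrightarrow> column (tile_end T) = rcol T"
  by (metis ex_rcol tile_end_eq)

text \<open>Columns are distinct within a tile, so the definite descriptions of start and end can be
  traded for the extreme columns.\<close>

lemma is_dyck_tile_iff:
  "is_dyck_tile T \<longleftrightarrow> is_tile T \<and>
    (\<forall>x\<in>T. column x = lcol T \<or> column x = rcol T \<longrightarrow> (\<forall>m\<in>T. height m \<le> height x))"
proof (cases "is_tile T")
  case True
  obtain x y where "x \<in> T" "column x = lcol T" "y \<in> T" "column y = rcol T"
    using True ex_lcol ex_rcol by meson
  moreover from this have "tile_start T = x" "tile_end T = y"
    using True tile_start_eq tile_end_eq by auto
  ultimately show ?thesis unfolding is_dyck_tile_def using True tile_eqI by metis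
qed (simp add: is_dyck_tile_def)

lemma is_tile_singleton: "is_tile {x}" by (auto simp: is_tile_iff)
lemma lcol_singleton [simp]: "lcol {x} = column x" by (simp add: lcol_def)
lemma rcol_singleton [simp]: "rcol {x} = column x" by (simp add: rcol_def)
lemma is_dyck_tile_singleton: "is_dyck_tile {x}" by (simp add: is_dyck_tile_iff is_tile_singleton)

lemma lcol_eqI: "is_tile T \<Longrightarrow> x \<in> T \<Longrightarrow> (\<And>y. y \<in> T \<Longrightarrow> column x \<le> column y) \<Longrightarrow> lcol T = column x"
  by (metis ex_lcol lcol_le order_antisym)

lemma rcol_eqI: "is_tile T \<Longrightarrow> x \<in> T \<Longrightarrow> (\<And>y. y \<in> T \<Longrightarrow> column y \<le> column x) \<Longrightarrow> rcol T = column x"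
  by (metis ex_rcol rcol_ge order_antisym)

text \<open>Disjoint tiles do not cross: the height difference in a common column is even and changes
  by at most 2 from one column to the next.\<close>

lemma noncrossing_step:
  assumes T: "is_tile T" "is_tile T'" "T \<inter> T' = {}"
    and x: "x \<in> T" "x' \<in> T'" "column x = column x'" "height x < height x'"
    and y: "y \<in> T" "y' \<in> T'" "column y = column y'" "column y = column x + 1"
  shows "height y < height y'"
proof -
  have h1: "y \<in> {NE x, SE x}"
    using T x y tile_eqI[OF T(1) y(1)] is_tile_imp(4)[OF T(1) x(1) y(1)] by fastforce
  have h2: "y' \<in> {NE x', SE x'}"
    using T x y tile_eqI[OF T(2) y(2)] is_tile_imp(4)[OF T(2) x(2) y(2)] by fastforce
  have "height x + 2 \<le> height x'" using even_height_diff[OF x(3)] x(4) by presburger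
  then have "height y \<le> height y'" using h1 h2 by auto
  moreover have "height y \<noteq> height y'" using node_eq_iff[of y y'] y(1,2,3) T(3) by auto
  ultimately show ?thesis by simp
qed

lemma noncrossing_up:
  assumes T: "is_tile T" "is_tile T'" "T \<inter> T' = {}"
    and x: "x \<in> T" "x' \<in> T'" "column x = column x'" "height x < height x'"
    and y: "y \<in> T" "y' \<in> T'" "column y = column y'" "column x \<le> column y"
  shows "height y < height y'"
  using y(4,1,2,3)
proof (induction "column y" arbitrary: y y' rule: int_ge_induct)
  case base
  then show ?case using x T tile_eqI by metis
next
  case (step c)
  have "lcol T < column y" using lcol_le[OF T(1) x(1)] step by simp
  moreover have "lcol T' < column y'" using lcol_le[OF T(2) x(2)] step x(3) by simp
  ultimately obtain z z' where z: "z \<in> {NW y, SW y}" "z \<in> T" "z' \<in> {NW y', SW y'}" "z' \<in> T'"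
    using tile_left[OF T(1) step.prems(1)] tile_left[OF T(2) step.prems(2)] by blast
  then have cz: "column z = c" "column z' = c" using step by auto
  then have "height z < height z'" using step.hyps z by auto
  then show ?case using noncrossing_step[OF T z(2,4)] cz step by simp
qed

text \<open>To the left of \<open>x\<close> the roles of the tiles are exchanged: a reversed order
  at \<open>y\<close> would propagate to the right and reverse the order at
  \<open>x\<close>.\<close>

lemma noncrossing:
  assumes T: "is_tile T" "is_tile T'" "T \<inter> T' = {}"
    and x: "x \<in> T" "x' \<in> T'" "column x = column x'" "height x < height x'"
    and y: "y \<in> T" "y' \<in> T'" "column y = column y'"
  shows "height y < height y'"
proof (cases "column x \<le> column y")
  case False
  show ?thesis
  proof (rule ccontr)
    assume "\<not> ?thesis"
    moreover have "height y \<noteq> height y'" using node_eq_iff[of y y'] y(1,2,3) T(3) by auto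
    ultimately have "height y' < height y" by simp
    then have "height x' < height x"
      using noncrossing_up[of T' T y' y x' x] T x y False by (auto simp: Int_commute)
    then show False using x by simp
  qed
qed (use noncrossing_up assms in blast)


section \<open>Cover-expansive tilings and strips\<close>

lemma tile_of_eq: "partition_on R D \<Longrightarrow> T \<in> D \<Longrightarrow> x \<in> T \<Longrightarrow> tile_of D x = T"
  unfolding tile_of_def
  by (rule the_equality) (blast, metis IntI disjointD empty_iff partition_onD2)

lemma tile_of_in:
  assumes "partition_on R D" "x \<in> R"
  shows "tile_of D x \<in> D" "x \<in> tile_of D x"
proof -
  obtain T where "T \<in> D" "x \<in> T" using assms partition_onD1 by fastforce
  then show "tile_of D x \<in> D" "x \<in> tile_of D x" using tile_of_eq[OF assms(1)] by simp_all
qed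

lemma tile_of_eq_tile_of: "partition_on R D \<Longrightarrow> x \<in> R \<Longrightarrow> y \<in> tile_of D x \<Longrightarrow> tile_of D y = tile_of D x"
  by (meson tile_of_eq tile_of_in)

lemma tile_of_sym: "partition_on R D \<Longrightarrow> x \<in> R \<Longrightarrow> y \<in> tile_of D x \<Longrightarrow> x \<in> tile_of D y"
  using tile_of_eq_tile_of tile_of_in(2) by metis

lemma partition_on_subset: "partition_on R D \<Longrightarrow> T \<in> D \<Longrightarrow> T \<subseteq> R"
  using partition_onD1 by fastforce

section \<open>Cover-expansiveness in terms of start and end columns\<close>

definition CE :: "node set \<Rightarrow> node set set set" where
  "CE R = {D. dyck_tiling R D \<and> cover_expansive R D}"

definition start_col :: "node set set \<Rightarrow> node \<Rightarrow> int" where "start_col D x = lcol (tile_of D x)"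
definition end_col :: "node set set \<Rightarrow> node \<Rightarrow> int" where "end_col D x = rcol (tile_of D x)"

lemma dyck_tiling_tile: "dyck_tiling R D \<Longrightarrow> x \<in> R \<Longrightarrow> is_tile (tile_of D x)"
  by (meson dyck_tiling_def is_dyck_tile_def tile_of_in(1))

lemma CE_iff:
  "D \<in> CE R \<longleftrightarrow> dyck_tiling R D \<and>
    (\<forall>a. a \<in> R \<longrightarrow> SE a \<in> R \<longrightarrow> start_col D (SE a) \<le> start_col D a) \<and>
    (\<forall>a. a \<in> R \<longrightarrow> SW a \<in> R \<longrightarrow> end_col D a \<le> end_col D (SW a))"
proof (cases "dyck_tiling R D")
  case True
  then have "column (tile_start (tile_of D a)) = start_col D a"
    "column (tile_end (tile_of D a)) = end_col D a" if "a \<in> R" for a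
    using dyck_tiling_tile that by (auto simp: start_col_def end_col_def)
  then show ?thesis by (auto simp: CE_def cover_expansive_def True)
qed (simp add: CE_def)

lemma CE_D:
  assumes "D \<in> CE R"
  shows "dyck_tiling R D" "partition_on R D"
    "\<And>a. a \<in> R \<Longrightarrow> SE a \<in> R \<Longrightarrow> start_col D (SE a) \<le> start_col D a"
    "\<And>a. a \<in> R \<Longrightarrow> SW a \<in> R \<Longrightarrow> end_col D a \<le> end_col D (SW a)"
  using assms unfolding CE_iff by (auto simp: dyck_tiling_def)

lemma start_col_le: "dyck_tiling R D \<Longrightarrow> x \<in> R \<Longrightarrow> start_col D x \<le> column x"
  unfolding start_col_def by (meson dyck_tiling_def dyck_tiling_tile lcol_le tile_of_in(2))

lemma end_col_ge: "dyck_tiling R D \<Longrightarrow> x \<in> R \<Longrightarrow> column x \<le> end_col D x"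
  unfolding end_col_def by (meson dyck_tiling_def dyck_tiling_tile rcol_ge tile_of_in(2))

text \<open>As \<open>x\<close> is the \<open>SE\<close> neighbour of \<open>NW x\<close>, its tile
  starts weakly left of the tile of \<open>NW x\<close>, hence strictly left of \<open>x\<close>,
  and must go on from \<open>x\<close> to the left.\<close>

lemma CE_left:
  assumes "D \<in> CE R" "x \<in> R" "NW x \<in> R"
  shows "NW x \<in> tile_of D x \<or> SW x \<in> tile_of D x"
proof -
  note d = CE_D[OF assms(1)]
  have "start_col D x \<le> start_col D (NW x)" using d(3)[OF assms(3)] assms(2) by simp
  also have "\<dots> \<le> column (NW x)" using start_col_le[OF d(1) assms(3)] .
  finally have "lcol (tile_of D x) < column x" unfolding start_col_def by simp
  then show ?thesis using tile_left dyck_tiling_tile[OF d(1) assms(2)] tile_of_in(2)[OF d(2) assms(2)] by blast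
qed

lemma CE_right:
  assumes "D \<in> CE R" "x \<in> R" "NE x \<in> R"
  shows "NE x \<in> tile_of D x \<or> SE x \<in> tile_of D x"
proof -
  note d = CE_D[OF assms(1)]
  have "column (NE x) \<le> end_col D (NE x)" using end_col_ge[OF d(1) assms(3)] .
  also have "\<dots> \<le> end_col D x" using d(4)[OF assms(3)] assms(2) by simp
  finally have "column x < rcol (tile_of D x)" unfolding end_col_def by simp
  then show ?thesis using tile_right dyck_tiling_tile[OF d(1) assms(2)] tile_of_in(2)[OF d(2) assms(2)] by blast
qed

lemma tiling_eqI:
  assumes "dyck_tiling R D" "x \<in> R" "y \<in> tile_of D x" "z \<in> tile_of D x" "column y = column z"
  shows "y = z"
  using tile_eqI[OF dyck_tiling_tile[OF assms(1,2)] assms(3-5)] .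

text \<open>The nodes of column \<open>l\<close>, together with their upper left and upper right neighbours.\<close>

definition nN :: "int \<Rightarrow> int \<Rightarrow> node" where "nN l a = (a, a + l)"
definition nY :: "int \<Rightarrow> int \<Rightarrow> node" where "nY l a = (a + 1, a + l)"
definition nZ :: "int \<Rightarrow> int \<Rightarrow> node" where "nZ l a = (a, a + l + 1)"

lemma strip_column [simp]:
  "column (nN l a) = l" "column (nY l a) = l - 1" "column (nZ l a) = l + 1"
  by (auto simp: column_def nN_def nY_def nZ_def)

lemma strip_height [simp]:
  "height (nN l a) = 2 * a + l" "height (nY l a) = 2 * a + l + 1" "height (nZ l a) = 2 * a + l + 1"
  by (auto simp: height_def nN_def nY_def nZ_def)

lemma strip_steps [simp]:
  "NW (nN l a) = nY l a" "NE (nN l a) = nZ l a" "SW (nN l a) = nY l (a - 1)" "SE (nN l a) = nZ l (a - 1)"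
  "SE (nY l a) = nN l a" "NE (nY l a) = nN l (a + 1)" "SW (nZ l a) = nN l a" "NW (nZ l a) = nN l (a + 1)"
  by (auto simp: nN_def nY_def nZ_def NW_def NE_def SW_def SE_def)

lemma strip_inject [simp]: "nN l a = nN l b \<longleftrightarrow> a = b" "nY l a = nY l b \<longleftrightarrow> a = b" "nZ l a = nZ l b \<longleftrightarrow> a = b"
  by (auto simp: nN_def nY_def nZ_def)

lemma strip_distinct [simp]:
  "nN l a \<noteq> nY l b" "nN l a \<noteq> nZ l b" "nY l a \<noteq> nN l b" "nZ l a \<noteq> nN l b" "nY l a \<noteq> nZ l b" "nZ l a \<noteq> nY l b"
  by (auto simp: nN_def nY_def nZ_def)

lemma column_eq_nN: "column x = l \<Longrightarrow> x = nN l (fst x)"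
  by (cases x) (auto simp: column_def nN_def)

text \<open>Induction up the column. The tile of each node continues to the left, but the lower left
  neighbour is missing (at the bottom) or already taken by the tile of the next lower node, and a
  tile meets a column only once.\<close>

lemma dip_left:
  assumes D: "D \<in> CE R" and bot: "nY l (al - 1) \<notin> R"
    and R: "\<And>a. al \<le> a \<Longrightarrow> a < be \<Longrightarrow> nN l a \<in> R \<and> nY l a \<in> R"
    and a: "al \<le> a" "a < be"
  shows "nY l a \<in> tile_of D (nN l a)"
  using a
proof (induction rule: int_ge_induct)
  case base
  have "nY l (al - 1) \<notin> tile_of D (nN l al)"
    using tile_of_in(1)[OF CE_D(2)[OF D]] partition_on_subset[OF CE_D(2)[OF D]] R[of al] base bot by blast
  then show ?case using CE_left[OF D, of "nN l al"] R[of al] base by simp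
next
  case (step a)
  note d = CE_D(1,2)[OF D]
  have R': "nN l a \<in> R" "nN l (a + 1) \<in> R" "nY l (a + 1) \<in> R" using R[of a] R[of "a + 1"] step by auto
  have ya: "nY l a \<in> tile_of D (nN l a)" using step by simp
  have "nY l a \<notin> tile_of D (nN l (a + 1))"
  proof
    assume "nY l a \<in> tile_of D (nN l (a + 1))"
    then have "tile_of D (nN l (a + 1)) = tile_of D (nN l a)"
      using tile_of_eq_tile_of[OF d(2) R'(1) ya] tile_of_eq_tile_of[OF d(2) R'(2)] by metis
    then have "nN l (a + 1) = nN l a"
      using tile_of_in(2)[OF d(2) R'(1)] tile_of_in(2)[OF d(2) R'(2)]
      by (intro tiling_eqI[OF d(1) R'(1)]) simp_all
    then show False by simp
  qed
  then show ?case using CE_left[OF D, of "nN l (a + 1)"] R' by simp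
qed

lemma dip_right:
  assumes D: "D \<in> CE R" and bot: "nZ l (al - 1) \<notin> R"
    and R: "\<And>a. al \<le> a \<Longrightarrow> a < be \<Longrightarrow> nN l a \<in> R \<and> nZ l a \<in> R"
    and a: "al \<le> a" "a < be"
  shows "nZ l a \<in> tile_of D (nN l a)"
  using a
proof (induction rule: int_ge_induct)
  case base
  have "nZ l (al - 1) \<notin> tile_of D (nN l al)"
    using tile_of_in(1)[OF CE_D(2)[OF D]] partition_on_subset[OF CE_D(2)[OF D]] R[of al] base bot by blast
  then show ?case using CE_right[OF D, of "nN l al"] R[of al] base by simp
next
  case (step a)
  note d = CE_D(1,2)[OF D]
  have R': "nN l a \<in> R" "nN l (a + 1) \<in> R" "nZ l (a + 1) \<in> R" using R[of a] R[of "a + 1"] step by auto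
  have ya: "nZ l a \<in> tile_of D (nN l a)" using step by simp
  have "nZ l a \<notin> tile_of D (nN l (a + 1))"
  proof
    assume "nZ l a \<in> tile_of D (nN l (a + 1))"
    then have "tile_of D (nN l (a + 1)) = tile_of D (nN l a)"
      using tile_of_eq_tile_of[OF d(2) R'(1) ya] tile_of_eq_tile_of[OF d(2) R'(2)] by metis
    then have "nN l (a + 1) = nN l a"
      using tile_of_in(2)[OF d(2) R'(1)] tile_of_in(2)[OF d(2) R'(2)]
      by (intro tiling_eqI[OF d(1) R'(1)]) simp_all
    then show False by simp
  qed
  then show ?case using CE_right[OF D, of "nN l (a + 1)"] R' by simp
qed

text \<open>This is the situation after a shift, where column \<open>l\<close> begins one node
  higher. Now it is the tile of the neighbour \<open>nY l a\<close> that must continue into column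
  \<open>l\<close>, and the lower of its two options is missing or taken.\<close>

lemma peak_left:
  assumes D: "D \<in> CE R" and bot: "nN l al \<notin> R"
    and R: "\<And>a. al \<le> a \<Longrightarrow> a < be \<Longrightarrow> nN l (a + 1) \<in> R \<and> nY l a \<in> R"
    and a: "al \<le> a" "a < be"
  shows "nY l a \<in> tile_of D (nN l (a + 1))"
  using a
proof (induction rule: int_ge_induct)
  case base
  note d = CE_D(1,2)[OF D]
  have "nN l al \<notin> tile_of D (nY l al)"
    using tile_of_in(1)[OF d(2)] partition_on_subset[OF d(2)] R[of al] base bot by blast
  then have "nN l (al + 1) \<in> tile_of D (nY l al)" using CE_right[OF D, of "nY l al"] R[of al] base by simp
  then show ?case using tile_of_sym[OF d(2), of "nY l al"] R[of al] base by blast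
next
  case (step a)
  note d = CE_D(1,2)[OF D]
  have R': "nN l (a + 1) \<in> R" "nN l (a + 1 + 1) \<in> R" "nY l (a + 1) \<in> R" using R[of a] R[of "a + 1"] step by auto
  have ya: "nY l a \<in> tile_of D (nN l (a + 1))" using step by simp
  have "nN l (a + 1) \<notin> tile_of D (nY l (a + 1))"
  proof
    assume "nN l (a + 1) \<in> tile_of D (nY l (a + 1))"
    then have "nY l (a + 1) \<in> tile_of D (nN l (a + 1))"
      using tile_of_sym[OF d(2) R'(3)] by blast
    then have "nY l (a + 1) = nY l a"
      using ya R' by (intro tiling_eqI[OF d(1), of "nN l (a + 1)"]) auto
    then show False by simp
  qed
  then have "nN l (a + 1 + 1) \<in> tile_of D (nY l (a + 1))"
    using CE_right[OF D, of "nY l (a + 1)"] R' by simp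
  then show ?case using tile_of_sym[OF d(2) R'(3)] by blast
qed

lemma peak_right:
  assumes D: "D \<in> CE R" and bot: "nN l al \<notin> R"
    and R: "\<And>a. al \<le> a \<Longrightarrow> a < be \<Longrightarrow> nN l (a + 1) \<in> R \<and> nZ l a \<in> R"
    and a: "al \<le> a" "a < be"
  shows "nZ l a \<in> tile_of D (nN l (a + 1))"
  using a
proof (induction rule: int_ge_induct)
  case base
  note d = CE_D(1,2)[OF D]
  have "nN l al \<notin> tile_of D (nZ l al)"
    using tile_of_in(1)[OF d(2)] partition_on_subset[OF d(2)] R[of al] base bot by blast
  then have "nN l (al + 1) \<in> tile_of D (nZ l al)" using CE_left[OF D, of "nZ l al"] R[of al] base by simp
  then show ?case using tile_of_sym[OF d(2), of "nZ l al"] R[of al] base by blast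
next
  case (step a)
  note d = CE_D(1,2)[OF D]
  have R': "nN l (a + 1) \<in> R" "nN l (a + 1 + 1) \<in> R" "nZ l (a + 1) \<in> R" using R[of a] R[of "a + 1"] step by auto
  have ya: "nZ l a \<in> tile_of D (nN l (a + 1))" using step by simp
  have "nN l (a + 1) \<notin> tile_of D (nZ l (a + 1))"
  proof
    assume "nN l (a + 1) \<in> tile_of D (nZ l (a + 1))"
    then have "nZ l (a + 1) \<in> tile_of D (nN l (a + 1))"
      using tile_of_sym[OF d(2) R'(3)] by blast
    then have "nZ l (a + 1) = nZ l a"
      using ya R' by (intro tiling_eqI[OF d(1), of "nN l (a + 1)"]) auto
    then show False by simp
  qed
  then have "nN l (a + 1 + 1) \<in> tile_of D (nZ l (a + 1))"
    using CE_left[OF D, of "nZ l (a + 1)"] R' by simp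
  then show ?case using tile_of_sym[OF d(2) R'(3)] by blast
qed

section \<open>Columns that admit no cover-expansive tiling\<close>

lemma tiling_end_col_eq:
  assumes "dyck_tiling R D" "x \<in> R" "NE x \<notin> tile_of D x" "SE x \<notin> tile_of D x"
  shows "end_col D x = column x"
  using tile_right[OF dyck_tiling_tile[OF assms(1,2)], of x] assms end_col_ge[OF assms(1,2)]
  unfolding end_col_def by (metis dyck_tiling_def order_le_less tile_of_in(2))

lemma tiling_start_col_eq:
  assumes "dyck_tiling R D" "x \<in> R" "NW x \<notin> tile_of D x" "SW x \<notin> tile_of D x"
  shows "start_col D x = column x"
  using tile_left[OF dyck_tiling_tile[OF assms(1,2)], of x] assms start_col_le[OF assms(1,2)]
  unfolding start_col_def by (metis dyck_tiling_def order_le_less tile_of_in(2))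

lemma end_height:
  assumes "dyck_tiling R D" "x \<in> R" "y \<in> tile_of D x" "start_col D x = column x \<or> end_col D x = column x"
  shows "height y \<le> height x"
proof -
  have "is_dyck_tile (tile_of D x)" "x \<in> tile_of D x"
    using assms(1,2) unfolding dyck_tiling_def by (auto dest: tile_of_in)
  then show ?thesis using assms(3,4) unfolding is_dyck_tile_iff start_col_def end_col_def by metis
qed

text \<open>The tile of the top node goes up on its left but cannot go on to the right: the upper
  right node is outside the region and the lower right one belongs to the tile below. So it would
  end at a node that is not of maximal height.\<close>

lemma CE_empty_right:
  assumes bot: "nY l (al - 1) \<notin> R" "nZ l (al - 1) \<notin> R" and ab: "al \<le> be"
    and R: "\<And>a. al \<le> a \<Longrightarrow> a \<le> be \<Longrightarrow> nN l a \<in> R \<and> nY l a \<in> R"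
    and RZ: "\<And>a. al \<le> a \<Longrightarrow> a < be \<Longrightarrow> nZ l a \<in> R" and top: "nZ l be \<notin> R"
  shows "CE R = {}"
proof -
  have False if D: "D \<in> CE R" for D
  proof -
    note d = CE_D(1,2)[OF D]
    have n: "nN l be \<in> R" using R ab by blast
    have y: "nY l be \<in> tile_of D (nN l be)" using dip_left[OF D bot(1), of "be + 1"] R ab by simp
    have sub: "tile_of D (nN l be) \<subseteq> R" using tile_of_in(1)[OF d(2) n] partition_on_subset[OF d(2)] by blast
    have "nZ l (be - 1) \<notin> tile_of D (nN l be)"
    proof (cases "al = be")
      case False
      have z: "nZ l (be - 1) \<in> tile_of D (nN l (be - 1))"
        using dip_right[OF D bot(2), of be "be - 1"] R RZ ab False by auto
      have n1: "nN l (be - 1) \<in> R" using R[of "be - 1"] ab False by simp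
      show ?thesis
      proof
        assume "nZ l (be - 1) \<in> tile_of D (nN l be)"
        then have "nN l (be - 1) \<in> tile_of D (nN l be)"
          using tile_of_eq_tile_of[OF d(2) n1 z] tile_of_eq_tile_of[OF d(2) n] tile_of_in(2)[OF d(2) n1] by metis
        then have "nN l (be - 1) = nN l be"
          using tile_of_in(2)[OF d(2) n] by (intro tiling_eqI[OF d(1) n]) auto
        then show False by simp
      qed
    qed (use bot sub in auto)
    then have "end_col D (nN l be) = column (nN l be)" using top sub by (intro tiling_end_col_eq[OF d(1) n]) auto
    then have "height (nY l be) \<le> height (nN l be)" using end_height[OF d(1) n y] by blast
    then show False by simp
  qed
  then show ?thesis by blast
qed

lemma CE_empty_left:
  assumes bot: "nY l (al - 1) \<notin> R" "nZ l (al - 1) \<notin> R" and ab: "al \<le> be"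
    and R: "\<And>a. al \<le> a \<Longrightarrow> a \<le> be \<Longrightarrow> nN l a \<in> R \<and> nZ l a \<in> R"
    and RZ: "\<And>a. al \<le> a \<Longrightarrow> a < be \<Longrightarrow> nY l a \<in> R" and top: "nY l be \<notin> R"
  shows "CE R = {}"
proof -
  have False if D: "D \<in> CE R" for D
  proof -
    note d = CE_D(1,2)[OF D]
    have n: "nN l be \<in> R" using R ab by blast
    have y: "nZ l be \<in> tile_of D (nN l be)" using dip_right[OF D bot(2), of "be + 1"] R ab by simp
    have sub: "tile_of D (nN l be) \<subseteq> R" using tile_of_in(1)[OF d(2) n] partition_on_subset[OF d(2)] by blast
    have "nY l (be - 1) \<notin> tile_of D (nN l be)"
    proof (cases "al = be")
      case False
      have z: "nY l (be - 1) \<in> tile_of D (nN l (be - 1))"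
        using dip_left[OF D bot(1), of be "be - 1"] R RZ ab False by auto
      have n1: "nN l (be - 1) \<in> R" using R[of "be - 1"] ab False by simp
      show ?thesis
      proof
        assume "nY l (be - 1) \<in> tile_of D (nN l be)"
        then have "nN l (be - 1) \<in> tile_of D (nN l be)"
          using tile_of_eq_tile_of[OF d(2) n1 z] tile_of_eq_tile_of[OF d(2) n] tile_of_in(2)[OF d(2) n1] by metis
        then have "nN l (be - 1) = nN l be"
          using tile_of_in(2)[OF d(2) n] by (intro tiling_eqI[OF d(1) n]) auto
        then show False by simp
      qed
    qed (use bot sub in auto)
    then have "start_col D (nN l be) = column (nN l be)" using top sub by (intro tiling_start_col_eq[OF d(1) n]) auto
    then have "height (nZ l be) \<le> height (nN l be)" using end_height[OF d(1) n y] by blast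
    then show False by simp
  qed
  then show ?thesis by blast
qed


text \<open>Adding the tile \<open>{n}\<close> is a bijection. Since \<open>NW n\<close> and
  \<open>NE n\<close> are outside, \<open>n\<close> can only be the upper node in a comparison of
  neighbours, and \<open>se\<close> and \<open>sw\<close> are these comparisons.\<close>

lemma CE_insert_singleton:
  assumes n: "n \<notin> R"
    and single: "\<And>D. D \<in> CE (insert n R) \<Longrightarrow> tile_of D n = {n}"
    and nbr: "NW n \<notin> R" "NE n \<notin> R"
    and se: "\<And>D. D \<in> CE R \<Longrightarrow> SE n \<in> R \<Longrightarrow> start_col D (SE n) \<le> column n"
    and sw: "\<And>D. D \<in> CE R \<Longrightarrow> SW n \<in> R \<Longrightarrow> column n \<le> end_col D (SW n)"
  shows "card (CE (insert n R)) = card (CE R)"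
proof -
  have tl: "tile_of (insert {n} D) x = tile_of D x" if "partition_on R D" "x \<in> R" for D x
  proof -
    have "partition_on (insert n R) (insert {n} D)"
      using that n partition_onD1[OF that(1)] by (subst partition_on_insert) (auto simp: disjnt_def)
    then show ?thesis using tile_of_eq tile_of_in[OF that] by (metis insertI2)
  qed
  have to: "insert {n} D \<in> CE (insert n R)" if D: "D \<in> CE R" for D
  proof -
    note d = CE_D[OF D]
    have p: "partition_on (insert n R) (insert {n} D)"
      using d(2) n partition_onD1[OF d(2)] by (subst partition_on_insert) (auto simp: disjnt_def)
    have e: "start_col (insert {n} D) x = start_col D x" "end_col (insert {n} D) x = end_col D x" if "x \<in> R" for x
      using tl[OF d(2) that] by (simp_all add: start_col_def end_col_def)
    have tn: "tile_of (insert {n} D) n = {n}" using tile_of_eq[OF p] by simp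
    have en: "start_col (insert {n} D) n = column n" "end_col (insert {n} D) n = column n" by (simp_all add: start_col_def end_col_def tn)
    have nn: "SE n \<noteq> n" "SW n \<noteq> n" by (auto simp: node_eq_iff)
    have n1: "SE a \<noteq> n" "SW a \<noteq> n" if "a \<in> R" for a using nbr that by auto
    show ?thesis unfolding CE_iff
    proof (intro conjI allI impI)
      show "dyck_tiling (insert n R) (insert {n} D)"
        using p d(1) by (auto simp: dyck_tiling_def is_dyck_tile_singleton)
      show "start_col (insert {n} D) (SE a) \<le> start_col (insert {n} D) a" if "a \<in> insert n R" "SE a \<in> insert n R" for a
        using that se[OF D] d(3) n1 nn by (cases "a = n") (auto simp: e en)
      show "end_col (insert {n} D) a \<le> end_col (insert {n} D) (SW a)" if "a \<in> insert n R" "SW a \<in> insert n R" for a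
        using that sw[OF D] d(4) n1 nn by (cases "a = n") (auto simp: e en)
    qed
  qed
  have restr: "D - {{n}} \<in> CE R \<and> insert {n} (D - {{n}}) = D" if D: "D \<in> CE (insert n R)" for D
  proof -
    note d = CE_D[OF D]
    have inD: "{n} \<in> D" using tile_of_in(1)[OF d(2), of n] single[OF D] by simp
    then have eq: "insert {n} (D - {{n}}) = D" by blast
    have "partition_on (insert n R - {n}) (D - {{n}})"
    proof -
      have "disjnt {n} (\<Union>(D - {{n}}))"
        using tile_of_eq[OF d(2), of _ n] single[OF D] by (auto simp: disjnt_def)
      then show ?thesis using partition_on_insert[of "{n}" "D - {{n}}" "insert n R"] d(2) eq by simp
    qed
    then have p: "partition_on R (D - {{n}})" using n by simp
    have e: "start_col (D - {{n}}) x = start_col D x" "end_col (D - {{n}}) x = end_col D x" if "x \<in> R" for x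
      using tl[OF p that] unfolding eq by (simp_all add: start_col_def end_col_def)
    have "D - {{n}} \<in> CE R" unfolding CE_iff
      using d p by (auto simp: dyck_tiling_def e)
    then show ?thesis using eq by simp
  qed
  have "bij_betw (insert {n}) (CE R) (CE (insert n R))"
  proof (rule bij_betw_byWitness[where f' = "\<lambda>D. D - {{n}}"])
    show "\<forall>D\<in>CE R. insert {n} D - {{n}} = D"
      using n CE_D(2) partition_on_subset by blast
  qed (use to restr in blast)+
  then show ?thesis by (simp add: bij_betw_same_card)
qed

text \<open>The new node is alone in its tile: its lower neighbours belong to the dip below it, or
  are missing, and its upper neighbours are outside.\<close>

lemma CE_insert_top:
  assumes bot: "nY l (al - 1) \<notin> R" "nZ l (al - 1) \<notin> R" and ab: "al \<le> be"
    and R: "\<And>a. al \<le> a \<Longrightarrow> a < be \<Longrightarrow> nN l a \<in> R \<and> nY l a \<in> R \<and> nZ l a \<in> R"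
    and top: "nN l be \<notin> R" "nY l be \<notin> R" "nZ l be \<notin> R"
  shows "card (CE (insert (nN l be) R)) = card (CE R)"
proof (rule CE_insert_singleton[OF top(1)])
  let ?R = "insert (nN l be) R"
  fix D assume D: "D \<in> CE ?R"
  note d = CE_D(1,2)[OF D]
  let ?T = "tile_of D (nN l be)"
  have sub: "?T \<subseteq> ?R" using tile_of_in(1)[OF d(2)] partition_on_subset[OF d(2)] by blast
  have "nY l (be - 1) \<notin> ?T \<and> nZ l (be - 1) \<notin> ?T"
  proof (cases "al = be")
    case True
    then show ?thesis using bot sub by auto
  next
    case False
    then have b: "al \<le> be - 1" "be - 1 < be" using ab by auto
    have n1: "nN l (be - 1) \<in> ?R" using R[OF b] by simp
    have "nY l (be - 1) \<in> tile_of D (nN l (be - 1))"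
      using R bot by (intro dip_left[OF D _ _ b]) auto
    moreover have "nZ l (be - 1) \<in> tile_of D (nN l (be - 1))"
      using R bot by (intro dip_right[OF D _ _ b]) auto
    moreover have "tile_of D (nN l (be - 1)) \<noteq> ?T"
    proof
      assume "tile_of D (nN l (be - 1)) = ?T"
      then have "nN l (be - 1) = nN l be"
        using tile_of_in(2)[OF d(2)] n1 by (intro tiling_eqI[OF d(1), of "nN l be"]) (simp_all, blast)
      then show False by simp
    qed
    ultimately show ?thesis using tile_of_eq_tile_of[OF d(2)] n1 by (metis insertI1)
  qed
  moreover have "nY l be \<notin> ?T" "nZ l be \<notin> ?T"
    using sub top strip_distinct by (metis insertE subsetD)+
  ultimately have "end_col D (nN l be) = l" "start_col D (nN l be) = l"
    using tiling_end_col_eq[OF d(1), of "nN l be"] tiling_start_col_eq[OF d(1), of "nN l be"] by simp_all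
  then have "column x = l" if "x \<in> ?T" for x
    using lcol_le[of ?T x] rcol_ge[of ?T x] dyck_tiling_tile[OF d(1), of "nN l be"] that
    by (simp add: start_col_def end_col_def)
  then show "?T = {nN l be}"
    using tiling_eqI[OF d(1), of "nN l be"] tile_of_in(2)[OF d(2), of "nN l be"] by (metis insertI1 is_singletonI' is_singleton_the_elem singletonD strip_column(1) empty_iff)
next
  show "NW (nN l be) \<notin> R" "NE (nN l be) \<notin> R" using top by auto
next
  fix D assume D: "D \<in> CE R" and s: "SE (nN l be) \<in> R"
  note d = CE_D(1,2)[OF D]
  have b: "al \<le> be - 1" "be - 1 < be" using bot(2) s ab by (cases "al = be"; simp)+
  have n1: "nN l (be - 1) \<in> R" using R[OF b] by simp
  have "nZ l (be - 1) \<in> tile_of D (nN l (be - 1))"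
    using R bot by (intro dip_right[OF D _ _ b]) auto
  then have "tile_of D (nZ l (be - 1)) = tile_of D (nN l (be - 1))" using tile_of_eq_tile_of[OF d(2) n1] by simp
  then show "start_col D (SE (nN l be)) \<le> column (nN l be)" using start_col_le[OF d(1) n1] by (simp add: start_col_def)
next
  fix D assume D: "D \<in> CE R" and s: "SW (nN l be) \<in> R"
  note d = CE_D(1,2)[OF D]
  have b: "al \<le> be - 1" "be - 1 < be" using bot(1) s ab by (cases "al = be"; simp)+
  have n1: "nN l (be - 1) \<in> R" using R[OF b] by simp
  have "nY l (be - 1) \<in> tile_of D (nN l (be - 1))"
    using R bot by (intro dip_left[OF D _ _ b]) auto
  then have "tile_of D (nY l (be - 1)) = tile_of D (nN l (be - 1))" using tile_of_eq_tile_of[OF d(2) n1] by simp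
  then show "column (nN l be) \<le> end_col D (SW (nN l be))" using end_col_ge[OF d(1) n1] by (simp add: end_col_def)
qed

section \<open>Exchanging one inner node of a tile\<close>

lemma tile_replace:
  assumes T: "is_tile T" and yz: "p \<in> T" "y \<in> T" "z \<in> T" "p \<in> {NE y, SE y}" "z \<in> {NE p, SE p}"
    and q: "q \<in> {NE y, SE y}" "z \<in> {NE q, SE q}"
  shows "is_tile (insert q (T - {p}))" "lcol (insert q (T - {p})) = lcol T" "rcol (insert q (T - {p})) = rcol T"
proof -
  have cp: "column p = column y + 1" "column q = column p" "column z = column p + 1"
    using yz q by auto
  have ne: "column x \<noteq> column p" if "x \<in> T - {p}" for x using that tile_eqI[OF T] yz(1) by blast
  have "column ` T = column ` insert p (T - {p})" using yz(1) by (simp only: insert_Diff)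
  then have cols: "column ` insert q (T - {p}) = column ` T" using cp(2) by (simp only: image_insert)
  then show "lcol (insert q (T - {p})) = lcol T" "rcol (insert q (T - {p})) = rcol T"
    by (simp_all add: lcol_def rcol_def)
  have zy: "z \<in> T - {p}" "y \<in> T - {p}" using yz cp by auto
  show "is_tile (insert q (T - {p}))"
  proof (rule is_tileI)
    show "finite (insert q (T - {p}))" using T is_tile_imp(1) by simp
    show "inj_on column (insert q (T - {p}))"
          proof -
      have "inj_on column (T - {p})" using is_tile_imp(3)[OF T] by (rule inj_on_subset) blast
      moreover have "column q \<notin> column ` (T - {p} - {q})"
      proof
        assume "column q \<in> column ` (T - {p} - {q})"
        then obtain w where w: "w \<in> T - {p}" "column q = column w" by blast
        then show False using ne[OF w(1)] cp(2) by simp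
      qed
      ultimately show ?thesis unfolding inj_on_insert by blast
    qed
    fix x x' assume x: "x \<in> insert q (T - {p})" "x' \<in> insert q (T - {p})" "column x < column x'"
    show "NE x \<in> insert q (T - {p}) \<or> SE x \<in> insert q (T - {p})"
    proof (cases "x = q \<or> x = y")
      case True
      then show ?thesis using zy q by auto
    next
      case False
      then have xT: "x \<in> T" using x by blast
      obtain x'' where "x'' \<in> T" "column x'' = column x'" using x(2) cols by (metis imageE imageI)
      then have "NE x \<in> T \<or> SE x \<in> T" using is_tile_imp(4)[OF T xT] x(3) by simp
      moreover have "column x \<noteq> column y" using False tile_eqI[OF T xT yz(2)] by blast
      then have "NE x \<noteq> p" "SE x \<noteq> p" using cp by auto
      ultimately show ?thesis by blast
    qed
  qed simp
qed

text \<open>The ends of the tile stay, so it suffices that the new node does not exceed the maximal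
  height, which \<open>x\<close> witnesses.\<close>

lemma dyck_replace:
  assumes T: "is_dyck_tile T" and yz: "p \<in> T" "y \<in> T" "z \<in> T" "p \<in> {NE y, SE y}" "z \<in> {NE p, SE p}"
    and q: "q \<in> {NE y, SE y}" "z \<in> {NE q, SE q}" and x: "x \<in> T" "height q \<le> height x"
  shows "is_dyck_tile (insert q (T - {p}))"
proof -
  have t: "is_tile T" using T by (simp add: is_dyck_tile_def)
  note r = tile_replace[OF t yz q]
  have c: "lcol T < column q" "column q < rcol T"
    using lcol_le[OF t yz(2)] rcol_ge[OF t yz(3)] yz q by auto
  have D: "height m \<le> height w" if "w \<in> T" "column w = lcol T \<or> column w = rcol T" "m \<in> T" for w m
    using T that unfolding is_dyck_tile_iff by blast
  show ?thesis unfolding is_dyck_tile_iff r(2,3)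
  proof (intro conjI ballI impI r(1))
    fix w m assume w: "w \<in> insert q (T - {p})" "column w = lcol T \<or> column w = rcol T" and m: "m \<in> insert q (T - {p})"
    have "w \<in> T" using w c by auto
    then show "height m \<le> height w" using D[OF _ w(2), of m] D[OF _ w(2), of x] m x by auto
  qed
qed

lemma tile_of_image:
  assumes "inj p" "partition_on R D"
  shows "partition_on (p ` R) ((`) p ` D)" "x \<in> R \<Longrightarrow> tile_of ((`) p ` D) (p x) = p ` tile_of D x"
proof -
  have "{} \<notin> (`) p ` D" using partition_onD3[OF assms(2)] by auto
  then show *: "partition_on (p ` R) ((`) p ` D)"
    using partition_on_inj_image[OF assms(2), of p] assms(1) by (simp add: inj_on_subset[of p UNIV])
  show "tile_of ((`) p ` D) (p x) = p ` tile_of D x" if "x \<in> R"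
    using tile_of_eq[OF *, of "p ` tile_of D x" "p x"] tile_of_in[OF assms(2) that] by blast
qed


section \<open>Shifting a strip\<close>

text \<open>Adding (1,1) keeps the column and raises the height by 2, so a node one below its
  neighbours comes to lie one above them.\<close>

definition shift :: "int \<Rightarrow> node \<Rightarrow> node" where
  "shift l x = (if column x = l then (fst x + 1, snd x + 1) else x)"
definition unshift :: "int \<Rightarrow> node \<Rightarrow> node" where
  "unshift l x = (if column x = l then (fst x - 1, snd x - 1) else x)"

lemma column_shift [simp]: "column (shift l x) = column x" "column (unshift l x) = column x"
  by (auto simp: shift_def unshift_def column_def)

lemma unshift_shift [simp]: "unshift l (shift l x) = x" "shift l (unshift l x) = x"
  by (auto simp: shift_def unshift_def column_def)

lemma inj_shift: "inj (shift l)" "inj (unshift l)"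
  by (metis injI unshift_shift(1), metis injI unshift_shift(2))

lemma shift_off [simp]: "column x \<noteq> l \<Longrightarrow> shift l x = x" "column x \<noteq> l \<Longrightarrow> unshift l x = x"
  by (auto simp: shift_def unshift_def)

lemma shift_nN [simp]: "shift l (nN l a) = nN l (a + 1)" "unshift l (nN l a) = nN l (a - 1)"
  by (auto simp: shift_def unshift_def) (auto simp: nN_def)

text \<open>The extreme columns depend only on the set of columns, which a shift does not
  change.\<close>

lemma col_image_shift: "lcol (shift l ` T) = lcol T" "rcol (shift l ` T) = rcol T"
    "lcol (unshift l ` T) = lcol T" "rcol (unshift l ` T) = rcol T"
  by (simp_all add: lcol_def rcol_def image_image)

lemma image_off:
  assumes "\<And>x. x \<in> T \<Longrightarrow> column x \<noteq> l"
  shows "shift l ` T = T" "unshift l ` T = T"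
  using assms by (auto intro!: rev_image_eqI)

lemma image_on:
  assumes "is_tile T" "nN l a \<in> T"
  shows "shift l ` T = insert (nN l (a + 1)) (T - {nN l a})"
    "unshift l ` T = insert (nN l (a - 1)) (T - {nN l a})"
proof -
  have "column x \<noteq> l" if "x \<in> T - {nN l a}" for x
    using tile_eqI[OF assms(1) _ assms(2), of x] that by auto
  then have *: "shift l ` (T - {nN l a}) = T - {nN l a}" "unshift l ` (T - {nN l a}) = T - {nN l a}"
    using image_off[of "T - {nN l a}" l] by blast+
  have T: "T = insert (nN l a) (T - {nN l a})" using assms by blast
  show "shift l ` T = insert (nN l (a + 1)) (T - {nN l a})"
    by (subst T) (simp only: image_insert * shift_nN)
  show "unshift l ` T = insert (nN l (a - 1)) (T - {nN l a})"
    by (subst T) (simp only: image_insert * shift_nN)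
qed

lemma shift_mem [simp]: "shift l x \<in> shift l ` E \<longleftrightarrow> x \<in> E"
  by (metis imageE imageI unshift_shift(1))

lemma shift_mem_off: "column x \<noteq> l \<Longrightarrow> x \<in> shift l ` E \<longleftrightarrow> x \<in> E"
  using shift_mem[of l x E] by simp

lemma shift_mem_on: "nN l a \<in> shift l ` E \<longleftrightarrow> nN l (a - 1) \<in> E"
  using shift_mem[of l "nN l (a - 1)" E] by simp

text \<open>These are the comparisons of cover-expansiveness that avoid column \<open>l\<close>; a
  shift does not touch them.\<close>

definition off :: "int \<Rightarrow> node set \<Rightarrow> node set set \<Rightarrow> bool" where
  "off l E D \<longleftrightarrow>
    (\<forall>a. column a \<noteq> l \<longrightarrow> a \<in> E \<longrightarrow> column (SE a) \<noteq> l \<longrightarrow> SE a \<in> E \<longrightarrow> start_col D (SE a) \<le> start_col D a) \<and>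
    (\<forall>a. column a \<noteq> l \<longrightarrow> a \<in> E \<longrightarrow> column (SW a) \<noteq> l \<longrightarrow> SW a \<in> E \<longrightarrow> end_col D a \<le> end_col D (SW a))"

lemma off_start_col: "off l E D \<Longrightarrow> column a \<noteq> l \<Longrightarrow> a \<in> E \<Longrightarrow> column (SE a) \<noteq> l \<Longrightarrow> SE a \<in> E \<Longrightarrow> start_col D (SE a) \<le> start_col D a"
  and off_end_col: "off l E D \<Longrightarrow> column a \<noteq> l \<Longrightarrow> a \<in> E \<Longrightarrow> column (SW a) \<noteq> l \<Longrightarrow> SW a \<in> E \<Longrightarrow> end_col D a \<le> end_col D (SW a)"
  unfolding off_def by blast+

text \<open>What cover-expansiveness says across column \<open>l\<close>, expressed on the
  neighbouring columns. In a column of dips it arises by comparing \<open>nN l (a + 1)\<close> with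
  its lower neighbours, in a column of peaks by comparing it with its upper ones.\<close>

definition chain :: "int \<Rightarrow> int \<Rightarrow> int \<Rightarrow> node set set \<Rightarrow> bool" where
  "chain l al be D \<longleftrightarrow> (\<forall>a. al \<le> a \<longrightarrow> a + 1 < be \<longrightarrow>
    start_col D (nY l a) \<le> start_col D (nY l (a + 1)) \<and> end_col D (nZ l (a + 1)) \<le> end_col D (nZ l a))"

definition dip :: "int \<Rightarrow> int \<Rightarrow> int \<Rightarrow> node set set \<Rightarrow> bool" where
  "dip l al tp D \<longleftrightarrow> (\<forall>a. al \<le> a \<longrightarrow> a < tp \<longrightarrow>
    nY l a \<in> tile_of D (nN l a) \<and> nZ l a \<in> tile_of D (nN l a))"

text \<open>The shift raises the dip to height one more than \<open>nY l a\<close>, so this says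
  that the raised node does not exceed the maximal height of its tile.\<close>

definition strict_at :: "int \<Rightarrow> node set set \<Rightarrow> int \<Rightarrow> bool" where
  "strict_at l D a \<longleftrightarrow> (\<exists>x\<in>tile_of D (nN l a). height (nY l a) < height x)"

text \<open>These are the tilings that become cover-expansive Dyck tilings when column \<open>l\<close> is shifted.\<close>

definition liftable :: "int \<Rightarrow> int \<Rightarrow> int \<Rightarrow> int \<Rightarrow> node set \<Rightarrow> node set set \<Rightarrow> bool" where
  "liftable l al tp be E D \<longleftrightarrow> dyck_tiling E D \<and> dip l al tp D \<and>
    (\<forall>a. al \<le> a \<longrightarrow> a < tp \<longrightarrow> strict_at l D a) \<and> off l E D \<and> chain l al be D"

text \<open>The constraints on \<open>tp\<close> cover two cases: \<open>tp = be\<close> for a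
  complete column, and \<open>tp = be - 1\<close> when its top node has been removed.\<close>

locale strip =
  fixes E :: "node set" and l al tp be :: int
  assumes N: "nN l a \<in> E \<longleftrightarrow> al \<le> a \<and> a < tp"
    and Y: "nY l a \<in> E \<longleftrightarrow> al \<le> a \<and> a < be"
    and Z: "nZ l a \<in> E \<longleftrightarrow> al \<le> a \<and> a < be"
    and tb: "tp \<le> be" "be \<le> tp + 1"
begin

lemma dip_start_col:
  assumes "partition_on E D" "dip l al tp D" "al \<le> a" "a < tp"
  shows "start_col D (nN l a) = start_col D (nY l a)" "start_col D (nZ l a) = start_col D (nY l a)"
    "end_col D (nN l a) = end_col D (nZ l a)" "end_col D (nY l a) = end_col D (nZ l a)"
proof -
  have n: "nN l a \<in> E" using N assms by simp
  have "tile_of D (nY l a) = tile_of D (nN l a)" "tile_of D (nZ l a) = tile_of D (nN l a)"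
    using tile_of_eq_tile_of[OF assms(1) n] assms by (auto simp: dip_def)
  then show "start_col D (nN l a) = start_col D (nY l a)" "start_col D (nZ l a) = start_col D (nY l a)"
    "end_col D (nN l a) = end_col D (nZ l a)" "end_col D (nY l a) = end_col D (nZ l a)"
    by (simp_all add: start_col_def end_col_def)
qed

lemma shift_start_col:
  assumes "partition_on E D" "x \<in> E"
  shows "start_col ((`) (shift l) ` D) (shift l x) = start_col D x" "end_col ((`) (shift l) ` D) (shift l x) = end_col D x"
  using tile_of_image(2)[OF inj_shift(1) assms] by (simp_all add: start_col_def end_col_def col_image_shift)

lemma shift_start_col_off:
  assumes "partition_on E D" "x \<in> E" "column x \<noteq> l"
  shows "start_col ((`) (shift l) ` D) x = start_col D x" "end_col ((`) (shift l) ` D) x = end_col D x"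
  using shift_start_col[OF assms(1,2)] assms(3) by simp_all

lemma shift_start_col_on:
  assumes "partition_on E D" "nN l a \<in> E"
  shows "start_col ((`) (shift l) ` D) (nN l (a + 1)) = start_col D (nN l a)" "end_col ((`) (shift l) ` D) (nN l (a + 1)) = end_col D (nN l a)"
  using shift_start_col[OF assms] by simp_all

lemma liftable_imp_CE:
  assumes g: "liftable l al tp be E D"
  shows "(`) (shift l) ` D \<in> CE (shift l ` E)"
proof -
  let ?D = "(`) (shift l) ` D"
  have d: "dyck_tiling E D" "partition_on E D" "dip l al tp D" "off l E D" "chain l al be D"
    and st: "\<And>a. al \<le> a \<Longrightarrow> a < tp \<Longrightarrow> strict_at l D a"
    using g by (auto simp: liftable_def dyck_tiling_def)
  note dl = dip_start_col[OF d(2,3)] note sl = shift_start_col_off[OF d(2)] note sn = shift_start_col_on[OF d(2)]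
  have "is_dyck_tile (shift l ` T)" if T: "T \<in> D" for T
  proof (cases "\<exists>x\<in>T. column x = l")
    case False
    have "is_dyck_tile T" using T d(1) by (simp add: dyck_tiling_def)
    then show ?thesis using image_off(1)[of T l] False by auto
  next
    case True
    then obtain x where x: "x \<in> T" "column x = l" by blast
    define a where "a = fst x"
    have a: "nN l a \<in> T" using x column_eq_nN[OF x(2)] by (simp add: a_def)
    have te: "tile_of D (nN l a) = T" using tile_of_eq[OF d(2) T a] .
    have ar: "al \<le> a" "a < tp" using a N partition_on_subset[OF d(2) T] by blast+
    have yz: "nY l a \<in> T" "nZ l a \<in> T" using d(3) ar te by (auto simp: dip_def)
    \<comment> \<open>Strictness provides a node at least as high as the raised one, as
      \<open>dyck_replace\<close> demands.\<close>
    obtain w where w: "w \<in> T" "height (nY l a) < height w" using st[OF ar] te by (auto simp: strict_at_def)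
    have dt: "is_dyck_tile T" using T d(1) by (simp add: dyck_tiling_def)
    show ?thesis unfolding image_on(1)[OF dt[unfolded is_dyck_tile_def, THEN conjunct1] a]
      using w(2) by (intro dyck_replace[OF dt a yz _ _ _ _ w(1)]) (auto simp: nN_def nY_def nZ_def NE_def SE_def height_def)
  qed
  then have dt: "dyck_tiling (shift l ` E) ?D"
    using tile_of_image(1)[OF inj_shift(1) d(2)] by (auto simp: dyck_tiling_def)
  have "start_col ?D (SE a) \<le> start_col ?D a" if a: "a \<in> shift l ` E" "SE a \<in> shift l ` E" for a
  proof (cases "column a = l \<or> column (SE a) = l")
    case False
    then have "a \<in> E" "SE a \<in> E" using a shift_mem_off by blast+
    then show ?thesis using False off_start_col[OF d(4), of a] sl[of a] sl[of "SE a"] by simp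
  next
    case True
    then show ?thesis
    proof
      assume "column a = l"
      then obtain b where b: "a = nN l (b + 1)" using column_eq_nN by (metis diff_add_cancel)
      have "nN l b \<in> E" using a(1) unfolding b shift_mem_on by simp
      moreover have "SE a = nZ l b" using b by simp
      ultimately show ?thesis using sn[of b] sl[of "nZ l b"] dl[of b] N Z tb b by auto
    next
      assume c: "column (SE a) = l"
      then obtain b where b: "SE a = nN l (b + 1)" using column_eq_nN by (metis diff_add_cancel)
      then have a2: "a = nY l (b + 1)" by (metis inverse_steps(3) strip_steps(1))
      have n: "nN l b \<in> E" using a(2) unfolding b shift_mem_on by simp
      have y: "nY l (b + 1) \<in> E" using a(1) shift_mem_off[of a l] unfolding a2 by simp
      \<comment> \<open>The raised node lies in the tile of \<open>nY l b\<close> but is compared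
        with its new upper neighbour \<open>nY l (b + 1)\<close>: this is where the chain condition
        enters.\<close>
      have "start_col D (nY l b) \<le> start_col D (nY l (b + 1))" using d(5) n y N Y by (auto simp: chain_def)
      then show ?thesis unfolding a2 using sn[OF n] sl[OF y] dl[of b] n N by simp
    qed
  qed
  moreover have "end_col ?D a \<le> end_col ?D (SW a)" if a: "a \<in> shift l ` E" "SW a \<in> shift l ` E" for a
  proof (cases "column a = l \<or> column (SW a) = l")
    case False
    then have "a \<in> E" "SW a \<in> E" using a shift_mem_off by blast+
    then show ?thesis using False off_end_col[OF d(4), of a] sl[of a] sl[of "SW a"] by simp
  next
    case True
    then show ?thesis
    proof
      assume "column a = l"
      then obtain b where b: "a = nN l (b + 1)" using column_eq_nN by (metis diff_add_cancel)
      have "nN l b \<in> E" using a(1) unfolding b shift_mem_on by simp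
      moreover have "SW a = nY l b" using b by simp
      ultimately show ?thesis using sn[of b] sl[of "nY l b"] dl[of b] N Y tb b by auto
    next
      assume c: "column (SW a) = l"
      then obtain b where b: "SW a = nN l (b + 1)" using column_eq_nN by (metis diff_add_cancel)
      then have a2: "a = nZ l (b + 1)" by (metis inverse_steps(1) strip_steps(2))
      have n: "nN l b \<in> E" using a(2) unfolding b shift_mem_on by simp
      have y: "nZ l (b + 1) \<in> E" using a(1) shift_mem_off[of a l] unfolding a2 by simp
      have "end_col D (nZ l (b + 1)) \<le> end_col D (nZ l b)" using d(5) n y N Z by (auto simp: chain_def)
      then show ?thesis unfolding a2 using sn[OF n] sl[OF y] dl[of b] n N by simp
    qed
  qed
  ultimately show ?thesis unfolding CE_iff using dt by blast
qed

lemma CE_imp_liftable: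
  assumes "D' \<in> CE (shift l ` E)"
  shows "liftable l al tp be E ((`) (unshift l) ` D')"
proof -
  let ?E = "shift l ` E"
  define D where "D = (`) (unshift l) ` D'"
  note d = CE_D[OF assms]
  have "partition_on (unshift l ` ?E) D" unfolding D_def by (rule tile_of_image(1)[OF inj_shift(2) d(2)])
  then have p: "partition_on E D" by (simp add: image_image)
  have D': "D' = (`) (shift l) ` D" by (simp add: D_def image_image)
  note sl = shift_start_col_off[OF p, folded D'] note sn = shift_start_col_on[OF p, folded D']
  have peak: "nY l a \<in> tile_of D' (nN l (a + 1))" "nZ l a \<in> tile_of D' (nN l (a + 1))"
    if "al \<le> a" "a < tp" for a
    using that tb N Y Z
    by (intro peak_left[OF assms, of l al tp] peak_right[OF assms, of l al tp];
        simp add: shift_mem_on shift_mem_off)+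
  have tD: "tile_of D' (nN l (a + 1)) = shift l ` tile_of D (nN l a)" if "al \<le> a" "a < tp" for a
    using tile_of_image(2)[OF inj_shift(1) p, of "nN l a" l] that N by (simp add: D')
  have nin: "nN l (a + 1) \<in> ?E" if "al \<le> a" "a < tp" for a using that N by (simp add: shift_mem_on)
  have strict: "strict_at l D a" if a: "al \<le> a" "a < tp" for a
  proof -
    let ?T = "tile_of D' (nN l (a + 1))"
    have dt: "is_dyck_tile ?T" using d(1) tile_of_in(1)[OF d(2) nin[OF a]] by (simp add: dyck_tiling_def)
    then have t: "is_tile ?T" by (simp add: is_dyck_tile_def)
    \<comment> \<open>The start of the tile witnesses strictness: it is at least as high as the
      peak, and it lies left of column \<open>l\<close> because the peak has a left neighbour in the
      tile, so lowering the column leaves it in place.\<close>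
    obtain x where x: "x \<in> ?T" "column x = lcol ?T" using ex_lcol[OF t] by blast
    have "height (nN l (a + 1)) \<le> height x"
      using dt x tile_of_in(2)[OF d(2) nin[OF a]] unfolding is_dyck_tile_iff by blast
    then have "height (nY l a) < height x" by simp
    moreover have "column x < l" using lcol_le[OF t peak(1)[OF a]] x by simp
    then have "x \<in> tile_of D (nN l a)" using x(1) shift_mem_off[of x l] unfolding tD[OF a] by simp
    ultimately show ?thesis unfolding strict_at_def by blast
  qed
  have dp: "dip l al tp D" unfolding dip_def
    using peak tD shift_mem_off[of "nY l _" l] shift_mem_off[of "nZ l _" l] by simp
  have dt: "is_dyck_tile (unshift l ` T)" if T: "T \<in> D'" for T
  proof (cases "\<exists>x\<in>T. column x = l")
    case False
    have "is_dyck_tile T" using T d(1) by (simp add: dyck_tiling_def)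
    then show ?thesis using image_off(2)[of T l] False by auto
  next
    case True
    then obtain x where x: "x \<in> T" "column x = l" by blast
    define a where "a = fst x - 1"
    have a: "nN l (a + 1) \<in> T" using x column_eq_nN[OF x(2)] by (simp add: a_def)
    have te: "tile_of D' (nN l (a + 1)) = T" using tile_of_eq[OF d(2) T a] .
    have "nN l (a + 1) \<in> ?E" using a partition_on_subset[OF d(2) T] by blast
    then have ar: "al \<le> a" "a < tp" using N by (simp_all add: shift_mem_on)
    have yz: "nY l a \<in> T" "nZ l a \<in> T" using peak[OF ar] te by auto
    have dt: "is_dyck_tile T" using T d(1) by (simp add: dyck_tiling_def)
    have "is_dyck_tile (insert (nN l a) (T - {nN l (a + 1)}))"
      by (intro dyck_replace[OF dt a yz _ _ _ _ yz(1)]) (auto simp: nN_def nY_def nZ_def NE_def SE_def height_def)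
    then show ?thesis using image_on(2)[OF dt[unfolded is_dyck_tile_def, THEN conjunct1] a] by simp
  qed
  have "off l E D" unfolding off_def
    using d(3,4) sl shift_mem_off[of _ l E] by (metis (no_types, opaque_lifting))
  moreover have "chain l al be D" unfolding chain_def
  proof (intro allI impI)
    fix a assume a: "al \<le> a" "a + 1 < be"
    have at: "a < tp" using a tb by simp
    have "nY l (a + 1) \<in> ?E" "nZ l (a + 1) \<in> ?E" using Y Z a by (simp_all add: shift_mem_off)
    then have "start_col D' (nN l (a + 1)) \<le> start_col D' (nY l (a + 1))" "end_col D' (nZ l (a + 1)) \<le> end_col D' (nN l (a + 1))"
      using d(3)[of "nY l (a + 1)"] d(4)[of "nZ l (a + 1)"] nin[OF a(1) at] by simp_all
    then show "start_col D (nY l a) \<le> start_col D (nY l (a + 1)) \<and> end_col D (nZ l (a + 1)) \<le> end_col D (nZ l a)"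
      using sn[of a] sl[of "nY l (a + 1)"] sl[of "nZ l (a + 1)"] dip_start_col[OF p dp a(1) at] N Y Z a at by simp
  qed
  ultimately show ?thesis unfolding liftable_def
    using dt dp strict p by (auto simp: D_def[symmetric] dyck_tiling_def) (auto simp: D_def)
qed

lemma card_liftable: "card {D. liftable l al tp be E D} = card (CE (shift l ` E))"
proof -
  have "bij_betw ((`) ((`) (shift l))) {D. liftable l al tp be E D} (CE (shift l ` E))"
    by (rule bij_betw_byWitness[where f' = "(`) ((`) (unshift l))"])
      (use liftable_imp_CE CE_imp_liftable in \<open>auto simp: image_image\<close>)
  then show ?thesis by (rule bij_betw_same_card)
qed

end

locale full_strip = strip E l al be be for E l al be
begin

text \<open>A dip puts a node of column \<open>l\<close> and both its upper neighbours into one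
  tile, so those comparisons are trivial; the ones with the lower neighbours are the chain
  condition.\<close>

lemma CE_iff_dip: "D \<in> CE E \<longleftrightarrow> dyck_tiling E D \<and> dip l al be D \<and> off l E D \<and> chain l al be D"
proof
  assume D: "D \<in> CE E"
  note d = CE_D[OF D]
  have dp: "dip l al be D" unfolding dip_def
    using dip_left[OF D, of l al be] dip_right[OF D, of l al be] N Y Z by simp
  have "chain l al be D" unfolding chain_def
  proof (intro allI impI)
    fix a assume a: "al \<le> a" "a + 1 < be"
    have "start_col D (nZ l a) \<le> start_col D (nN l (a + 1))" "end_col D (nN l (a + 1)) \<le> end_col D (nY l a)"
      using d(3)[of "nN l (a + 1)"] d(4)[of "nN l (a + 1)"] N Y Z a by simp_all
    then show "start_col D (nY l a) \<le> start_col D (nY l (a + 1)) \<and> end_col D (nZ l (a + 1)) \<le> end_col D (nZ l a)"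
      using dip_start_col[OF d(2) dp, of a] dip_start_col[OF d(2) dp, of "a + 1"] a by simp
  qed
  then show "dyck_tiling E D \<and> dip l al be D \<and> off l E D \<and> chain l al be D"
    using d dp by (simp add: off_def)
next
  assume A: "dyck_tiling E D \<and> dip l al be D \<and> off l E D \<and> chain l al be D"
  then have p: "partition_on E D" by (simp add: dyck_tiling_def)
  have dp: "dip l al be D" using A by blast
  note dl = dip_start_col[OF p dp]
  have "start_col D (SE a) \<le> start_col D a" if a: "a \<in> E" "SE a \<in> E" for a
  proof (cases "column a = l \<or> column (SE a) = l")
    case False
    then show ?thesis using A a off_start_col[of l E D a] by blast
  next
    case True
    then show ?thesis
    proof
      assume "column a = l"
      then obtain b where b: "a = nN l (b + 1)" using column_eq_nN by (metis diff_add_cancel)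
      then have "al \<le> b" "b + 1 < be" using a N Z by auto
      then show ?thesis using dl[of b] dl[of "b + 1"] A b by (auto simp: chain_def)
    next
      assume "column (SE a) = l"
      then obtain b where b: "SE a = nN l b" using column_eq_nN by metis
      then have "a = nY l b" by (metis inverse_steps(3) strip_steps(1))
      then show ?thesis using dl[of b] b a N by auto
    qed
  qed
  moreover have "end_col D a \<le> end_col D (SW a)" if a: "a \<in> E" "SW a \<in> E" for a
  proof (cases "column a = l \<or> column (SW a) = l")
    case False
    then show ?thesis using A a off_end_col[of l E D a] by blast
  next
    case True
    then show ?thesis
    proof
      assume "column a = l"
      then obtain b where b: "a = nN l (b + 1)" using column_eq_nN by (metis diff_add_cancel)
      then have "al \<le> b" "b + 1 < be" using a N Y by auto
      then show ?thesis using dl[of b] dl[of "b + 1"] A b by (auto simp: chain_def)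
    next
      assume "column (SW a) = l"
      then obtain b where b: "SW a = nN l b" using column_eq_nN by metis
      then have "a = nZ l b" by (metis inverse_steps(1) strip_steps(2))
      then show ?thesis using dl[of b] b a N by auto
    qed
  qed
  ultimately show "D \<in> CE E" unfolding CE_iff using A by blast
qed

end


section \<open>Cutting and gluing the top tile of a strip\<close>

lemma tiles_disjoint:
  assumes "partition_on R D" "S \<in> D" "T \<in> D" "x \<in> S" "x \<notin> T"
  shows "S \<inter> T = {}"
  using assms by (metis disjointD partition_onD2)

lemma same_column_less:
  "column x = column y \<Longrightarrow> height x < height y \<Longrightarrow> fst x < fst y \<and> snd x < snd y"
  unfolding column_def height_def by presburger

lemma tile_restrict_left:
  assumes T: "is_tile T" "y \<in> T"
  shows "is_tile {x \<in> T. column x \<le> column y}" "lcol {x \<in> T. column x \<le> column y} = lcol T"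
    "rcol {x \<in> T. column x \<le> column y} = column y"
proof -
  let ?S = "{x \<in> T. column x \<le> column y}"
  show t: "is_tile ?S"
  proof (rule is_tileI)
    show "finite ?S" using is_tile_imp(1)[OF T(1)] by simp
    show "?S \<noteq> {}" using T(2) by blast
    show "inj_on column ?S" using is_tile_imp(3)[OF T(1)] by (rule inj_on_subset) blast
    fix x x' assume x: "x \<in> ?S" "x' \<in> ?S" "column x < column x'"
    then have "NE x \<in> T \<or> SE x \<in> T" using is_tile_imp(4)[OF T(1), of x x'] by simp
    then show "NE x \<in> ?S \<or> SE x \<in> ?S" using x by auto
  qed
  obtain s where s: "s \<in> T" "column s = lcol T" using ex_lcol[OF T(1)] by blast
  have "lcol ?S = column s" using s lcol_le[OF T(1)] T(2) by (intro lcol_eqI[OF t]) auto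
  then show "lcol ?S = lcol T" using s by simp
  show "rcol ?S = column y" using T(2) by (intro rcol_eqI[OF t]) auto
qed

lemma tile_restrict_right:
  assumes T: "is_tile T" "y \<in> T"
  shows "is_tile {x \<in> T. column y \<le> column x}" "rcol {x \<in> T. column y \<le> column x} = rcol T"
    "lcol {x \<in> T. column y \<le> column x} = column y"
proof -
  let ?S = "{x \<in> T. column y \<le> column x}"
  show t: "is_tile ?S"
  proof (rule is_tileI)
    show "finite ?S" using is_tile_imp(1)[OF T(1)] by simp
    show "?S \<noteq> {}" using T(2) by blast
    show "inj_on column ?S" using is_tile_imp(3)[OF T(1)] by (rule inj_on_subset) blast
    fix x x' assume x: "x \<in> ?S" "x' \<in> ?S" "column x < column x'"
    then have "NE x \<in> T \<or> SE x \<in> T" using is_tile_imp(4)[OF T(1), of x x'] by simp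
    then show "NE x \<in> ?S \<or> SE x \<in> ?S" using x by auto
  qed
  obtain s where s: "s \<in> T" "column s = rcol T" using ex_rcol[OF T(1)] by blast
  have "rcol ?S = column s" using s rcol_ge[OF T(1)] T(2) by (intro rcol_eqI[OF t]) auto
  then show "rcol ?S = rcol T" using s by simp
  show "lcol ?S = column y" using T(2) by (intro lcol_eqI[OF t]) auto
qed

text \<open>A node of maximal height is an admissible end for either piece.\<close>

lemma dyck_restrict:
  assumes T: "is_dyck_tile T" "y \<in> T" and h: "\<And>x. x \<in> T \<Longrightarrow> height x \<le> height y"
  shows "is_dyck_tile {x \<in> T. column x \<le> column y}" "is_dyck_tile {x \<in> T. column y \<le> column x}"
proof -
  have t: "is_tile T" using T(1) by (simp add: is_dyck_tile_def)
  note l = tile_restrict_left[OF t T(2)] and r = tile_restrict_right[OF t T(2)]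
  have y: "x = y" if "x \<in> T" "column x = column y" for x using tile_eqI[OF t that(1) T(2) that(2)] .
  have e: "height m \<le> height x" if "x \<in> T" "column x = lcol T \<or> column x = rcol T" "m \<in> T" for x m
    using T(1) that unfolding is_dyck_tile_iff by blast
  show "is_dyck_tile {x \<in> T. column x \<le> column y}"
    unfolding is_dyck_tile_iff l(2,3) using l(1) y e h by blast
  show "is_dyck_tile {x \<in> T. column y \<le> column x}"
    unfolding is_dyck_tile_iff r(2,3) using r(1) y e h by blast
qed

lemma tile_join:
  assumes L: "is_tile L" "nY l c \<in> L" "rcol L = l - 1" and R: "is_tile R" "nZ l c \<in> R" "lcol R = l + 1"
  shows "is_tile (insert (nN l c) (L \<union> R))" "lcol (insert (nN l c) (L \<union> R)) = lcol L"
    "rcol (insert (nN l c) (L \<union> R)) = rcol R"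
proof -
  let ?T = "insert (nN l c) (L \<union> R)"
  have cl: "column x \<le> l - 1" if "x \<in> L" for x using rcol_ge[OF L(1) that] L(3) by simp
  have cr: "l + 1 \<le> column x" if "x \<in> R" for x using lcol_le[OF R(1) that] R(3) by simp
  show t: "is_tile ?T"
  proof (rule is_tileI)
    show "finite ?T" using is_tile_imp(1)[OF L(1)] is_tile_imp(1)[OF R(1)] by simp
    show "inj_on column ?T"
    proof (rule inj_onI)
      fix x y assume xy: "x \<in> ?T" "y \<in> ?T" "column x = column y"
      consider "x = nN l c" | "x \<in> L" | "x \<in> R" using xy(1) by blast
      then show "x = y"
      proof cases
        case 1
        then have "column y = l" using xy(3) by simp
        then show ?thesis using xy(2) cl[of y] cr[of y] 1 by auto
      next
        case 2
        then have "y \<in> L" using xy cl[of x] cr[of y] by auto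
        then show ?thesis using tile_eqI[OF L(1) 2 _ xy(3)] by blast
      next
        case 3
        then have "y \<in> R" using xy cr[of x] cl[of y] by auto
        then show ?thesis using tile_eqI[OF R(1) 3 _ xy(3)] by blast
      qed
    qed
    fix x x' assume x: "x \<in> ?T" "x' \<in> ?T" "column x < column x'"
    consider "x = nN l c" | "x = nY l c" | "x \<in> L" "x \<noteq> nY l c" | "x \<in> R" using x(1) by blast
    then show "NE x \<in> ?T \<or> SE x \<in> ?T"
    proof cases
      case 3
      then have "column x \<noteq> l - 1" using tile_eqI[OF L(1) 3(1) L(2)] by auto
      then have "column x < rcol L" using cl[OF 3(1)] L(3) by simp
      then show ?thesis using tile_right[OF L(1) 3(1)] by blast
    next
      case 4
      then have "x' \<in> R" using x(2,3) cr[OF 4] cl[of x'] by auto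
      then show ?thesis using is_tile_imp(4)[OF R(1) 4 _ x(3)] by blast
    qed (use R(2) in auto)
  qed simp
  have ll: "lcol L \<le> l - 1" using lcol_le[OF L(1,2)] by simp
  have rr: "l + 1 \<le> rcol R" using rcol_ge[OF R(1,2)] by simp
  obtain s where s: "s \<in> L" "column s = lcol L" using ex_lcol[OF L(1)] by blast
  have "column s \<le> column y" if "y \<in> ?T" for y
    using that lcol_le[OF L(1), of y] cr[of y] ll s(2) by auto
  then show "lcol ?T = lcol L" using lcol_eqI[OF t, of s] s by simp
  obtain s where s: "s \<in> R" "column s = rcol R" using ex_rcol[OF R(1)] by blast
  have "column y \<le> column s" if "y \<in> ?T" for y
    using that rcol_ge[OF R(1), of y] cl[of y] rr s(2) by auto
  then show "rcol ?T = rcol R" using rcol_eqI[OF t, of s] s by simp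
qed

text \<open>As ends of Dyck tiles, \<open>nY l c\<close> and \<open>nZ l c\<close> have maximal
  height in \<open>L\<close> and in \<open>R\<close>, and these two heights agree.\<close>

lemma dyck_join:
  assumes L: "is_dyck_tile L" "nY l c \<in> L" "rcol L = l - 1" and R: "is_dyck_tile R" "nZ l c \<in> R" "lcol R = l + 1"
  shows "is_dyck_tile (insert (nN l c) (L \<union> R))"
    and "x \<in> insert (nN l c) (L \<union> R) \<Longrightarrow> height x \<le> height (nY l c)"
proof -
  have t: "is_tile L" "is_tile R" using L(1) R(1) by (simp_all add: is_dyck_tile_def)
  note j = tile_join[OF t(1) L(2,3) t(2) R(2,3)]
  have hl: "height x \<le> 2 * c + l + 1" if "x \<in> L" for x
    using L that unfolding is_dyck_tile_iff by (metis strip_column(2) strip_height(2))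
  have hr: "height x \<le> 2 * c + l + 1" if "x \<in> R" for x
    using R that unfolding is_dyck_tile_iff by (metis strip_column(3) strip_height(3))
  show h: "height x \<le> height (nY l c)" if "x \<in> insert (nN l c) (L \<union> R)" for x using that hl[of x] hr[of x] by auto
  have ll: "lcol L \<le> l - 1" using lcol_le[OF t(1) L(2)] by simp
  have rr: "l + 1 \<le> rcol R" using rcol_ge[OF t(2) R(2)] by simp
  show "is_dyck_tile (insert (nN l c) (L \<union> R))" unfolding is_dyck_tile_iff j(2,3)
  proof (intro conjI ballI impI j(1))
    fix x m assume x: "x \<in> insert (nN l c) (L \<union> R)" "column x = lcol L \<or> column x = rcol R"
      and m: "m \<in> insert (nN l c) (L \<union> R)"
    have "height (nY l c) \<le> height x"
      using x(2)
    proof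
      assume c: "column x = lcol L"
      then have "x \<in> L" using x(1) ll lcol_le[OF t(2), of x] R(3) by auto
      then show ?thesis using c L(1,2) unfolding is_dyck_tile_iff by blast
    next
      assume c: "column x = rcol R"
      then have "x \<in> R" using x(1) rr rcol_ge[OF t(1), of x] L(3) by auto
      then have "height (nZ l c) \<le> height x" using c R(1,2) unfolding is_dyck_tile_iff by blast
      then show ?thesis by simp
    qed
    then show "height m \<le> height x" using h[OF m] by simp
  qed
qed

lemma (in strip) chain_trans:
  assumes "chain l al be D" "al \<le> a" "a \<le> b" "b < be"
  shows "start_col D (nY l a) \<le> start_col D (nY l b) \<and> end_col D (nZ l b) \<le> end_col D (nZ l a)"
  using assms(3,4)
proof (induction rule: int_ge_induct)
  case (step b)
  then show ?case using assms(1)[unfolded chain_def, rule_format, of b] assms(2) by auto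
qed simp

section \<open>Strictness of the dips in a convex region\<close>

locale convex_strip = full_strip +
  assumes conv: "\<lbrakk>x \<in> E; z \<in> E; fst x \<le> fst y; fst y \<le> fst z; snd x \<le> snd y; snd y \<le> snd z\<rbrakk> \<Longrightarrow> y \<in> E"
begin

text \<open>A tile of the strip whose dip is as deep as the tile is high would be separated from the
  next tile of the strip by a third one, but there is no room for it in column \<open>l\<close>.\<close>

lemma strict_below:
  assumes D: "D \<in> CE E" and a: "al \<le> a" "a + 1 < be"
  shows "strict_at l D a"
proof (rule ccontr)
  assume ns: "\<not> strict_at l D a"
  note d = CE_D[OF D]
  have cd: "dip l al be D" "chain l al be D" using D CE_iff_dip by blast+
  let ?T = "tile_of D (nN l a)" and ?T' = "tile_of D (nN l (a + 1))"
  have n: "nN l a \<in> E" "nN l (a + 1) \<in> E" using N a by auto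
  have t: "is_tile ?T" "is_tile ?T'" using dyck_tiling_tile[OF d(1)] n by blast+
  have nT: "nN l a \<in> ?T" "nN l (a + 1) \<in> ?T'" using tile_of_in(2)[OF d(2)] n by blast+
  have hT: "height x \<le> 2 * a + l + 1" if "x \<in> ?T" for x using ns that unfolding strict_at_def by force
  have yT: "nY l (a + 1) \<in> ?T'" "nZ l (a + 1) \<in> ?T'" using cd(1) a unfolding dip_def by auto
  obtain s where s: "s \<in> ?T'" "column s = lcol ?T'" using ex_lcol[OF t(2)] by blast
  have dT': "is_dyck_tile ?T'" using d(1) tile_of_in(1)[OF d(2) n(2)] by (simp add: dyck_tiling_def)
  have hs: "2 * a + l + 3 \<le> height s" using dT' s yT(1) unfolding is_dyck_tile_iff by fastforce
  have cs: "column s \<le> l - 1" using lcol_le[OF t(2) yT(1)] s(2) by simp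
  have sE: "s \<in> E" using s(1) partition_on_subset[OF d(2) tile_of_in(1)[OF d(2) n(2)]] by blast
  have TE: "?T \<subseteq> E" using partition_on_subset[OF d(2) tile_of_in(1)[OF d(2) n(1)]] .
  have "start_col D (nY l a) \<le> start_col D (nY l (a + 1))" using cd(2) a by (simp add: chain_def)
  then have "start_col D (nN l a) \<le> start_col D (nN l (a + 1))" using dip_start_col(1)[OF d(2) cd(1)] a by simp
  then have lc: "lcol ?T \<le> column s" using s(2) by (simp add: start_col_def)
  have rT: "l \<le> rcol ?T" using rcol_ge[OF t(1) nT(1)] by simp
  show False
  proof (cases "lcol ?T = column s")
    case True
    obtain p where p: "p \<in> ?T" "column p = lcol ?T" using ex_lcol[OF t(1)] by blast
    have "fst p < fst s \<and> snd p < snd s" using True p hs hT[OF p(1)] by (intro same_column_less) auto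
    \<comment> \<open>If both tiles start in the same column, the node above the lower start lies
      between the two starts and so in \<open>E\<close>. Cover-expansiveness would then make the
      lower tile start further left.\<close>
    then have q: "NW p \<in> E" using conv[of p s "NW p"] TE p(1) sE by (auto simp: NW_def)
    have pE: "p \<in> E" using TE p(1) by blast
    have "start_col D p \<le> start_col D (NW p)" using d(3)[OF q] pE by simp
    also have "\<dots> \<le> column p - 1" using start_col_le[OF d(1) q] by simp
    finally show False using p tile_of_eq_tile_of[OF d(2) n(1) p(1)] by (simp add: start_col_def)
  next
    case False
    then obtain u where u: "u \<in> ?T" "column u = column s - 1"
      using tile_ex_column[OF t(1), of "column s - 1"] lc cs rT by auto
    \<comment> \<open>If \<open>T'\<close> starts further right than \<open>T\<close>, the node just
      before its start lies above \<open>T\<close> and so in \<open>E\<close>. Its tile must end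
      weakly right of \<open>T'\<close>, hence it crosses column \<open>l\<close>.\<close>
    let ?w = "SW s"
    have hu: "height u < height ?w" using hT[OF u(1)] hs by simp
    then have "fst u < fst ?w \<and> snd u < snd ?w" using u(2) by (intro same_column_less) auto
    then have wE: "?w \<in> E" using conv[of u s ?w] TE u(1) sE by (auto simp: SW_def)
    let ?S = "tile_of D ?w"
    have tS: "is_tile ?S" "?w \<in> ?S" using dyck_tiling_tile[OF d(1) wE] tile_of_in(2)[OF d(2) wE] by auto
    have "end_col D s \<le> end_col D ?w" using d(4)[OF sE wE] .
    moreover have "l + 1 \<le> end_col D s"
      using rcol_ge[OF t(2) yT(2)] tile_of_eq_tile_of[OF d(2) n(2) s(1)] by (simp add: end_col_def)
    ultimately have rS: "l + 1 \<le> rcol ?S" by (simp add: end_col_def)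
    obtain m where m: "m \<in> ?S" "column m = l"
      using tile_ex_column[OF tS(1), of l] rS lcol_le[OF tS] cs by auto
    have wT': "?w \<notin> ?T'" using lcol_le[OF t(2), of ?w] s(2) by auto
    have SD: "?S \<in> D" "?T \<in> D" "?T' \<in> D" using tile_of_in(1)[OF d(2)] wE n by blast+
    have dis': "?S \<inter> ?T' = {}" using tiles_disjoint[OF d(2) SD(1,3) tS(2) wT'] .
    have "?w \<notin> ?T" using tile_eqI[OF t(1) _ u(1), of ?w] u(2) hu by auto
    then have dis: "?T \<inter> ?S = {}" using tiles_disjoint[OF d(2) SD(1,2) tS(2)] by blast
    \<comment> \<open>\<open>NE ?w\<close> is \<open>s\<close>, which belongs to \<open>T'\<close>.
      So the tile of \<open>?w\<close> passes below \<open>s\<close> and stays between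
      \<open>T\<close> and \<open>T'\<close>; but in column \<open>l\<close> there is no node
      between \<open>nN l a\<close> and \<open>nN l (a + 1)\<close>.\<close>
    have "NE ?w \<in> ?S \<or> SE ?w \<in> ?S" using tile_right[OF tS] rS cs by simp
    moreover have "s \<notin> ?S" using dis' s(1) by blast
    ultimately have v: "SE ?w \<in> ?S" by simp
    have "height m < height (nN l (a + 1))"
      using noncrossing[OF tS(1) t(2) dis' v s(1) _ _ m(1) nT(2)] m(2) by simp
    moreover have "height (nN l a) < height m"
      using noncrossing[OF t(1) tS(1) dis u(1) tS(2) _ hu nT(1) m(1)] m(2) u(2) by simp
    moreover have "m = nN l (fst m)" using column_eq_nN[OF m(2)] .
    then have "height m = 2 * fst m + l" by (metis strip_height(1))
    ultimately show False by simp
  qed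
qed

end


text \<open>The tilings \<open>D\<close> and \<open>D1\<close> differ in that the tile \<open>insert n (L \<union> M)\<close> of \<open>D\<close> is cut at \<open>n\<close>.\<close>

locale cut_tile = convex_strip +
  fixes c :: int and D0 D D1 :: "node set set" and L M T :: "node set"
  assumes c: "c = be - 1" "al < be"
    and D: "D = insert T D0" "partition_on E D" "T \<notin> D0"
    and D1: "D1 = insert L (insert M D0)" "partition_on (E - {nN l c}) D1" "L \<notin> D0" "M \<notin> D0"
    and T: "T = insert (nN l c) (L \<union> M)" "is_dyck_tile T" "\<And>x. x \<in> T \<Longrightarrow> height x \<le> height (nY l c)"
    and L: "is_dyck_tile L" "rcol L = l - 1" "nY l c \<in> L" "lcol T = lcol L"
    and M: "is_dyck_tile M" "lcol M = l + 1" "nZ l c \<in> M" "rcol T = rcol M"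
    and D0: "\<And>S. S \<in> D0 \<Longrightarrow> is_dyck_tile S"
begin

sublocale cut: strip "E - {nN l c}" l al c be
proof
  fix a
  show "nN l a \<in> E - {nN l c} \<longleftrightarrow> al \<le> a \<and> a < c" using N[of a] c(1) by auto
  show "nY l a \<in> E - {nN l c} \<longleftrightarrow> al \<le> a \<and> a < be" using Y[of a] by simp
  show "nZ l a \<in> E - {nN l c} \<longleftrightarrow> al \<le> a \<and> a < be" using Z[of a] by simp
qed (use c(1) in simp_all)

lemma tiles: "is_tile L" "is_tile M" "is_tile T"
  using L(1) M(1) T(2) by (simp_all add: is_dyck_tile_def)

lemma dyck_tilings: "dyck_tiling E D" "dyck_tiling (E - {nN l c}) D1"
  using D D1 D0 L(1) M(1) T(2) by (auto simp: dyck_tiling_def)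

lemma cols: "x \<in> L \<Longrightarrow> column x < l" "x \<in> M \<Longrightarrow> l < column x"
  using rcol_ge[OF tiles(1), of x] lcol_le[OF tiles(2), of x] L(2) M(2) by simp_all

lemma sub: "L \<subseteq> E - {nN l c}" "M \<subseteq> E - {nN l c}"
  using partition_onD1[OF D1(2)] D1(1) by auto

lemma tile_of_cut:
  "x \<in> L \<Longrightarrow> tile_of D1 x = L" "x \<in> M \<Longrightarrow> tile_of D1 x = M" "x \<in> T \<Longrightarrow> tile_of D x = T"
  using tile_of_eq[OF D1(2)] tile_of_eq[OF D(2)] D D1 by auto

lemma tile_of_same:
  assumes "x \<in> E" "x \<notin> T"
  shows "tile_of D1 x = tile_of D x"
proof -
  have "tile_of D x \<in> D0" using tile_of_in[OF D(2) assms(1)] assms(2) D(1) by auto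
  then show ?thesis using tile_of_eq[OF D1(2) _ tile_of_in(2)[OF D(2) assms(1)]] D1(1) by simp
qed

text \<open>Cutting moves starts only to the right, and only on \<open>M\<close>; it moves ends only
  to the left, and only on \<open>L\<close>.\<close>

lemma start_col_cut:
  assumes "x \<in> E" "x \<noteq> nN l c"
  shows "x \<notin> M \<Longrightarrow> start_col D1 x = start_col D x" "x \<in> M \<Longrightarrow> start_col D1 x = l + 1" "start_col D x \<le> start_col D1 x"
    "x \<notin> L \<Longrightarrow> end_col D1 x = end_col D x" "x \<in> L \<Longrightarrow> end_col D1 x = l - 1" "end_col D1 x \<le> end_col D x"
proof -
  have *: "lcol T \<le> l - 1" "l + 1 \<le> rcol T"
    using lcol_le[OF tiles(1) L(3)] rcol_ge[OF tiles(2) M(3)] L(4) M(4) by simp_all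
  consider "x \<in> L" "x \<notin> M" | "x \<in> M" "x \<notin> L" | "x \<notin> T" "x \<notin> L" "x \<notin> M"
    using assms(2) T(1) cols[of x] by fastforce
  then have "(x \<notin> M \<longrightarrow> start_col D1 x = start_col D x) \<and> (x \<in> M \<longrightarrow> start_col D1 x = l + 1) \<and> start_col D x \<le> start_col D1 x \<and>
    (x \<notin> L \<longrightarrow> end_col D1 x = end_col D x) \<and> (x \<in> L \<longrightarrow> end_col D1 x = l - 1) \<and> end_col D1 x \<le> end_col D x"
    using tile_of_cut[of x] tile_of_same[OF assms(1)] T(1) L(2,4) M(2,4) * by cases (simp_all add: start_col_def end_col_def)
  then show "x \<notin> M \<Longrightarrow> start_col D1 x = start_col D x" "x \<in> M \<Longrightarrow> start_col D1 x = l + 1" "start_col D x \<le> start_col D1 x"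
    "x \<notin> L \<Longrightarrow> end_col D1 x = end_col D x" "x \<in> L \<Longrightarrow> end_col D1 x = l - 1" "end_col D1 x \<le> end_col D x"
    by simp_all
qed

lemma strip_not_cut:
  "nY l a \<notin> M" "nZ l a \<notin> L" "nN l a \<notin> L" "nN l a \<notin> M" "a \<noteq> c \<Longrightarrow> nN l a \<notin> T"
proof -
  show *: "nY l a \<notin> M" "nZ l a \<notin> L" "nN l a \<notin> L" "nN l a \<notin> M"
    using cols(2)[of "nY l a"] cols(1)[of "nZ l a"] cols(1)[of "nN l a"] cols(2)[of "nN l a"] by auto
  show "a \<noteq> c \<Longrightarrow> nN l a \<notin> T" using T(1) * by auto
qed

text \<open>The chain condition looks at starts in column \<open>l - 1\<close>, which misses
  \<open>M\<close>, and at ends in column \<open>l + 1\<close>, which misses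
  \<open>L\<close>.\<close>

lemma chain_cut: "chain l al be D1 \<longleftrightarrow> chain l al be D"
proof -
  have "start_col D1 (nY l a) = start_col D (nY l a)" "end_col D1 (nZ l a) = end_col D (nZ l a)" if "al \<le> a" "a < be" for a
    using start_col_cut(1,4) strip_not_cut that Y Z by auto
  then show ?thesis unfolding chain_def by simp
qed

lemma tile_of_N: "al \<le> a \<Longrightarrow> a < c \<Longrightarrow> tile_of D1 (nN l a) = tile_of D (nN l a)"
  using tile_of_same[of "nN l a"] strip_not_cut(5)[of a] N c by simp

lemma dip_cut: "dip l al c D1 \<longleftrightarrow> dip l al be D"
proof -
  have "nY l c \<in> tile_of D (nN l c)" "nZ l c \<in> tile_of D (nN l c)"
    using tile_of_cut(3)[of "nN l c"] T(1) L(3) M(3) by auto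
  moreover have "a < be \<longleftrightarrow> a < c \<or> a = c" for a using c by auto
  ultimately show ?thesis unfolding dip_def using tile_of_N by auto
qed

lemma not_strict: "\<not> strict_at l D c"
  using T tile_of_cut(3)[of "nN l c"] by (force simp: strict_at_def)

text \<open>For starts, the critical case is \<open>SE a\<close> in \<open>M\<close> with
  \<open>a\<close> in another tile. That tile runs above \<open>T\<close>; if it started left of
  column \<open>l + 1\<close>, it would meet column \<open>l\<close> above \<open>nN l c\<close>,
  the topmost node there. The case of ends is the mirror image.\<close>

lemma off_cut:
  assumes CE: "D \<in> CE E"
  shows "off l (E - {nN l c}) D1"
proof -
  note d = CE_D[OF CE]
  have nc: "nN l c \<in> T" using T(1) by blast
  have TD: "T \<in> D" using D(1) by blast
  have "start_col D1 (SE a) \<le> start_col D1 a"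
    if a: "column a \<noteq> l" "a \<in> E" "a \<noteq> nN l c" "column (SE a) \<noteq> l" "SE a \<in> E" "SE a \<noteq> nN l c" for a
  proof (cases "SE a \<in> M")
    case False
    have "start_col D1 (SE a) = start_col D (SE a)" using start_col_cut(1) a False by blast
    also have "\<dots> \<le> start_col D a" using d(3) a by blast
    also have "\<dots> \<le> start_col D1 a" using start_col_cut(3) a by blast
    finally show ?thesis .
  next
    case True
    then have e: "start_col D1 (SE a) = l + 1" using start_col_cut(2) a by blast
    show ?thesis
    proof (cases "a \<in> M")
      case True
      then show ?thesis using start_col_cut(2) a e by simp
    next
      case aM: False
      have ca: "l < column a" using cols(2)[OF True] a(1) by simp
      have "a \<notin> L" using cols(1)[of a] ca by auto
      then have aT: "a \<notin> T" using T(1) aM a(3) by blast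
      have SaT: "SE a \<in> T" using True T(1) by blast
      have "lcol T < column (SE a)" using lcol_le[OF tiles(3) nc] ca by simp
      then have u: "SW (SE a) \<in> T" using tile_left[OF tiles(3) SaT] aT by simp
      have "l + 1 \<le> start_col D a"
      proof (rule ccontr)
        assume "\<not> l + 1 \<le> start_col D a"
        then have "lcol (tile_of D a) \<le> l" by (simp add: start_col_def)
        moreover have ta: "is_tile (tile_of D a)" "a \<in> tile_of D a"
          using dyck_tiling_tile[OF d(1) a(2)] tile_of_in(2)[OF d(2) a(2)] by auto
        ultimately obtain m where m: "m \<in> tile_of D a" "column m = l"
          using tile_ex_column[of "tile_of D a" l] rcol_ge[OF ta] ca by auto
        have dis: "T \<inter> tile_of D a = {}"
          using tiles_disjoint[OF d(2) tile_of_in(1)[OF d(2) a(2)] TD ta(2) aT] by blast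
        have "height (nN l c) < height m"
          using noncrossing[OF tiles(3) ta(1) dis u ta(2) _ _ nc m(1)] m(2) by simp
        moreover have mE: "nN l (fst m) \<in> E" "m = nN l (fst m)"
          using m partition_on_subset[OF d(2) tile_of_in(1)[OF d(2) a(2)]] column_eq_nN[OF m(2)] by auto
        moreover have "fst m \<le> c" using mE(1) N c by simp
        ultimately show False by (metis linorder_not_less strip_height(1) add_le_cancel_right mult_left_mono zero_le_numeral)
      qed
      then show ?thesis using e start_col_cut(3)[OF a(2,3)] by simp
    qed
  qed
  moreover have "end_col D1 a \<le> end_col D1 (SW a)"
    if a: "column a \<noteq> l" "a \<in> E" "a \<noteq> nN l c" "column (SW a) \<noteq> l" "SW a \<in> E" "SW a \<noteq> nN l c" for a
  proof (cases "a \<in> L")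
    case e: False
    show ?thesis
    proof (cases "SW a \<in> L")
      case False
      have "end_col D1 a = end_col D a" using start_col_cut(4) a e by blast
      also have "\<dots> \<le> end_col D (SW a)" using d(4) a by blast
      also have "\<dots> = end_col D1 (SW a)" using start_col_cut(4) a False by simp
      finally show ?thesis .
    next
      case True
      have cS: "column (SW a) < l" using cols(1)[OF True] .
      have ca: "column a < l" using cS a(1) by simp
      have "a \<notin> M" using cols(2)[of a] ca by auto
      then have aT: "a \<notin> T" using T(1) e a(3) by blast
      have SaT: "SW a \<in> T" using True T(1) by blast
      have "column (SW a) < rcol T" using rcol_ge[OF tiles(3) nc] ca by simp
      then have u: "SE (SW a) \<in> T" using tile_right[OF tiles(3) SaT] aT by simp
      have "end_col D a \<le> l - 1"
      proof (rule ccontr)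
        assume "\<not> end_col D a \<le> l - 1"
        then have "l \<le> rcol (tile_of D a)" by (simp add: end_col_def)
        moreover have ta: "is_tile (tile_of D a)" "a \<in> tile_of D a"
          using dyck_tiling_tile[OF d(1) a(2)] tile_of_in(2)[OF d(2) a(2)] by auto
        ultimately obtain m where m: "m \<in> tile_of D a" "column m = l"
          using tile_ex_column[of "tile_of D a" l] lcol_le[OF ta] ca by auto
        have dis: "T \<inter> tile_of D a = {}"
          using tiles_disjoint[OF d(2) tile_of_in(1)[OF d(2) a(2)] TD ta(2) aT] by blast
        have "height (nN l c) < height m"
          using noncrossing[OF tiles(3) ta(1) dis u ta(2) _ _ nc m(1)] m(2) by simp
        moreover have mE: "nN l (fst m) \<in> E" "m = nN l (fst m)"
          using m partition_on_subset[OF d(2) tile_of_in(1)[OF d(2) a(2)]] column_eq_nN[OF m(2)] by auto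
        moreover have "fst m \<le> c" using mE(1) N c by simp
        ultimately show False by (metis linorder_not_less strip_height(1) add_le_cancel_right mult_left_mono zero_le_numeral)
      qed
      then show ?thesis using start_col_cut(5)[OF a(5,6) True] start_col_cut(6)[OF a(2,3)] by simp
    qed
  next
    case True
    then have e: "end_col D1 a = l - 1" using start_col_cut(5) a by blast
    have "SW a \<notin> M" using cols(1)[OF True] cols(2)[of "SW a"] by auto
    show ?thesis
    proof (cases "SW a \<in> L")
      case True
      then show ?thesis using start_col_cut(5)[OF a(5,6)] e by simp
    next
      case False
      have "end_col D1 a \<le> end_col D a" using start_col_cut(6) a by blast
      also have "\<dots> \<le> end_col D (SW a)" using d(4) a by blast
      also have "\<dots> = end_col D1 (SW a)" using start_col_cut(4) a False by simp
      finally show ?thesis .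
    qed
  qed
  ultimately show ?thesis unfolding off_def by blast
qed

lemma CE_imp_liftable_cut:
  assumes CE: "D \<in> CE E"
  shows "liftable l al c be (E - {nN l c}) D1"
proof -
  have d: "dip l al be D" "chain l al be D" using CE CE_iff_dip by blast+
  have "strict_at l D1 a" if "al \<le> a" "a < c" for a
    using strict_below[OF CE, of a] that c tile_of_N[OF that] by (simp add: strict_at_def)
  then show ?thesis unfolding liftable_def
    using dyck_tilings(2) d dip_cut chain_cut off_cut[OF CE] by blast
qed

text \<open>For starts, the critical case is \<open>a\<close> in \<open>M\<close> with
  \<open>SE a\<close> in another tile, since gluing moves the start of \<open>a\<close> to that of
  \<open>L\<close>. The other tile reaches column \<open>l + 1\<close> below \<open>M\<close>, in
  some \<open>nZ l b\<close> with \<open>b < c\<close>; it has a dip there, so the chain condition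
  bounds its start by that of \<open>L\<close>. The case of ends is the mirror image.\<close>

lemma off_glue:
  assumes g: "liftable l al c be (E - {nN l c}) D1"
  shows "off l E D"
proof -
  have o: "off l (E - {nN l c}) D1" and dp: "dip l al c D1" and ch: "chain l al be D1"
    using g by (simp_all add: liftable_def)
  note dt = dyck_tilings
  have D1M: "M \<in> D1" "L \<in> D1" using D1(1) by auto
  have E1: "a \<in> E - {nN l c}" if "a \<in> E" "column a \<noteq> l" for a using that by auto
  have lsL: "start_col D1 (nY l c) = lcol L" "end_col D1 (nZ l c) = rcol M" using tile_of_cut L(3) M(3) by (simp_all add: start_col_def end_col_def)
  have "start_col D (SE a) \<le> start_col D a" if a: "column a \<noteq> l" "a \<in> E" "column (SE a) \<noteq> l" "SE a \<in> E" for a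
  proof -
    have a1: "a \<in> E - {nN l c}" "SE a \<in> E - {nN l c}" using E1 a by blast+
    have le: "start_col D1 (SE a) \<le> start_col D1 a" using off_start_col[OF o a(1) a1(1) a(3) a1(2)] .
    have le': "start_col D (SE a) \<le> start_col D1 (SE a)" using start_col_cut(3)[of "SE a"] a1 by blast
    show ?thesis
    proof (cases "a \<in> M")
      case False
      then have "start_col D1 a = start_col D a" using start_col_cut(1)[of a] a1 by blast
      then show ?thesis using le le' by simp
    next
      case aM: True
      have lsa: "start_col D a = lcol L" using aM T(1) tile_of_cut(3)[of a] L(4) by (simp add: start_col_def)
      show ?thesis
      proof (cases "SE a \<in> M")
        case True
        then show ?thesis using lsa T(1) tile_of_cut(3)[of "SE a"] L(4) by (simp add: start_col_def)
      next
        case False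
        let ?X = "tile_of D1 (SE a)"
        have tX: "is_tile ?X" "SE a \<in> ?X" "?X \<in> D1"
          using dyck_tiling_tile[OF dt(2) a1(2)] tile_of_in[OF D1(2) a1(2)] by auto
        have ca: "l < column a" using cols(2)[OF aM] .
        have lX: "lcol ?X \<le> l + 1" using le start_col_cut(2)[of a] aM a1 by (simp add: start_col_def)
        have dis: "?X \<inter> M = {}" using tiles_disjoint[OF D1(2) tX(3) D1M(1) tX(2) False] .
        then have "NW (SE a) \<notin> ?X" using aM by auto
        then have u: "SW (SE a) \<in> ?X" using tile_left[OF tX(1,2)] lX ca by simp
        obtain v where v: "v \<in> ?X" "column v = l + 1"
          using tile_ex_column[OF tX(1) lX] rcol_ge[OF tX(1,2)] ca by auto
        have hv: "height v < height (nZ l c)"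
          using noncrossing[OF tX(1) tiles(2) dis u aM _ _ v(1) M(3)] v(2) by simp
        define b where "b = fst v"
        have vb: "v = nZ l b" using v(2) unfolding b_def nZ_def column_def by (cases v) auto
        have "v \<in> E" using v(1) partition_on_subset[OF D1(2) tX(3)] by blast
        then have b: "al \<le> b" "b < c" using vb Z hv by auto
        have "start_col D (SE a) \<le> start_col D1 (SE a)" using le' .
        also have "\<dots> = start_col D1 (nZ l b)"
          using tile_of_eq_tile_of[OF D1(2) a1(2) v(1)] by (simp add: start_col_def vb)
        also have "\<dots> = start_col D1 (nY l b)" using cut.dip_start_col(2)[OF D1(2) dp b] .
        also have "\<dots> \<le> start_col D1 (nY l c)" using cut.chain_trans[OF ch b(1), of c] b c by simp
        finally show ?thesis using lsL lsa by simp
      qed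
    qed
  qed
  moreover have "end_col D a \<le> end_col D (SW a)" if a: "column a \<noteq> l" "a \<in> E" "column (SW a) \<noteq> l" "SW a \<in> E" for a
  proof -
    have a1: "a \<in> E - {nN l c}" "SW a \<in> E - {nN l c}" using E1 a by blast+
    have le: "end_col D1 a \<le> end_col D1 (SW a)" using off_end_col[OF o a(1) a1(1) a(3) a1(2)] .
    have le': "end_col D1 (SW a) \<le> end_col D (SW a)" using start_col_cut(6)[of "SW a"] a1 by blast
    show ?thesis
    proof (cases "a \<in> L")
      case False
      then have "end_col D1 a = end_col D a" using start_col_cut(4)[of a] a1 by blast
      then show ?thesis using le le' by simp
    next
      case aL: True
      have rsa: "end_col D a = rcol M" using aL T(1) tile_of_cut(3)[of a] M(4) by (simp add: end_col_def)
      show ?thesis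
      proof (cases "SW a \<in> L")
        case True
        then show ?thesis using rsa T(1) tile_of_cut(3)[of "SW a"] M(4) by (simp add: end_col_def)
      next
        case SL: False
        let ?X = "tile_of D1 (SW a)"
        have tX: "is_tile ?X" "SW a \<in> ?X" "?X \<in> D1"
          using dyck_tiling_tile[OF dt(2) a1(2)] tile_of_in[OF D1(2) a1(2)] by auto
        have ca: "column a < l" using cols(1)[OF aL] .
        have lX: "l - 1 \<le> rcol ?X" using le start_col_cut(5)[of a] aL a1 by (simp add: end_col_def)
        have dis: "?X \<inter> L = {}" using tiles_disjoint[OF D1(2) tX(3) D1M(2) tX(2) SL] .
        then have "NE (SW a) \<notin> ?X" using aL by auto
        then have u: "SE (SW a) \<in> ?X" using tile_right[OF tX(1,2)] lX ca by simp
        obtain v where v: "v \<in> ?X" "column v = l - 1"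
          using tile_ex_column[OF tX(1) _ lX] lcol_le[OF tX(1,2)] ca by auto
        have hv: "height v < height (nY l c)"
          using noncrossing[OF tX(1) tiles(1) dis u aL _ _ v(1) L(3)] v(2) by simp
        define b where "b = fst v - 1"
        have vb: "v = nY l b" using v(2) unfolding b_def nY_def column_def by (cases v) auto
        have "v \<in> E" using v(1) partition_on_subset[OF D1(2) tX(3)] by blast
        then have b: "al \<le> b" "b < c" using vb Y hv by auto
        have "rcol M \<le> end_col D1 (nZ l b)" using cut.chain_trans[OF ch b(1), of c] b c lsL by simp
        also have "\<dots> = end_col D1 (nY l b)" using cut.dip_start_col(4)[OF D1(2) dp b] by simp
        also have "\<dots> = end_col D1 (SW a)"
          using tile_of_eq_tile_of[OF D1(2) a1(2) v(1)] by (simp add: end_col_def vb)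
        finally show ?thesis using le' rsa by simp
      qed
    qed
  qed
  ultimately show ?thesis unfolding off_def by blast
qed

end


context cut_tile begin

lemma liftable_imp_CE_glue:
  assumes "liftable l al c be (E - {nN l c}) D1"
  shows "D \<in> CE E"
  using assms dyck_tilings(1) dip_cut off_glue[OF assms] chain_cut unfolding CE_iff_dip liftable_def by blast

end

section \<open>The bijection between cutting and gluing\<close>

definition lpart :: "int \<Rightarrow> node set \<Rightarrow> node set" where "lpart l T = {x \<in> T. column x \<le> l - 1}"
definition rpart :: "int \<Rightarrow> node set \<Rightarrow> node set" where "rpart l T = {x \<in> T. l + 1 \<le> column x}"

definition cut_tiling :: "int \<Rightarrow> int \<Rightarrow> node set set \<Rightarrow> node set set" where
  "cut_tiling l c D = (let T = tile_of D (nN l c) in insert (lpart l T) (insert (rpart l T) (D - {T})))"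

definition glue_tiling :: "int \<Rightarrow> int \<Rightarrow> node set set \<Rightarrow> node set set" where
  "glue_tiling l c D = (let L = tile_of D (nY l c); M = tile_of D (nZ l c) in
     insert (insert (nN l c) (L \<union> M)) (D - {L, M}))"

context convex_strip begin

lemma cut_tile_cut:
  assumes ab: "al < be" and c: "c = be - 1" and CE: "D \<in> CE E" and ns: "\<not> strict_at l D c"
  defines "T \<equiv> tile_of D (nN l c)"
  shows "cut_tile E l al be c (D - {T}) D (cut_tiling l c D) (lpart l T) (rpart l T) T"
proof -
  note d = CE_D(1,2)[OF CE]
  have n: "nN l c \<in> E" using N c ab by simp
  have TD: "T \<in> D" "nN l c \<in> T" using tile_of_in[OF d(2) n] by (simp_all add: T_def)
  have dT: "is_dyck_tile T" using d(1) TD(1) by (simp add: dyck_tiling_def)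
  then have t: "is_tile T" by (simp add: is_dyck_tile_def)
  have y: "nY l c \<in> T" "nZ l c \<in> T" using CE ab c unfolding CE_iff_dip dip_def T_def by auto
  have h: "height x \<le> height (nY l c)" if "x \<in> T" for x using ns that unfolding strict_at_def T_def by force
  then have h': "height x \<le> height (nZ l c)" if "x \<in> T" for x using that by simp
  have lp: "lpart l T = {x \<in> T. column x \<le> column (nY l c)}" "rpart l T = {x \<in> T. column (nZ l c) \<le> column x}"
    by (simp_all add: lpart_def rpart_def)
  note L = tile_restrict_left[OF t y(1), folded lp] and M = tile_restrict_right[OF t y(2), folded lp]
  note dL = dyck_restrict(1)[OF dT y(1) h, folded lp] and dM = dyck_restrict(2)[OF dT y(2) h', folded lp]
  have yL: "nY l c \<in> lpart l T" "nZ l c \<in> rpart l T" using y by (simp_all add: lpart_def rpart_def)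
  have T: "T = insert (nN l c) (lpart l T \<union> rpart l T)"
  proof (intro equalityI subsetI)
    fix x assume x: "x \<in> T"
    show "x \<in> insert (nN l c) (lpart l T \<union> rpart l T)"
    proof (cases "column x = l")
      case True
      then show ?thesis using tile_eqI[OF t x TD(2)] by simp
    qed (use x in \<open>auto simp: lpart_def rpart_def\<close>)
  qed (use TD(2) in \<open>auto simp: lpart_def rpart_def\<close>)
  have disT: "S \<inter> T = {}" if "S \<in> D - {T}" for S using that TD(1) partition_onD2[OF d(2)] by (auto dest: disjointD)
  have nL: "lpart l T \<notin> D - {T}" "rpart l T \<notin> D - {T}" using disT yL y by blast+
  have p0: "partition_on (E - T) (D - {T})"
  proof -
    have "disjnt T (\<Union>(D - {T}))" using disT unfolding disjnt_def by blast
    then show ?thesis using partition_on_insert[of T "D - {T}" E] d(2) TD(1) by (simp add: insert_absorb)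
  qed
  have U: "\<Union>(D - {T}) = E - T" using partition_onD1[OF p0] by simp
  have TE: "T \<subseteq> E" using partition_on_subset[OF d(2) TD(1)] .
  have nl: "nN l c \<notin> lpart l T" "nN l c \<notin> rpart l T" by (simp_all add: lpart_def rpart_def)
  have LM: "lpart l T \<inter> rpart l T = {}" by (auto simp: lpart_def rpart_def)
  have LT: "lpart l T \<subseteq> T" "rpart l T \<subseteq> T" by (auto simp: lpart_def rpart_def)
  have p1: "partition_on (E - T \<union> rpart l T) (insert (rpart l T) (D - {T}))"
  proof (subst partition_on_insert)
    show "disjnt (rpart l T) (\<Union>(D - {T}))" unfolding U disjnt_def using LT by blast
    have "E - T \<union> rpart l T - rpart l T = E - T" using LT by blast
    then show "partition_on (E - T \<union> rpart l T - rpart l T) (D - {T}) \<and>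
      rpart l T \<subseteq> E - T \<union> rpart l T \<and> rpart l T \<noteq> {}" using p0 yL by auto
  qed
  have p2: "partition_on (E - {nN l c}) (cut_tiling l c D)"
    unfolding cut_tiling_def Let_def T_def[symmetric]
  proof (subst partition_on_insert)
    show "disjnt (lpart l T) (\<Union>(insert (rpart l T) (D - {T})))"
      unfolding Union_insert U disjnt_def using LT LM by blast
    have "E - {nN l c} - lpart l T = E - T \<union> rpart l T" using T TE LT LM nl by blast
    then show "partition_on (E - {nN l c} - lpart l T) (insert (rpart l T) (D - {T})) \<and>
      lpart l T \<subseteq> E - {nN l c} \<and> lpart l T \<noteq> {}" using p1 yL LT TE nl by auto
  qed
  have D0: "D = insert T (D - {T})" "T \<notin> D - {T}" using TD(1) by blast+
  have D1: "cut_tiling l c D = insert (lpart l T) (insert (rpart l T) (D - {T}))"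
    by (simp add: cut_tiling_def T_def Let_def)
  have dD: "is_dyck_tile S" if "S \<in> D - {T}" for S using that d(1) by (simp add: dyck_tiling_def)
  have LM': "rcol (lpart l T) = l - 1" "lcol (rpart l T) = l + 1" using L(3) M(3) by simp_all
  show ?thesis
    by (rule cut_tile.intro[OF convex_strip_axioms cut_tile_axioms.intro[OF c ab D0(1) d(2) D0(2) D1 p2 nL
        T dT h dL LM'(1) yL(1) L(2)[symmetric] dM LM'(2) yL(2) M(2)[symmetric] dD]])
qed

lemma cut_tile_glue:
  assumes ab: "al < be" and c: "c = be - 1" and g: "liftable l al c be (E - {nN l c}) D1"
  defines "L \<equiv> tile_of D1 (nY l c)" and "M \<equiv> tile_of D1 (nZ l c)"
  shows "cut_tile E l al be c (D1 - {L, M}) (glue_tiling l c D1) D1 L M (insert (nN l c) (L \<union> M))"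
proof -
  let ?E = "E - {nN l c}" and ?T = "insert (nN l c) (L \<union> M)"
  have dt: "dyck_tiling ?E D1" using g by (simp add: liftable_def)
  then have p: "partition_on ?E D1" by (simp add: dyck_tiling_def)
  have yz: "nY l c \<in> ?E" "nZ l c \<in> ?E" using Y Z ab c by auto
  have LM: "L \<in> D1" "nY l c \<in> L" "M \<in> D1" "nZ l c \<in> M"
    using tile_of_in[OF p yz(1)] tile_of_in[OF p yz(2)] by (simp_all add: L_def M_def)
  have sub: "L \<subseteq> ?E" "M \<subseteq> ?E" using partition_on_subset[OF p] LM by blast+
  have n1: "nN l (c + 1) \<notin> ?E" "nN l c \<notin> ?E" using N c by auto
  have "end_col D1 (nY l c) = column (nY l c)"
    using sub n1 by (intro tiling_end_col_eq[OF dt yz(1)]) (auto simp: L_def[symmetric])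
  then have rL: "rcol L = l - 1" by (simp add: end_col_def L_def)
  have "start_col D1 (nZ l c) = column (nZ l c)"
    using sub n1 by (intro tiling_start_col_eq[OF dt yz(2)]) (auto simp: M_def[symmetric])
  then have lM: "lcol M = l + 1" by (simp add: start_col_def M_def)
  have d: "is_dyck_tile L" "is_dyck_tile M" using dt LM by (simp_all add: dyck_tiling_def)
  then have t: "is_tile L" "is_tile M" by (simp_all add: is_dyck_tile_def)
  note j = tile_join[OF t(1) LM(2) rL t(2) LM(4) lM] and dj = dyck_join[OF d(1) LM(2) rL d(2) LM(4) lM]
  have "L \<noteq> M" using rcol_ge[OF t(1) , of "nZ l c"] rL LM(4) by auto
  have dis: "S \<inter> L = {}" "S \<inter> M = {}" if "S \<in> D1 - {L, M}" for S
    using that LM partition_onD2[OF p] by (auto dest: disjointD)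
  have U: "\<Union>(D1 - {L, M}) = ?E - (L \<union> M)"
  proof -
    have "D1 = insert L (insert M (D1 - {L, M}))" using LM by blast
    then have "\<Union>D1 = L \<union> M \<union> \<Union>(D1 - {L, M})" by (metis Union_insert Un_assoc)
    moreover have "\<Union>(D1 - {L, M}) \<inter> (L \<union> M) = {}" using dis by blast
    ultimately show ?thesis unfolding partition_onD1[OF p] by blast
  qed
  have TD: "?T \<notin> D1 - {L, M}" using partition_on_subset[OF p] n1 by blast
  have "partition_on (?E - (L \<union> M)) (D1 - {L, M})"
    unfolding partition_on_def U using partition_onD2[OF p] partition_onD3[OF p]
    by (meson DiffD1 Diff_subset pairwise_subset)
  moreover have "E - ?T = ?E - (L \<union> M)" by blast
  moreover have "nN l c \<in> E" using N ab c by simp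
  ultimately have p2: "partition_on E (insert ?T (D1 - {L, M}))"
    using sub by (subst partition_on_insert) (auto simp: U disjnt_def)
  have D: "glue_tiling l c D1 = insert ?T (D1 - {L, M})" by (simp add: glue_tiling_def L_def M_def Let_def)
  have D1: "D1 = insert L (insert M (D1 - {L, M}))" using LM by blast
  have nLM: "L \<notin> D1 - {L, M}" "M \<notin> D1 - {L, M}" by simp_all
  have dD: "is_dyck_tile S" if "S \<in> D1 - {L, M}" for S using that dt by (simp add: dyck_tiling_def)
  show ?thesis
    by (rule cut_tile.intro[OF convex_strip_axioms cut_tile_axioms.intro[OF c ab D p2[folded D] TD D1 p nLM
        refl dj d(1) rL LM(2) j(2) d(2) lM LM(4) j(3) dD]])
qed

text \<open>The locale \<open>cut_tile\<close> serves both directions: \<open>cut_tile_cut\<close>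
  instantiates it starting from the uncut tiling, \<open>cut_tile_glue\<close> starting from the cut
  one.\<close>

lemma card_not_strict:
  assumes ab: "al < be" and c: "c = be - 1"
  shows "card {D \<in> CE E. \<not> strict_at l D c} = card {D. liftable l al c be (E - {nN l c}) D}"
proof -
  have nE: "nN l c \<in> E" using N ab c by simp
  have "bij_betw (cut_tiling l c) {D \<in> CE E. \<not> strict_at l D c} {D. liftable l al c be (E - {nN l c}) D}"
  proof (rule bij_betw_byWitness[where f' = "glue_tiling l c"])
    show "\<forall>D\<in>{D \<in> CE E. \<not> strict_at l D c}. glue_tiling l c (cut_tiling l c D) = D"
    proof
      fix D assume D: "D \<in> {D \<in> CE E. \<not> strict_at l D c}"
      let ?T = "tile_of D (nN l c)"
      interpret cut_tile E l al be c "D - {?T}" D "cut_tiling l c D" "lpart l ?T" "rpart l ?T" ?T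
        using cut_tile_cut[OF ab c] D by blast
      have "glue_tiling l c (cut_tiling l c D) =
          insert (insert (nN l c) (lpart l ?T \<union> rpart l ?T)) (cut_tiling l c D - {lpart l ?T, rpart l ?T})"
        unfolding glue_tiling_def Let_def tile_of_cut(1)[OF L(3)] tile_of_cut(2)[OF M(3)] ..
      also have "\<dots> = D" unfolding T(1)[symmetric] using D1(1,3,4) D(1) by blast
      finally show "glue_tiling l c (cut_tiling l c D) = D" .
    qed
    show "\<forall>D\<in>{D. liftable l al c be (E - {nN l c}) D}. cut_tiling l c (glue_tiling l c D) = D"
    proof
      fix D assume "D \<in> {D. liftable l al c be (E - {nN l c}) D}"
      then have g: "liftable l al c be (E - {nN l c}) D" by blast
      let ?L = "tile_of D (nY l c)" and ?M = "tile_of D (nZ l c)"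
      let ?T = "insert (nN l c) (?L \<union> ?M)"
      interpret cut_tile E l al be c "D - {?L, ?M}" "glue_tiling l c D" D ?L ?M ?T
        using cut_tile_glue[OF ab c g] .
      have t: "tile_of (glue_tiling l c D) (nN l c) = ?T" using tile_of_cut(3)[of "nN l c"] by blast
      have "lpart l ?T = ?L" "rpart l ?T = ?M"
        using cols by (auto simp: lpart_def rpart_def dest: cols)
      then show "cut_tiling l c (glue_tiling l c D) = D"
        unfolding cut_tiling_def t Let_def using D1(1) D(1,3) by auto
    qed
    show "cut_tiling l c ` {D \<in> CE E. \<not> strict_at l D c} \<subseteq> {D. liftable l al c be (E - {nN l c}) D}"
      using cut_tile.CE_imp_liftable_cut[OF cut_tile_cut[OF ab c]] by blast
    show "glue_tiling l c ` {D. liftable l al c be (E - {nN l c}) D} \<subseteq> {D \<in> CE E. \<not> strict_at l D c}"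
      using cut_tile.liftable_imp_CE_glue[OF cut_tile_glue[OF ab c]] cut_tile.not_strict[OF cut_tile_glue[OF ab c]]
      by blast
  qed
  then show ?thesis by (rule bij_betw_same_card)
qed

text \<open>\<open>strict_below\<close> settles all dips but the topmost one, so only that one
  remains to be decided.\<close>

lemma liftable_iff_CE_strict:
  assumes ab: "al < be" and c: "c = be - 1"
  shows "liftable l al be be E D \<longleftrightarrow> D \<in> CE E \<and> strict_at l D c"
proof
  assume "liftable l al be be E D"
  then show "D \<in> CE E \<and> strict_at l D c" unfolding liftable_def CE_iff_dip using ab c by force
next
  assume A: "D \<in> CE E \<and> strict_at l D c"
  have "strict_at l D a" if "al \<le> a" "a < be" for a
  proof (cases "a = c")
    case False
    then have "a + 1 < be" using that c by simp
    then show ?thesis using strict_below[of D a] that A by blast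
  qed (use A in blast)
  then show "liftable l al be be E D" using A unfolding liftable_def CE_iff_dip by blast
qed

text \<open>The first summand counts the tilings that can be shifted as they stand, the second those
  whose top tile has to be cut first, which costs the top node.\<close>

theorem card_CE_strip:
  assumes fin: "finite E" and ab: "al < be"
  shows "card (CE E) = card (CE (shift l ` E)) + card (CE (shift l ` (E - {nN l (be - 1)})))"
proof -
  define c where "c = be - 1"
  interpret s: strip "E - {nN l c}" l al c be
  proof
    fix a
    show "nN l a \<in> E - {nN l c} \<longleftrightarrow> al \<le> a \<and> a < c" using N[of a] c_def by auto
    show "nY l a \<in> E - {nN l c} \<longleftrightarrow> al \<le> a \<and> a < be" using Y[of a] by simp
    show "nZ l a \<in> E - {nN l c} \<longleftrightarrow> al \<le> a \<and> a < be" using Z[of a] by simp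
  qed (use c_def in simp_all)
  have "CE E \<subseteq> {D. partition_on E D}" using CE_D(2) by blast
  then have f: "finite (CE E)" using finitely_many_partition_on[OF fin] finite_subset by blast
  have "CE E = {D. liftable l al be be E D} \<union> {D \<in> CE E. \<not> strict_at l D c}"
    using liftable_iff_CE_strict[OF ab c_def] by blast
  moreover have "{D. liftable l al be be E D} \<inter> {D \<in> CE E. \<not> strict_at l D c} = {}"
    using liftable_iff_CE_strict[OF ab c_def] by blast
  ultimately have "card (CE E) = card {D. liftable l al be be E D} + card {D \<in> CE E. \<not> strict_at l D c}"
    using f card_Un_disjoint by (metis (no_types, lifting) finite_Un)
  then show ?thesis using card_not_strict[OF ab c_def] card_liftable s.card_liftable by (simp add: c_def)
qed

end


section \<open>The permutation module\<close>

text \<open>The coefficient of \<open>S\<close> when \<open>x\<close> acts on the subset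
  \<open>{f+1..f+g}\<close> in the permutation module. This subset is fixed by every
  \<open>t_i\<close> with \<open>i\<close> different from \<open>f\<close>, hence can play the role
  of the generator \<open>m\<close>.\<close>

definition orbit_sum :: "nat \<Rightarrow> nat \<Rightarrow> ((nat \<Rightarrow> nat) \<Rightarrow> 'a::field) \<Rightarrow> nat set \<Rightarrow> 'a" where
  "orbit_sum f g x S = (\<Sum>\<sigma> | \<sigma> permutes {1..f+g} \<and> \<sigma> ` {f+1..f+g} = S. x \<sigma>)"

abbreviation perms :: "nat \<Rightarrow> (nat \<Rightarrow> nat) set" where "perms k \<equiv> {p. p permutes {1..k}}"

declare finite_permutations [simp]

section \<open>The group algebra and the left ideal of relations\<close>

lemma inv_comp_eq_iff: "p permutes S \<Longrightarrow> inv p \<circ> \<sigma> = q \<longleftrightarrow> \<sigma> = p \<circ> q"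
  by (metis comp_assoc fun.map_id0 id_apply id_comp permutes_inv_o)

lemma ga_basis_in_ga: "ga_basis k p \<in> ga k"
  by (auto simp: ga_def ga_basis_def)

lemma ga_diff: "x \<in> ga k \<Longrightarrow> y \<in> ga k \<Longrightarrow> x - y \<in> ga k"
  by (auto simp: ga_def)

lemma ga_mult_in_ga: "ga_mult k x y \<in> ga k"
  by (auto simp: ga_def ga_mult_def)

lemma ga_basis_mult:
  assumes "p permutes {1..k}"
  shows "ga_mult k (ga_basis k p) y = (\<lambda>\<sigma>. if \<sigma> permutes {1..k} then y (inv p \<circ> \<sigma>) else 0)"
proof
  fix \<sigma>
  have "(\<Sum>\<tau>\<in>perms k. ga_basis k p \<tau> * y (inv \<tau> \<circ> \<sigma>)) = (\<Sum>\<tau>\<in>perms k. if \<tau> = p then y (inv p \<circ> \<sigma>) else 0)"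
    using assms by (intro sum.cong) (auto simp: ga_basis_def)
  then show "ga_mult k (ga_basis k p) y \<sigma> = (if \<sigma> permutes {1..k} then y (inv p \<circ> \<sigma>) else 0)"
    using assms by (simp add: ga_mult_def)
qed

lemma ga_basis_mult_basis:
  assumes "p permutes {1..k}" "q permutes {1..k}"
  shows "ga_mult k (ga_basis k p) (ga_basis k q) = ga_basis k (p \<circ> q)"
  unfolding ga_basis_mult[OF assms(1)] using assms
  by (auto simp: fun_eq_iff[where 'a = "nat \<Rightarrow> nat"] ga_basis_def inv_comp_eq_iff permutes_compose)

lemma ga_mult_diff_left: "ga_mult k (x - y) z = ga_mult k x z - ga_mult k y z"
  by (auto simp: fun_eq_iff[where 'a = "nat \<Rightarrow> nat"] ga_mult_def sum_subtractf left_diff_distrib)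

lemma ga_mult_diff_right: "ga_mult k x (y - z) = ga_mult k x y - ga_mult k x z"
  by (auto simp: fun_eq_iff[where 'a = "nat \<Rightarrow> nat"] ga_mult_def sum_subtractf right_diff_distrib)

lemma ga_one_mult: "x \<in> ga k \<Longrightarrow> ga_mult k (ga_one k) x = x"
  unfolding ga_one_def ga_basis_mult[OF permutes_id]
  by (auto simp: fun_eq_iff[where 'a = "nat \<Rightarrow> nat"] ga_def)

lemma ga_mult_zero: "ga_mult k 0 y = 0"
  by (auto simp: fun_eq_iff[where 'a = "nat \<Rightarrow> nat"] ga_mult_def)

lemma ga_prod_in_ga: "ga_prod k xs \<in> ga k"
  by (cases xs) (auto simp: ga_prod_def ga_one_def ga_basis_in_ga ga_mult_in_ga)

lemma ga_prod_Cons: "ga_prod k (x # xs) = ga_mult k x (ga_prod k xs)"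
  by (simp add: ga_prod_def)

lemma Mrel_zero: "0 \<in> Mrel f g"
  unfolding Mrel_def by (auto intro!: exI[of _ "\<lambda>_. 0"] simp: ga_mult_zero ga_def)

lemma Mrel_add:
  assumes "x \<in> Mrel f g" "y \<in> Mrel f g"
  shows "x + y \<in> Mrel f g"
proof -
  obtain a b where a: "\<forall>i. a i \<in> ga (f+g)" "x = (\<Sum>i\<in>{1..<f+g} - {f}. ga_mult (f+g) (a i) (gen_t (f+g) i - ga_one (f+g)))"
    and b: "\<forall>i. b i \<in> ga (f+g)" "y = (\<Sum>i\<in>{1..<f+g} - {f}. ga_mult (f+g) (b i) (gen_t (f+g) i - ga_one (f+g)))"
    using assms unfolding Mrel_def by blast
  have "ga_mult k (u + v) w = ga_mult k u w + ga_mult k v w" for k u v and w :: "(nat \<Rightarrow> nat) \<Rightarrow> 'a"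
    by (auto simp: fun_eq_iff[where 'a = "nat \<Rightarrow> nat"] ga_mult_def sum.distrib distrib_right)
  then show ?thesis unfolding Mrel_def
    using a b by (intro CollectI exI[of _ "\<lambda>i. a i + b i"]) (auto simp: sum.distrib ga_def)
qed

lemma Mrel_scale:
  assumes "x \<in> Mrel f g"
  shows "(\<lambda>\<sigma>. c * x \<sigma>) \<in> Mrel f g"
proof -
  obtain a where a: "\<forall>i. a i \<in> ga (f+g)" "x = (\<Sum>i\<in>{1..<f+g} - {f}. ga_mult (f+g) (a i) (gen_t (f+g) i - ga_one (f+g)))"
    using assms unfolding Mrel_def by blast
  have s: "sum F A \<sigma> = (\<Sum>i\<in>A. F i \<sigma>)" for F :: "nat \<Rightarrow> (nat \<Rightarrow> nat) \<Rightarrow> 'a" and A \<sigma>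
    by (induction A rule: infinite_finite_induct) auto
  have "ga_mult k (\<lambda>\<sigma>. c * u \<sigma>) w = (\<lambda>\<sigma>. c * ga_mult k u w \<sigma>)" for k u and w :: "(nat \<Rightarrow> nat) \<Rightarrow> 'a"
    by (auto simp: ga_mult_def sum_distrib_left mult.assoc)
  then have "(\<lambda>\<sigma>. c * x \<sigma>) = (\<Sum>i\<in>{1..<f+g} - {f}. ga_mult (f+g) (\<lambda>\<sigma>. c * a i \<sigma>) (gen_t (f+g) i - ga_one (f+g)))"
    unfolding a(2) by (auto simp: fun_eq_iff[where 'a = "nat \<Rightarrow> nat"] s sum_distrib_left)
  then show ?thesis unfolding Mrel_def
    using a(1) by (intro CollectI exI[of _ "\<lambda>i \<sigma>. c * a i \<sigma>"]) (auto simp: ga_def)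
qed

lemma Mrel_sum: "(\<And>i. i \<in> A \<Longrightarrow> F i \<in> Mrel f g) \<Longrightarrow> sum F A \<in> Mrel f g"
  by (induction A rule: infinite_finite_induct) (auto simp: Mrel_zero Mrel_add)

lemma Mrel_mult_gen:
  assumes "a \<in> ga (f+g)" "i \<in> {1..<f+g} - {f}"
  shows "ga_mult (f+g) a (gen_t (f+g) i - ga_one (f+g)) \<in> Mrel f g"
proof -
  define b where "b = (\<lambda>j. if j = i then a else 0)"
  have "(\<Sum>j\<in>{1..<f+g} - {f}. ga_mult (f+g) (b j) (gen_t (f+g) j - ga_one (f+g))) =
    (\<Sum>j\<in>{1..<f+g} - {f}. if j = i then ga_mult (f+g) a (gen_t (f+g) i - ga_one (f+g)) else 0)"
    by (intro sum.cong) (auto simp: b_def ga_mult_zero)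
  also have "\<dots> = ga_mult (f+g) a (gen_t (f+g) i - ga_one (f+g))" using assms(2) by simp
  finally show ?thesis unfolding Mrel_def
    using assms(1) by (intro CollectI exI[of _ b]) (auto simp: b_def ga_def)
qed

text \<open>The permutations that fix the generator of \<open>M\<close>. Quantifying over the left
  factor makes closure under composition a telescoping sum; the type argument records the field,
  which the other arguments do not mention.\<close>

definition fixes_gen :: "'a::field itself \<Rightarrow> nat \<Rightarrow> nat \<Rightarrow> (nat \<Rightarrow> nat) \<Rightarrow> bool" where
  "fixes_gen _ f g p \<longleftrightarrow> p permutes {1..f+g} \<and>
    (\<forall>\<tau>. \<tau> permutes {1..f+g} \<longrightarrow> (ga_basis (f+g) (\<tau> \<circ> p) - ga_basis (f+g) \<tau> :: (nat \<Rightarrow> nat) \<Rightarrow> 'a) \<in> Mrel f g)"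

lemma fixes_gen_id: "fixes_gen TYPE('a::field) f g id"
  by (simp add: fixes_gen_def permutes_id Mrel_zero)

lemma fixes_gen_comp:
  assumes "fixes_gen TYPE('a::field) f g p" "fixes_gen TYPE('a) f g q"
  shows "fixes_gen TYPE('a) f g (p \<circ> q)"
  unfolding fixes_gen_def
proof (intro conjI allI impI)
  show "p \<circ> q permutes {1..f+g}" using assms by (simp add: fixes_gen_def permutes_compose)
  fix \<tau> assume t: "\<tau> permutes {1..f+g}"
  then have "\<tau> \<circ> p permutes {1..f+g}" using assms(1) by (simp add: fixes_gen_def permutes_compose)
  then have "(ga_basis (f+g) (\<tau> \<circ> p \<circ> q) - ga_basis (f+g) (\<tau> \<circ> p)) +
      (ga_basis (f+g) (\<tau> \<circ> p) - ga_basis (f+g) \<tau> :: (nat \<Rightarrow> nat) \<Rightarrow> 'a) \<in> Mrel f g"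
    using assms t by (intro Mrel_add) (auto simp: fixes_gen_def)
  then show "(ga_basis (f+g) (\<tau> \<circ> (p \<circ> q)) - ga_basis (f+g) \<tau> :: (nat \<Rightarrow> nat) \<Rightarrow> 'a) \<in> Mrel f g"
    by (simp add: comp_assoc)
qed

lemma fixes_gen_adjacent:
  assumes "i \<in> {1..<f+g} - {f}"
  shows "fixes_gen TYPE('a::field) f g (Transposition.transpose i (Suc i))"
  unfolding fixes_gen_def
proof (intro conjI allI impI)
  show p: "Transposition.transpose i (Suc i) permutes {1..f+g}"
    using assms by (intro permutes_swap_id) auto
  fix \<tau> assume t: "\<tau> permutes {1..f+g}"
  have "ga_mult (f+g) (ga_basis (f+g) \<tau>) (gen_t (f+g) i - ga_one (f+g)) =
    (ga_basis (f+g) (\<tau> \<circ> Transposition.transpose i (Suc i)) - ga_basis (f+g) \<tau> :: (nat \<Rightarrow> nat) \<Rightarrow> 'a)"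
    unfolding ga_mult_diff_right gen_t_def ga_one_def
    by (simp add: ga_basis_mult_basis[OF t p] ga_basis_mult_basis[OF t permutes_id])
  then show "(ga_basis (f+g) (\<tau> \<circ> Transposition.transpose i (Suc i)) - ga_basis (f+g) \<tau> :: (nat \<Rightarrow> nat) \<Rightarrow> 'a)
      \<in> Mrel f g"
    using Mrel_mult_gen[OF ga_basis_in_ga assms] by metis
qed

text \<open>With \<open>c = b - 1\<close>, the transposition is the conjugate of an adjacent one by
  \<open>(a c)\<close>. As \<open>a\<close> and \<open>b\<close> lie on the same side of the gap
  after \<open>f\<close>, the adjacent transposition at \<open>f\<close> never occurs.\<close>

lemma fixes_gen_transpose_less:
  assumes "a < b" "a \<in> {1..f+g}" "b \<in> {1..f+g}" "b \<le> f \<or> f < a"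
  shows "fixes_gen TYPE('a::field) f g (Transposition.transpose a b)"
  using assms
proof (induction b rule: less_induct)
  case (less b)
  then obtain c where b: "b = Suc c" by (cases b) auto
  show ?case
  proof (cases "a = c")
    case True
    show ?thesis unfolding b True using less.prems b True by (intro fixes_gen_adjacent) auto
  next
    case False
    have ac: "fixes_gen TYPE('a) f g (Transposition.transpose a c)"
      using less.prems False b by (intro less.IH) auto
    have cb: "fixes_gen TYPE('a) f g (Transposition.transpose c b)"
      unfolding b using less.prems False b by (intro fixes_gen_adjacent) auto
    have "Transposition.transpose a b =
        Transposition.transpose a c \<circ> Transposition.transpose c b \<circ> Transposition.transpose a c"
      using False less.prems(1) b by (intro transpose_comp_triple[symmetric]) auto
    then show ?thesis using fixes_gen_comp[OF fixes_gen_comp[OF ac cb] ac] by (simp only:)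
  qed
qed

lemma fixes_gen_transpose:
  assumes "a \<in> {1..f+g}" "b \<in> {1..f+g}" "a \<le> f \<longleftrightarrow> b \<le> f"
  shows "fixes_gen TYPE('a::field) f g (Transposition.transpose a b)"
proof -
  consider "a < b" | "b < a" | "a = b" by linarith
  then show ?thesis
  proof cases
    case 1
    then show ?thesis using assms by (intro fixes_gen_transpose_less) auto
  next
    case 2
    then have "fixes_gen TYPE('a) f g (Transposition.transpose b a)"
      using assms by (intro fixes_gen_transpose_less) auto
    then show ?thesis by (simp add: transpose_commute)
  qed (simp add: fixes_gen_id)
qed

lemma fixes_gen_block:
  assumes "p permutes S" "S \<subseteq> {1..f+g}" "\<And>a b. a \<in> S \<Longrightarrow> b \<in> S \<Longrightarrow> a \<le> f \<longleftrightarrow> b \<le> f"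
  shows "fixes_gen TYPE('a::field) f g p"
proof -
  have "finite S" using assms(2) finite_subset by blast
  with assms(1) show ?thesis
  proof (induction rule: permutes_induct)
    case (swap a b p)
    have "fixes_gen TYPE('a) f g (Transposition.transpose a b)"
      using swap assms(2) assms(3)[of a b] by (intro fixes_gen_transpose) blast+
    then show ?case using swap fixes_gen_comp by blast
  qed (rule fixes_gen_id)
qed

text \<open>The stabilizer of the base subset is the Young subgroup of type (f, g), so the
  permutation splits into its restrictions to the two blocks.\<close>

lemma fixes_gen_young:
  assumes p: "p permutes {1..f+g}" and B: "p ` {f+1..f+g} = {f+1..f+g}"
  shows "fixes_gen TYPE('a::field) f g p"
proof -
  let ?A = "{1..f}" and ?B = "{f+1..f+g}"
  have inj: "inj p" using p by (rule permutes_inj)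
  have "?A = {1..f+g} - ?B" by auto
  then have A: "p ` ?A = ?A"
    using image_set_diff[OF inj, of "{1..f+g}" ?B] B permutes_image[OF p] by metis
  define q where "q = (\<lambda>x. if x \<in> ?A then p x else x)"
  define r where "r = (\<lambda>x. if x \<in> ?B then p x else x)"
  have q: "q permutes ?A"
  proof (rule bij_imp_permutes)
    have "bij_betw p ?A ?A" using A inj_on_subset[OF inj] unfolding bij_betw_def by blast
    then show "bij_betw q ?A ?A" by (rule bij_betw_cong[THEN iffD1, rotated]) (simp add: q_def)
  qed (auto simp: q_def)
  have r: "r permutes ?B"
  proof (rule bij_imp_permutes)
    have "bij_betw p ?B ?B" using B inj_on_subset[OF inj] unfolding bij_betw_def by blast
    then show "bij_betw r ?B ?B" by (rule bij_betw_cong[THEN iffD1, rotated]) (simp add: r_def)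
  qed (auto simp: r_def)
  have "p = q \<circ> r"
  proof
    fix x
    consider "x \<in> ?A" | "x \<in> ?B" | "x \<notin> {1..f+g}" by fastforce
    then show "p x = (q \<circ> r) x"
    proof cases
      case 2
      then have "p x \<in> ?B" using B by blast
      then show ?thesis using 2 by (auto simp: q_def r_def)
    qed (auto simp: q_def r_def permutes_not_in[OF p])
  qed
  moreover have "fixes_gen TYPE('a) f g q" using q by (rule fixes_gen_block) auto
  moreover have "fixes_gen TYPE('a) f g r" using r by (rule fixes_gen_block) auto
  ultimately show ?thesis using fixes_gen_comp by metis
qed

lemma basis_diff_in_Mrel:
  assumes "\<sigma> permutes {1..f+g}" "\<tau> permutes {1..f+g}" "\<sigma> ` {f+1..f+g} = \<tau> ` {f+1..f+g}"
  shows "(ga_basis (f+g) \<sigma> - ga_basis (f+g) \<tau> :: (nat \<Rightarrow> nat) \<Rightarrow> 'a::field) \<in> Mrel f g"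
proof -
  have "inv \<tau> \<circ> \<sigma> permutes {1..f+g}" using assms by (simp add: permutes_compose permutes_inv)
  moreover have "(inv \<tau> \<circ> \<sigma>) ` {f+1..f+g} = {f+1..f+g}"
    by (simp only: image_comp[symmetric] assms(3) image_inv_f_f[OF permutes_inj[OF assms(2)]])
  ultimately have "fixes_gen TYPE('a) f g (inv \<tau> \<circ> \<sigma>)" by (rule fixes_gen_young)
  moreover have "\<tau> \<circ> (inv \<tau> \<circ> \<sigma>) = \<sigma>" using permutes_inv_o(1)[OF assms(2)] by (simp add: comp_assoc[symmetric])
  ultimately show ?thesis using assms(2) unfolding fixes_gen_def by metis
qed

text \<open>Subtract from each permutation the chosen representative \<open>\<rho>\<close> of its
  coset. The subtracted terms collect into orbit sums and vanish in total, while each difference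
  lies in the ideal.\<close>

lemma Mrel_if_orbit_sum_eq_0:
  fixes x :: "(nat \<Rightarrow> nat) \<Rightarrow> 'a::field"
  assumes x: "x \<in> ga (f+g)" and z: "\<And>S. orbit_sum f g x S = 0"
  shows "x \<in> Mrel f g"
proof -
  let ?k = "f + g" and ?B = "{f+1..f+g}"
  define \<rho> where "\<rho> S = (SOME \<sigma>. \<sigma> permutes {1..?k} \<and> \<sigma> ` ?B = S)" for S
  have \<rho>: "\<rho> (\<sigma> ` ?B) permutes {1..?k} \<and> \<rho> (\<sigma> ` ?B) ` ?B = \<sigma> ` ?B" if "\<sigma> permutes {1..?k}" for \<sigma>
    unfolding \<rho>_def by (rule someI[of _ \<sigma>]) (use that in simp)
  have s: "sum F A \<tau> = (\<Sum>i\<in>A. F i \<tau>)" for F :: "(nat \<Rightarrow> nat) \<Rightarrow> (nat \<Rightarrow> nat) \<Rightarrow> 'a" and A \<tau>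
    by (induction A rule: infinite_finite_induct) auto
  have "x = (\<Sum>\<sigma>\<in>perms ?k. (\<lambda>\<tau>. x \<sigma> * (ga_basis ?k \<sigma> - ga_basis ?k (\<rho> (\<sigma> ` ?B))) \<tau>))"
  proof
    fix \<tau>
    have "(\<Sum>\<sigma>\<in>perms ?k. x \<sigma> * ga_basis ?k \<sigma> \<tau>) = (\<Sum>\<sigma>\<in>perms ?k. if \<sigma> = \<tau> then x \<tau> else 0)"
      by (intro sum.cong) (auto simp: ga_basis_def)
    also have "\<dots> = x \<tau>" using x by (auto simp: ga_def)
    finally have 1: "(\<Sum>\<sigma>\<in>perms ?k. x \<sigma> * ga_basis ?k \<sigma> \<tau>) = x \<tau>" .
    have "(\<Sum>\<sigma>\<in>perms ?k. x \<sigma> * ga_basis ?k (\<rho> (\<sigma> ` ?B)) \<tau>) =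
      (\<Sum>S\<in>(\<lambda>\<sigma>. \<sigma> ` ?B) ` perms ?k. \<Sum>\<sigma> | \<sigma> \<in> perms ?k \<and> \<sigma> ` ?B = S. x \<sigma> * ga_basis ?k (\<rho> (\<sigma> ` ?B)) \<tau>)"
      by (rule sum.image_gen) simp
    also have "\<dots> = (\<Sum>S\<in>(\<lambda>\<sigma>. \<sigma> ` ?B) ` perms ?k. orbit_sum f g x S * ga_basis ?k (\<rho> S) \<tau>)"
      unfolding orbit_sum_def sum_distrib_right by (intro sum.cong) auto
    also have "\<dots> = 0" by (simp add: z)
    finally show "x \<tau> = (\<Sum>\<sigma>\<in>perms ?k. (\<lambda>\<tau>. x \<sigma> * (ga_basis ?k \<sigma> - ga_basis ?k (\<rho> (\<sigma> ` ?B))) \<tau>)) \<tau>"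
      using 1 by (simp add: s right_diff_distrib sum_subtractf)
  qed
  moreover have "(\<Sum>\<sigma>\<in>perms ?k. (\<lambda>\<tau>. x \<sigma> * (ga_basis ?k \<sigma> - ga_basis ?k (\<rho> (\<sigma> ` ?B))) \<tau>)) \<in> Mrel f g"
    using \<rho> by (intro Mrel_sum Mrel_scale basis_diff_in_Mrel) auto
  ultimately show ?thesis by simp
qed

section \<open>The generators acting on orbit sums\<close>

lemma orbit_sum_gen_t:
  assumes "i \<in> {1..<f+g}"
  shows "orbit_sum f g (ga_mult (f+g) (gen_t (f+g) i) x) S = orbit_sum f g x (Transposition.transpose i (Suc i) ` S)"
proof -
  let ?t = "Transposition.transpose i (Suc i)" and ?B = "{f+1..f+g}"
  have t: "?t permutes {1..f+g}" using assms by (intro permutes_swap_id) auto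
  have tt: "?t ` ?t ` A = A" for A by (simp add: image_comp)
  show ?thesis unfolding orbit_sum_def gen_t_def ga_basis_mult[OF t]
  proof (rule sum.reindex_bij_witness[where i = "\<lambda>\<sigma>. ?t \<circ> \<sigma>" and j = "\<lambda>\<sigma>. ?t \<circ> \<sigma>"])
    fix \<sigma> assume s: "\<sigma> \<in> {\<sigma>. \<sigma> permutes {1..f+g} \<and> \<sigma> ` ?B = S}"
    show "?t \<circ> (?t \<circ> \<sigma>) = \<sigma>" by (simp add: comp_assoc[symmetric])
    show "?t \<circ> \<sigma> \<in> {\<sigma>. \<sigma> permutes {1..f+g} \<and> \<sigma> ` ?B = ?t ` S}"
      using s t image_comp[of ?t \<sigma> ?B] by (auto simp only: mem_Collect_eq permutes_compose)
    show "x (?t \<circ> \<sigma>) = (if \<sigma> permutes {1..f+g} then x (inv ?t \<circ> \<sigma>) else 0)" using s by simp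
  next
    fix \<sigma> assume s: "\<sigma> \<in> {\<sigma>. \<sigma> permutes {1..f+g} \<and> \<sigma> ` ?B = ?t ` S}"
    show "?t \<circ> (?t \<circ> \<sigma>) = \<sigma>" by (simp add: comp_assoc[symmetric])
    show "?t \<circ> \<sigma> \<in> {\<sigma>. \<sigma> permutes {1..f+g} \<and> \<sigma> ` ?B = S}"
      using s t tt image_comp[of ?t \<sigma> ?B] by (auto simp only: mem_Collect_eq permutes_compose)
  qed
qed

lemma orbit_sum_gen_s:
  assumes "i \<in> {1..<f+g}" "x \<in> ga (f+g)"
  shows "orbit_sum f g (ga_mult (f+g) (gen_s (f+g) i) x) S =
    orbit_sum f g x (Transposition.transpose i (Suc i) ` S) - orbit_sum f g x S"
  unfolding orbit_sum_gen_t[OF assms(1), symmetric] gen_s_def ga_mult_diff_left ga_one_mult[OF assms(2)]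
  by (simp add: orbit_sum_def sum_subtractf)

lemma orbit_sum_one: "orbit_sum f g (ga_one (f+g)) S = (if S = {f+1..f+g} then 1 else 0)"
proof -
  have "orbit_sum f g (ga_one (f+g)) S =
    (\<Sum>\<sigma> | \<sigma> permutes {1..f+g} \<and> \<sigma> ` {f+1..f+g} = S. if \<sigma> = id then 1 else 0)"
    unfolding orbit_sum_def ga_one_def ga_basis_def by (intro sum.cong) (auto simp: permutes_id)
  also have "\<dots> = (if id \<in> {\<sigma>. \<sigma> permutes {1..f+g} \<and> \<sigma> ` {f+1..f+g} = S} then 1 else 0)"
    by (rule sum.delta) (rule finite_subset[of _ "perms (f+g)"], auto)
  also have "id \<in> {\<sigma>. \<sigma> permutes {1..f+g} \<and> \<sigma> ` {f+1..f+g} = S} \<longleftrightarrow> S = {f+1..f+g}"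
    by (metis (mono_tags) image_id id_apply mem_Collect_eq permutes_id)
  finally show ?thesis .
qed


section \<open>Adding nodes to diagrams\<close>

definition downset :: "node set \<Rightarrow> bool" where
  "downset U \<longleftrightarrow> (\<forall>x y. x \<in> U \<longrightarrow> fst y \<le> fst x \<longrightarrow> snd y \<le> snd x \<longrightarrow> y \<in> U)"

lemma downsetD: "downset U \<Longrightarrow> x \<in> U \<Longrightarrow> fst y \<le> fst x \<Longrightarrow> snd y \<le> snd x \<Longrightarrow> y \<in> U"
  unfolding downset_def by blast

text \<open>The nodes \<open>nY l (r - 1)\<close> and \<open>nZ l (r - 1)\<close> are the lower
  neighbours of \<open>nN l r\<close>, so \<open>U\<close> remains a downset when
  \<open>nN l r\<close> is added.\<close>

definition addable :: "int \<Rightarrow> int \<Rightarrow> node set \<Rightarrow> bool" where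
  "addable l r U \<longleftrightarrow> downset U \<and> nN l r \<notin> U \<and> nY l (r - 1) \<in> U \<and> nZ l (r - 1) \<in> U"

lemma strip_coords [simp]:
  "fst (nN l a) = a" "snd (nN l a) = a + l" "fst (nY l a) = a + 1" "snd (nY l a) = a + l"
  "fst (nZ l a) = a" "snd (nZ l a) = a + l + 1"
  by (simp_all add: nN_def nY_def nZ_def)

text \<open>Three adjacent columns having the same profile is what makes the difference of two such
  downsets a full strip.\<close>

lemma addable_mem:
  assumes "addable l r U"
  shows "nN l a \<in> U \<longleftrightarrow> a < r" "nY l a \<in> U \<longleftrightarrow> a < r" "nZ l a \<in> U \<longleftrightarrow> a < r"
proof -
  have U: "downset U" and n: "nN l r \<notin> U" and yz: "nY l (r - 1) \<in> U" "nZ l (r - 1) \<in> U"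
    using assms by (auto simp: addable_def)
  have a: "nY l a \<in> U" "nZ l a \<in> U" if "a < r"
    using downsetD[OF U yz(1), of "nY l a"] downsetD[OF U yz(2), of "nZ l a"] that by simp_all
  then have "nN l a \<in> U" if "a < r" using that downsetD[OF U, of "nY l a" "nN l a"] by simp
  moreover have "nN l a \<notin> U" "nY l a \<notin> U" "nZ l a \<notin> U" if "\<not> a < r"
    using that n downsetD[OF U, of "nN l a" "nN l r"] downsetD[OF U, of "nY l a" "nN l r"]
      downsetD[OF U, of "nZ l a" "nN l r"] by auto
  ultimately show "nN l a \<in> U \<longleftrightarrow> a < r" "nY l a \<in> U \<longleftrightarrow> a < r" "nZ l a \<in> U \<longleftrightarrow> a < r" using a by blast+
qed

lemma addable_insertI:
  assumes "downset U" "downset (insert (nN l r) U)" "nN l r \<notin> U"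
  shows "addable l r U"
proof -
  have "nY l (r - 1) \<in> insert (nN l r) U" "nZ l (r - 1) \<in> insert (nN l r) U"
    using downsetD[OF assms(2), of "nN l r" "nY l (r - 1)"] downsetD[OF assms(2), of "nN l r" "nZ l (r - 1)"] by simp_all
  then show ?thesis using assms by (simp add: addable_def)
qed

section \<open>The recursion for the number of tilings\<close>

definition tiling_number :: "node set \<Rightarrow> node set \<Rightarrow> nat" where
  "tiling_number U V = (if V \<subseteq> U then card (CE (U - V)) else 0)"

lemma addable_subset_insert:
  assumes "addable l be U" "addable l al V" "V \<subseteq> insert (nN l be) U"
  shows "V \<subseteq> U"
proof -
  have "nN l be \<notin> V"
  proof
    assume "nN l be \<in> V"
    then have "nY l be \<in> V" using addable_mem[OF assms(2)] by simp
    then have "nY l be \<in> U" using assms(3) by auto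
    then show False using addable_mem(2)[OF assms(1)] by simp
  qed
  then show ?thesis using assms(3) by blast
qed

lemma tiling_number_insert:
  assumes U: "addable l be U" and V: "addable l al V"
  shows "tiling_number (insert (nN l be) U) V = tiling_number U V"
proof (cases "V \<subseteq> U")
  case True
  note u = addable_mem[OF U] and v = addable_mem[OF V]
  have ab: "al \<le> be" using True u(1)[of "al - 1"] v(1)[of "al - 1"] by auto
  have "insert (nN l be) U - V = insert (nN l be) (U - V)" using True u(1)[of be] by auto
  moreover have "card (CE (insert (nN l be) (U - V))) = card (CE (U - V))"
    by (rule CE_insert_top[OF _ _ ab]) (simp_all add: u v)
  ultimately show ?thesis using True by (auto simp: tiling_number_def)
next
  case False
  then show ?thesis using addable_subset_insert[OF U V] by (auto simp: tiling_number_def)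
qed

lemma tiling_number_rec:
  assumes U: "addable l be U" and V: "addable l al V" and fin: "finite (U - V)"
  shows "tiling_number U V =
    tiling_number (insert (nN l be) U) (insert (nN l al) V) + tiling_number U (insert (nN l al) V)"
proof (cases "V \<subseteq> U")
  case True
  note u = addable_mem[OF U] and v = addable_mem[OF V]
  have ab: "al \<le> be" using True u(1)[of "al - 1"] v(1)[of "al - 1"] by auto
  show ?thesis
  proof (cases "al = be")
    \<comment> \<open>Column \<open>l\<close> of the difference is empty. Adding the same node to
      both downsets changes nothing, and the second summand is 0.\<close>
    case True
    have "insert (nN l be) U - insert (nN l al) V = U - V" "\<not> insert (nN l al) V \<subseteq> U"
      using u(1)[of be] True by auto
    then show ?thesis using \<open>V \<subseteq> U\<close> True by (auto simp: tiling_number_def)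
  next
    case False
    then have al: "al < be" using ab by simp
    interpret convex_strip "U - V" l al be
    proof
      show "y \<in> U - V" if "x \<in> U - V" "z \<in> U - V" "fst x \<le> fst y" "fst y \<le> fst z" "snd x \<le> snd y" "snd y \<le> snd z"
        for x y z
        using that downsetD[of U z y] downsetD[of V y x] U V by (auto simp: addable_def)
    qed (auto simp: u v)
    have mem: "x \<in> shift l ` (U - V) \<longleftrightarrow> x \<in> insert (nN l be) U - insert (nN l al) V" for x
    proof (cases "column x = l")
      case True
      then obtain a where "x = nN l a" using column_eq_nN by blast
      then show ?thesis using al by (auto simp: shift_mem_on u v)
    next
      case False
      then show ?thesis by (auto simp: shift_mem_off)
    qed
    have mem': "x \<in> shift l ` (U - V - {nN l (be - 1)}) \<longleftrightarrow> x \<in> U - insert (nN l al) V" for x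
    proof (cases "column x = l")
      case True
      then obtain a where "x = nN l a" using column_eq_nN by blast
      then show ?thesis using al by (auto simp: shift_mem_on u v)
    next
      case False
      then show ?thesis by (auto simp: shift_mem_off)
    qed
    have "shift l ` (U - V) = insert (nN l be) U - insert (nN l al) V"
      "shift l ` (U - V - {nN l (be - 1)}) = U - insert (nN l al) V"
      using mem mem' by blast+
    moreover have "nN l al \<in> U" using u(1) al by simp
    ultimately show ?thesis using card_CE_strip[OF fin al] \<open>V \<subseteq> U\<close> by (auto simp: tiling_number_def)
  qed
next
  case False
  then have "\<not> insert (nN l al) V \<subseteq> U" "\<not> insert (nN l al) V \<subseteq> insert (nN l be) U"
    using addable_subset_insert[OF U V] by blast+
  then show ?thesis using False by (simp only: tiling_number_def if_False)
qed

text \<open>Exactly one upper neighbour of the top node of column \<open>l\<close> lies in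
  \<open>U\<close>, so that node is not removable and the next one is not addable. The tile of the
  top node would have to end or start there in spite of a higher node.\<close>

lemma tiling_number_straight:
  assumes U: "downset U" and V: "addable l al V"
    and be: "nN l (be - 1) \<in> U" "nN l be \<notin> U" and yz: "nY l (be - 1) \<in> U \<longleftrightarrow> nZ l (be - 1) \<notin> U"
  shows "tiling_number U V = 0"
proof (cases "V \<subseteq> U")
  case True
  note v = addable_mem[OF V]
  have u: "nN l a \<in> U \<longleftrightarrow> a < be" for a
    using downsetD[OF U be(1), of "nN l a"] downsetD[OF U, of "nN l a" "nN l be"] be by fastforce
  \<comment> \<open>\<open>V\<close> contains both neighbours \<open>nY l (al - 1)\<close> and
    \<open>nZ l (al - 1)\<close>, whereas at \<open>be - 1\<close> one of them is missing from
    \<open>U\<close>. So the difference has a node in column \<open>l\<close>.\<close>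
  have "al - 1 \<noteq> be - 1" using True yz v[of "al - 1"] by auto
  moreover have "al - 1 < be" using True v(1)[of "al - 1"] u[of "al - 1"] by auto
  ultimately have al: "al \<le> be - 1" by simp
  have n: "nN l a \<in> U - V" if "al \<le> a" "a \<le> be - 1" for a using that u v by simp
  have below: "nY l a \<in> U - V" "nZ l a \<in> U - V" if "al \<le> a" "a < be - 1" for a
    using that v downsetD[OF U be(1), of "nY l a"] downsetD[OF U be(1), of "nZ l a"] by simp_all
  have bot: "nY l (al - 1) \<notin> U - V" "nZ l (al - 1) \<notin> U - V" using v by simp_all
  have "CE (U - V) = {}"
  proof (cases "nY l (be - 1) \<in> U")
    case True
    have "nY l a \<in> U - V" if "al \<le> a" "a \<le> be - 1" for a
      using that below[of a] True v by (cases "a = be - 1") auto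
    then show ?thesis using n below True yz by (intro CE_empty_right[OF bot al]) auto
  next
    case False
    have "nZ l a \<in> U - V" if "al \<le> a" "a \<le> be - 1" for a
      using that below[of a] False yz v by (cases "a = be - 1") auto
    then show ?thesis using n below False yz by (intro CE_empty_left[OF bot al]) auto
  qed
  then show ?thesis by (simp add: tiling_number_def)
qed (simp add: tiling_number_def)

text \<open>Adding the nodes \<open>(a, b)\<close> with \<open>a \<le> 0\<close>, and with \<open>b \<le> 0\<close> in the first \<open>g\<close> rows, to a
  diagram makes every column nonempty and leaves the skew diagrams unchanged.\<close>

definition ext :: "nat \<Rightarrow> nat list \<Rightarrow> node set" where
  "ext g lam = {(a, b). a \<le> 0 \<or> a \<le> int g \<and> b \<le> int (part lam (nat a))}"

lemma Pfg_iff: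
  "lam \<in> Pfg f g \<longleftrightarrow> length lam = g \<and> (\<forall>r s. 1 \<le> r \<longrightarrow> r \<le> s \<longrightarrow> s \<le> g \<longrightarrow> part lam s \<le> part lam r) \<and>
    (\<forall>r. 1 \<le> r \<longrightarrow> r \<le> g \<longrightarrow> part lam r \<le> f)"
proof (cases "length lam = g")
  case len: True
  have "sorted_wrt (\<ge>) lam \<longleftrightarrow> (\<forall>r s. 1 \<le> r \<longrightarrow> r \<le> s \<longrightarrow> s \<le> g \<longrightarrow> part lam s \<le> part lam r)"
  proof
    assume s: "sorted_wrt (\<ge>) lam"
    show "\<forall>r s. 1 \<le> r \<longrightarrow> r \<le> s \<longrightarrow> s \<le> g \<longrightarrow> part lam s \<le> part lam r"
    proof (intro allI impI)
      fix r s :: nat assume rs: "1 \<le> r" "r \<le> s" "s \<le> g"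
      then show "part lam s \<le> part lam r"
        using sorted_wrt_nth_less[OF s, of "r - 1" "s - 1"] len by (cases "r = s") (auto simp: part_def)
    qed
  next
    assume A: "\<forall>r s. 1 \<le> r \<longrightarrow> r \<le> s \<longrightarrow> s \<le> g \<longrightarrow> part lam s \<le> part lam r"
    show "sorted_wrt (\<ge>) lam" unfolding sorted_wrt_iff_nth_less
    proof (intro allI impI)
      fix i j assume "i < j" "j < length lam"
      then show "lam ! i \<ge> lam ! j" using A[rule_format, of "Suc i" "Suc j"] len by (auto simp: part_def)
    qed
  qed
  moreover have "(\<forall>x\<in>set lam. x \<le> f) \<longleftrightarrow> (\<forall>r. 1 \<le> r \<longrightarrow> r \<le> g \<longrightarrow> part lam r \<le> f)"
  proof
    assume A: "\<forall>r. 1 \<le> r \<longrightarrow> r \<le> g \<longrightarrow> part lam r \<le> f"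
    show "\<forall>x\<in>set lam. x \<le> f"
    proof
      fix x assume "x \<in> set lam"
      then obtain i where "i < length lam" "x = lam ! i" by (auto simp: in_set_conv_nth)
      then show "x \<le> f" using A[rule_format, of "Suc i"] len by (simp add: part_def)
    qed
  qed (auto simp: part_def len)
  ultimately show ?thesis by (simp add: Pfg_def len)
qed (simp add: Pfg_def)

lemma Pfg_D:
  assumes "lam \<in> Pfg f g"
  shows "length lam = g" "\<And>r s. 1 \<le> r \<Longrightarrow> r \<le> s \<Longrightarrow> s \<le> g \<Longrightarrow> part lam s \<le> part lam r"
    "\<And>r. 1 \<le> r \<Longrightarrow> r \<le> g \<Longrightarrow> part lam r \<le> f"
  using assms unfolding Pfg_iff by blast+

lemma downset_ext:
  assumes "lam \<in> Pfg f g"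
  shows "downset (ext g lam)"
  unfolding downset_def
proof (intro allI impI)
  fix x y assume x: "x \<in> ext g lam" and y: "fst y \<le> fst x" "snd y \<le> snd x"
  show "y \<in> ext g lam"
  proof (cases "fst y \<le> 0")
    case False
    then have "part lam (nat (fst x)) \<le> part lam (nat (fst y))"
      using x y by (intro Pfg_D(2)[OF assms]) (auto simp: ext_def)
    then show ?thesis using False x y by (auto simp: ext_def)
  qed (auto simp: ext_def)
qed

lemma diagram_diff_ext:
  assumes "lam \<in> Pfg f g" "mu \<in> Pfg f g"
  shows "diagram lam - diagram mu = ext g lam - ext g mu" "diagram mu \<subseteq> diagram lam \<longleftrightarrow> ext g mu \<subseteq> ext g lam"
proof -
  have d: "diagram nu = {(a, b). 1 \<le> a \<and> 1 \<le> b \<and> (a, b) \<in> ext g nu}" if "nu \<in> Pfg f g" for nu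
    using Pfg_D(1)[OF that] by (auto simp: diagram_def ext_def part_def split: if_splits)
  have base: "(a, b) \<in> ext g nu" if "a \<le> int g" "b \<le> 0 \<or> a \<le> 0" for a b nu using that by (auto simp: ext_def)
  have bd: "a \<le> int g" if "(a, b) \<in> ext g nu" for a b nu using that by (auto simp: ext_def)
  show "diagram lam - diagram mu = ext g lam - ext g mu" (is "?L = ?R")
  proof (intro equalityI subrelI)
    show "(a, b) \<in> ?R" if "(a, b) \<in> ?L" for a b using that unfolding d[OF assms(1)] d[OF assms(2)] by auto
    show "(a, b) \<in> ?L" if "(a, b) \<in> ?R" for a b
      using that base[of a b mu] bd[of a b lam] unfolding d[OF assms(1)] d[OF assms(2)]
      by (cases "b \<le> 0 \<or> a \<le> 0") auto
  qed
  show "diagram mu \<subseteq> diagram lam \<longleftrightarrow> ext g mu \<subseteq> ext g lam"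
  proof (intro iffI subsetI)
    fix x assume A: "diagram mu \<subseteq> diagram lam" and x: "x \<in> ext g mu"
    obtain a b where ab: "x = (a, b)" by (cases x)
    show "x \<in> ext g lam"
    proof (cases "1 \<le> a \<and> 1 \<le> b")
      case True
      then have "x \<in> diagram mu" using x ab unfolding d[OF assms(2)] by simp
      then show ?thesis using A ab unfolding d[OF assms(1)] by blast
    next
      case False
      then show ?thesis using base[of a b lam] bd[of a b mu] x ab by auto
    qed
  next
    fix x assume "ext g mu \<subseteq> ext g lam" "x \<in> diagram mu"
    then show "x \<in> diagram lam" unfolding d[OF assms(1)] d[OF assms(2)] by blast
  qed
qed

lemma finite_diagram:
  assumes "lam \<in> Pfg f g"
  shows "finite (diagram lam)"
proof (rule finite_subset)
  show "diagram lam \<subseteq> {0..int g} \<times> {0..int f}"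
  proof (rule subrelI)
    fix a b assume x: "(a, b) \<in> diagram lam"
    then have "a \<le> int g" using Pfg_D(1)[OF assms] by (auto simp: diagram_def part_def split: if_splits)
    then show "(a, b) \<in> {0..int g} \<times> {0..int f}"
      using x Pfg_D(3)[OF assms, of "nat a"] nat_le_iff[of a g] by (auto simp: diagram_def le_nat_iff)
  qed
qed simp

lemma e_coeff_eq:
  assumes "lam \<in> Pfg f g" "mu \<in> Pfg f g"
  shows "e_coeff lam mu = tiling_number (ext g lam) (ext g mu)"
  unfolding e_coeff_def tiling_number_def CE_def diagram_diff_ext[OF assms] by simp


section \<open>Partitions as \<open>g\<close>-subsets of \<open>{1..f+g}\<close>\<close>

text \<open>These are the beta-numbers of the partition, shifted by one. The value \<open>i\<close>
  in row \<open>r\<close> means that the first free node of that row lies in column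
  \<open>i - g\<close>.\<close>

definition pos :: "nat \<Rightarrow> nat list \<Rightarrow> nat \<Rightarrow> nat" where
  "pos g lam r = part lam r + (g + 1 - r)"

definition posset :: "nat \<Rightarrow> nat list \<Rightarrow> nat set" where
  "posset g lam = pos g lam ` {1..g}"

lemma pos_in_posset: "r \<in> {1..g} \<Longrightarrow> pos g lam r \<in> posset g lam"
  unfolding posset_def by (rule imageI)

text \<open>By the choice of \<open>i\<close>, the added node lies in column
  \<open>i - g\<close>.\<close>

definition covers :: "nat \<Rightarrow> nat \<Rightarrow> nat \<Rightarrow> nat list \<Rightarrow> nat list \<Rightarrow> bool" where
  "covers f g i lam lam' \<longleftrightarrow> lam \<in> Pfg f g \<and> lam' \<in> Pfg f g \<and>
    (\<exists>r\<in>{1..g}. pos g lam r = i \<and> lam' = lam[r - 1 := Suc (part lam r)])"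

lemma part_update:
  assumes "length lam = g" "1 \<le> r" "r \<le> g"
  shows "part (lam[r - 1 := v]) s = (if s = r then v else part lam s)"
  using assms by (auto simp: part_def nth_list_update)

lemma pos_less:
  assumes "lam \<in> Pfg f g" "1 \<le> r" "r < s" "s \<le> g"
  shows "pos g lam s < pos g lam r"
  using Pfg_D(2)[OF assms(1,2), of s] assms by (simp add: pos_def)

lemma pos_inj:
  assumes "lam \<in> Pfg f g"
  shows "inj_on (pos g lam) {1..g}"
proof (rule inj_onI)
  fix r s assume "r \<in> {1..g}" "s \<in> {1..g}" "pos g lam r = pos g lam s"
  then show "r = s"
    using pos_less[OF assms, of r s] pos_less[OF assms, of s r] by (cases r s rule: linorder_cases) auto
qed

text \<open>Read from the last row upwards, the positions form a strictly increasing list, which its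
  set determines.\<close>

lemma posset_inj:
  assumes lam: "lam \<in> Pfg f g" and mu: "mu \<in> Pfg f g" and eq: "posset g lam = posset g mu"
  shows "lam = mu"
proof -
  define L where "L nu = map (pos g nu) (rev [1..<g+1])" for nu
  have L: "sorted_wrt (<) (L nu)" "set (L nu) = posset g nu" if "nu \<in> Pfg f g" for nu
  proof -
    have "sorted_wrt (\<lambda>r s. s < r) (rev [1..<g+1])" 
      unfolding sorted_wrt_rev by (rule sorted_wrt_upt)
    then show "sorted_wrt (<) (L nu)" unfolding L_def sorted_wrt_map
      by (rule sorted_wrt_mono_rel[rotated]) (auto intro: pos_less[OF that])
    show "set (L nu) = posset g nu" unfolding L_def posset_def by (auto simp: atLeastLessThanSuc_atLeastAtMost)
  qed
  have "L lam = L mu"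
    using strict_sorted_equal[OF L(1)[OF mu] L(1)[OF lam]] L(2)[OF lam] L(2)[OF mu] eq by metis
  then have p: "pos g lam r = pos g mu r" if "r \<in> {1..g}" for r
    using that unfolding L_def map_eq_conv set_rev set_upt by auto
  show ?thesis
  proof (rule nth_equalityI)
    show "length lam = length mu" using Pfg_D(1)[OF lam] Pfg_D(1)[OF mu] by simp
    fix i assume "i < length lam"
    then show "lam ! i = mu ! i"
      using p[of "Suc i"] Pfg_D(1)[OF lam] Pfg_D(1)[OF mu] by (simp add: pos_def part_def)
  qed
qed

lemma covers_pos:
  assumes "covers f g i lam lam'"
  obtains r where "r \<in> {1..g}" "pos g lam r = i" "\<And>s. part lam' s = (if s = r then Suc (part lam r) else part lam s)"
    "lam' = lam[r - 1 := Suc (part lam r)]"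
proof -
  obtain r where r: "r \<in> {1..g}" "pos g lam r = i" "lam' = lam[r - 1 := Suc (part lam r)]" and lam: "lam \<in> Pfg f g"
    using assms unfolding covers_def by blast
  show ?thesis using that[of r] r part_update[OF Pfg_D(1)[OF lam]] by simp
qed

text \<open>Row \<open>r\<close> moves from \<open>i\<close> to \<open>i + 1\<close>. By injectivity
  of the positions no other row is at \<open>i\<close> before the move or at \<open>i + 1\<close>
  after it, so the transposition fixes the rest.\<close>

lemma covers_posset:
  assumes "covers f g i lam lam'"
  shows "posset g lam' = Transposition.transpose i (Suc i) ` posset g lam"
    "posset g lam = Transposition.transpose i (Suc i) ` posset g lam'"
proof -
  let ?t = "Transposition.transpose i (Suc i)"
  have P: "lam \<in> Pfg f g" "lam' \<in> Pfg f g" using assms by (auto simp: covers_def)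
  obtain r where r: "r \<in> {1..g}" "pos g lam r = i"
    and p: "\<And>s. part lam' s = (if s = r then Suc (part lam r) else part lam s)"
    using covers_pos[OF assms] by metis
  have "pos g lam' s = ?t (pos g lam s)" if s: "s \<in> {1..g}" for s
  proof (cases "s = r")
    case True
    then show ?thesis using r p by (simp add: pos_def)
  next
    case False
    then have e: "pos g lam' s = pos g lam s" using p by (simp add: pos_def)
    have "pos g lam s \<noteq> i" using inj_onD[OF pos_inj[OF P(1)] _ s r(1)] r(2) False by auto
    moreover have "pos g lam' r = Suc i" using r p by (simp add: pos_def)
    then have "pos g lam' s \<noteq> Suc i" using inj_onD[OF pos_inj[OF P(2)] _ s r(1)] False by auto
    ultimately show ?thesis using e by simp
  qed
  then show *: "posset g lam' = ?t ` posset g lam" unfolding posset_def image_image by (rule image_cong[OF refl])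
  show "posset g lam = ?t ` posset g lam'" unfolding * by (simp add: image_comp)
qed

lemma covers_sum:
  assumes "covers f g i lam lam'"
  shows "sum_list lam' = Suc (sum_list lam)"
proof -
  obtain r where r: "r \<in> {1..g}" "lam' = lam[r - 1 := Suc (part lam r)]" and len: "length lam = g"
    using assms Pfg_D(1) unfolding covers_def by metis
  have "part lam r = lam ! (r - 1)" "r - 1 < length lam" using r len by (auto simp: part_def)
  moreover from this have "lam ! (r - 1) \<le> sum_list lam" by (simp add: elem_le_sum_list)
  ultimately show ?thesis using r(2) by (simp add: sum_list_update)
qed

lemma update_Pfg:
  assumes lam: "lam \<in> Pfg f g" and r: "r \<in> {1..g}" and v: "v \<le> f"
    and "r = 1 \<or> v \<le> part lam (r - 1)" "r = g \<or> part lam (r + 1) \<le> v"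
  shows "lam[r - 1 := v] \<in> Pfg f g"
proof -
  note d = Pfg_D[OF lam]
  have p: "part (lam[r - 1 := v]) s = (if s = r then v else part lam s)" for s
    using part_update[OF d(1), of r] r by simp
  have up: "v \<le> part lam s" if "1 \<le> s" "s < r" for s
    using that d(2)[of s "r - 1"] r assms(4) by force
  have down: "part lam s \<le> v" if "r < s" "s \<le> g" for s
    using that d(2)[of "r + 1" s] r assms(5) by force
  show ?thesis unfolding Pfg_iff p using d up down v by auto
qed

lemma ex_covers:
  assumes lam: "lam \<in> Pfg f g" and i: "i \<in> {1..<f+g}" and S: "i \<in> posset g lam" "Suc i \<notin> posset g lam"
  shows "\<exists>lam'. covers f g i lam lam'"
proof -
  obtain r where r: "r \<in> {1..g}" "pos g lam r = i" using S(1) unfolding posset_def by auto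
  note d = Pfg_D[OF lam]
  have up: "r = 1 \<or> Suc (part lam r) \<le> part lam (r - 1)"
  proof (cases "r = 1")
    case False
    then have "r - 1 \<in> {1..g}" using r by auto
    then have "pos g lam (r - 1) \<noteq> Suc i" using S(2) pos_in_posset by metis
    moreover have "i < pos g lam (r - 1)" using pos_less[OF lam, of "r - 1" r] r False by auto
    ultimately show ?thesis using r False by (auto simp: pos_def)
  qed simp
  \<comment> \<open>In the first row the bound comes from \<open>i < f + g\<close>, in the others
    from the row above.\<close>
  have "Suc (part lam r) \<le> f"
  proof (cases "r = 1")
    case False
    then have "1 \<le> r - 1" "r - 1 \<le> g" using r(1) by auto
    then show ?thesis using d(3)[of "r - 1"] up False by simp
  qed (use r i in \<open>auto simp: pos_def\<close>)
  moreover have "r = g \<or> part lam (r + 1) \<le> Suc (part lam r)"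
    using d(2)[of r "r + 1"] r(1) by (cases "r = g") auto
  ultimately have "lam[r - 1 := Suc (part lam r)] \<in> Pfg f g"
    using up by (intro update_Pfg[OF lam r(1)])
  then show ?thesis using lam r unfolding covers_def by blast
qed

lemma ex_covered:
  assumes lam: "lam \<in> Pfg f g" and i: "i \<in> {1..<f+g}" and S: "i \<notin> posset g lam" "Suc i \<in> posset g lam"
  shows "\<exists>lam'. covers f g i lam' lam"
proof -
  obtain r where r: "r \<in> {1..g}" "pos g lam r = Suc i" using S(2) unfolding posset_def by auto
  note d = Pfg_D[OF lam]
  have below: "r = g \<or> part lam (r + 1) < part lam r"
  proof (cases "r = g")
    case False
    then have "r + 1 \<in> {1..g}" using r by auto
    then have "pos g lam (r + 1) \<noteq> i" using S(1) pos_in_posset by metis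
    moreover have "pos g lam (r + 1) < Suc i" using pos_less[OF lam, of r "r + 1"] r False by auto
    ultimately show ?thesis using r False by (auto simp: pos_def)
  qed simp
  \<comment> \<open>In the last row this is where \<open>1 \<le> i\<close> enters; elsewhere the row
    below is strictly shorter.\<close>
  then have pr: "0 < part lam r" using r i by (auto simp: pos_def)
  let ?nu = "lam[r - 1 := part lam r - 1]"
  have "r = 1 \<or> part lam r - 1 \<le> part lam (r - 1)"
  proof (cases "r = 1")
    case False
    then have "1 \<le> r - 1" "r - 1 \<le> r" "r \<le> g" using r(1) by auto
    then show ?thesis using d(2)[of "r - 1" r] by linarith
  qed simp
  moreover have "part lam r - 1 \<le> f" using d(3)[of r] r(1) by simp
  moreover have "r = g \<or> part lam (r + 1) \<le> part lam r - 1" using below by auto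
  ultimately have nu: "?nu \<in> Pfg f g" by (intro update_Pfg[OF lam r(1)])
  have p: "part ?nu r = part lam r - 1" using part_update[OF d(1), of r] r by simp
  have "lam = ?nu[r - 1 := Suc (part ?nu r)]" unfolding p using pr r d(1) by (auto simp: part_def list_update_id)
  moreover have "pos g ?nu r = i" using p pr r by (simp add: pos_def)
  ultimately show ?thesis using lam nu r(1) unfolding covers_def by blast
qed

lemma covers_ext:
  assumes "covers f g i lam lam'"
  obtains r where "addable (int i - int g) r (ext g lam)" "ext g lam' = insert (nN (int i - int g) r) (ext g lam)"
proof -
  have P: "lam \<in> Pfg f g" "lam' \<in> Pfg f g" using assms by (auto simp: covers_def)
  obtain r where r: "r \<in> {1..g}" "pos g lam r = i"
    and p: "\<And>s. part lam' s = (if s = r then Suc (part lam r) else part lam s)"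
    using covers_pos[OF assms] by metis
  let ?l = "int i - int g"
  have n: "nN ?l (int r) = (int r, int (part lam r) + 1)" using r by (auto simp: nN_def pos_def)
  have ex: "ext g lam' = insert (nN ?l (int r)) (ext g lam)"
    unfolding n using r(1) by (auto simp: ext_def p split: if_splits)
  have "nN ?l (int r) \<notin> ext g lam" unfolding n using r(1) by (simp add: ext_def)
  then have "addable ?l (int r) (ext g lam)"
    using downset_ext[OF P(1)] downset_ext[OF P(2)] unfolding ex by (intro addable_insertI)
  then show ?thesis using that ex by blast
qed

lemma e_coeff_covers:
  assumes lam: "covers f g i lam lam'" and mu: "covers f g i mu mu'"
  shows "e_coeff lam' mu = e_coeff lam mu" "e_coeff lam mu = e_coeff lam' mu' + e_coeff lam mu'"
proof -
  have P: "lam \<in> Pfg f g" "lam' \<in> Pfg f g" "mu \<in> Pfg f g" "mu' \<in> Pfg f g"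
    using lam mu by (auto simp: covers_def)
  obtain r where r: "addable (int i - int g) r (ext g lam)" "ext g lam' = insert (nN (int i - int g) r) (ext g lam)"
    using covers_ext[OF lam] .
  obtain s where s: "addable (int i - int g) s (ext g mu)" "ext g mu' = insert (nN (int i - int g) s) (ext g mu)"
    using covers_ext[OF mu] .
  have fin: "finite (ext g lam - ext g mu)"
    using finite_diagram[OF P(1)] unfolding diagram_diff_ext(1)[OF P(1,3), symmetric] by simp
  show "e_coeff lam' mu = e_coeff lam mu"
    using tiling_number_insert[OF r(1) s(1)] by (simp add: e_coeff_eq[OF P(1,3)] e_coeff_eq[OF P(2,3)] r(2))
  show "e_coeff lam mu = e_coeff lam' mu' + e_coeff lam mu'"
    using tiling_number_rec[OF r(1) s(1) fin]
    by (simp add: e_coeff_eq[OF P(1,3)] e_coeff_eq[OF P(2,4)] e_coeff_eq[OF P(1,4)] r(2) s(2))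
qed

lemma e_coeff_straight:
  assumes lam: "lam \<in> Pfg f g" and mu: "covers f g i mu mu'" and i: "i \<in> {1..<f+g}"
    and S: "i \<in> posset g lam \<longleftrightarrow> Suc i \<in> posset g lam"
  shows "e_coeff lam mu = 0"
proof -
  let ?l = "int i - int g" and ?U = "ext g lam"
  have Pmu: "mu \<in> Pfg f g" using mu by (simp add: covers_def)
  obtain s where s: "addable ?l s (ext g mu)" using covers_ext[OF mu] by metis
  have U: "downset ?U" using downset_ext[OF lam] .
  \<comment> \<open>The last row in which column \<open>i - g\<close> meets the extended diagram. It
    exists even if the column has no node in \<open>lam\<close>, because \<open>ext\<close> contains
    row 0.\<close>
  define b where "b = (GREATEST n. nN ?l (int n) \<in> ?U)"
  have n0: "nN ?l (int 0) \<in> ?U" by (simp add: nN_def ext_def)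
  have bd: "n \<le> g" if "nN ?l (int n) \<in> ?U" for n using that by (auto simp: nN_def ext_def)
  have b1: "nN ?l (int b) \<in> ?U" unfolding b_def by (rule GreatestI_nat[of _ 0 g]) (use n0 bd in auto)
  have b2: "nN ?l (int (Suc b)) \<notin> ?U"
  proof
    assume "nN ?l (int (Suc b)) \<in> ?U"
    then have "Suc b \<le> b" unfolding b_def by (rule Greatest_le_nat[of _ _ g]) (use bd in auto)
    then show False by simp
  qed
  \<comment> \<open>Position \<open>i\<close> is occupied exactly when row \<open>b + 1\<close> ends
    one column before column \<open>i - g\<close>.\<close>
  have i1: "i \<in> posset g lam \<longleftrightarrow> nY ?l (int b) \<in> ?U"
  proof
    assume "i \<in> posset g lam"
    then obtain r where r: "r \<in> {1..g}" "pos g lam r = i" unfolding posset_def by auto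
    then have il: "int i - int g = int (part lam r) + 1 - int r" by (auto simp: pos_def)
    have "nY ?l (int r - 1) \<in> ?U" "nN ?l (int r) \<notin> ?U" using r by (auto simp: nY_def nN_def ext_def il)
    moreover from this have "r = Suc b"
      using downsetD[OF U b1, of "nN ?l (int r)"] downsetD[OF U, of "nY ?l (int r - 1)" "nN ?l (int r - 1)"]
        downsetD[OF U, of "nN ?l (int r - 1)" "nN ?l (int (Suc b))"] b2 r(1)
      by (cases "r \<le> b"; cases "Suc b < r") auto
    ultimately show "nY ?l (int b) \<in> ?U" by simp
  next
    assume y: "nY ?l (int b) \<in> ?U"
    then have bg: "Suc b \<le> g" by (auto simp: nY_def ext_def)
    have nat: "nat (int b + 1) = Suc b" "nat (1 + int b) = Suc b" by auto
    have "int b + ?l \<le> int (part lam (Suc b))" using y nat by (auto simp: nY_def ext_def)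
    moreover have "\<not> int (Suc b) + ?l \<le> int (part lam (Suc b))" using b2 bg nat by (auto simp: nN_def ext_def)
    ultimately have "pos g lam (Suc b) = i" using bg by (auto simp: pos_def)
    then show "i \<in> posset g lam" using bg unfolding posset_def by (intro image_eqI[of _ _ "Suc b"]) auto
  qed
  \<comment> \<open>Position \<open>i + 1\<close> is occupied exactly when row \<open>b\<close> ends
    in column \<open>i - g\<close>. So \<open>S\<close> says that exactly one upper neighbour of the
    last node is present.\<close>
  have i2: "Suc i \<in> posset g lam \<longleftrightarrow> nZ ?l (int b) \<notin> ?U"
  proof
    assume "Suc i \<in> posset g lam"
    then obtain r where r: "r \<in> {1..g}" "pos g lam r = Suc i" unfolding posset_def by auto
    then have il: "int i - int g = int (part lam r) - int r" by (auto simp: pos_def)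
    have n: "nN ?l (int r) \<in> ?U" "nZ ?l (int r) \<notin> ?U" using r by (auto simp: nZ_def nN_def ext_def il)
    have "\<not> r < b" using downsetD[OF U b1, of "nZ ?l (int r)"] n(2) by auto
    moreover have "\<not> b < r" using downsetD[OF U n(1), of "nN ?l (int (Suc b))"] b2 by auto
    ultimately have "r = b" by simp
    then show "nZ ?l (int b) \<notin> ?U" using n by simp
  next
    assume z: "nZ ?l (int b) \<notin> ?U"
    have bg: "1 \<le> b" "b \<le> g" using z bd[OF b1] by (auto simp: nZ_def ext_def)
    have "int b + ?l \<le> int (part lam b)" using b1 bg by (auto simp: nN_def ext_def)
    moreover have "\<not> int b + ?l + 1 \<le> int (part lam b)" using z bg by (auto simp: nZ_def ext_def)
    ultimately have "pos g lam b = Suc i" using bg by (auto simp: pos_def)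
    then show "Suc i \<in> posset g lam" using bg unfolding posset_def by (intro image_eqI[of _ _ b]) auto
  qed
  have "tiling_number ?U (ext g mu) = 0"
    using tiling_number_straight[OF U s, of "int b + 1"] b1 b2 i1 i2 S by (simp add: add.commute)
  then show ?thesis using e_coeff_eq[OF lam Pmu] by simp
qed

text \<open>Full rows contribute no letters, so the first letter comes from the first row that is
  not full, and filling one node there removes just this letter. This drives the inductions on the
  length of the word.\<close>

lemma word_cases:
  assumes mu: "mu \<in> Pfg f g"
  obtains "mu = replicate g f" "word f g mu = []"
  | i mu' where "i \<in> {1..<f+g}" "covers f g i mu mu'" "word f g mu = i # word f g mu'"
proof -
  note d = Pfg_D[OF mu]
  let ?W = "\<lambda>lam r. [part lam r + g - r + 1 ..< f + g - r + 1]"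
  show ?thesis
  proof (cases "\<forall>r\<in>{1..g}. part mu r = f")
    case True
    have "mu = replicate g f"
    proof (rule nth_equalityI)
      fix j assume "j < length mu"
      then show "mu ! j = replicate g f ! j" using True[rule_format, of "Suc j"] d(1) by (simp add: part_def)
    qed (simp add: d)
    moreover have "word f g mu = []" unfolding word_def using True by auto
    ultimately show ?thesis using that(1) by blast
  next
    case False
    define r where "r = (LEAST r. r \<in> {1..g} \<and> part mu r \<noteq> f)"
    have r: "r \<in> {1..g}" "part mu r \<noteq> f"
      using LeastI_ex[of "\<lambda>r. r \<in> {1..g} \<and> part mu r \<noteq> f"] False unfolding r_def by blast+
    have full: "part mu s = f" if "s \<in> {1..g}" "s < r" for s
      using not_less_Least[of s "\<lambda>r. r \<in> {1..g} \<and> part mu r \<noteq> f"] that unfolding r_def by blast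
    have lt: "part mu r < f" using d(3)[of r] r by force
    define i where "i = pos g mu r"
    define mu' where "mu' = mu[r - 1 := Suc (part mu r)]"
    have "r = 1 \<or> Suc (part mu r) \<le> part mu (r - 1)"
    proof (cases "r = 1")
      case False
      then have "r - 1 \<in> {1..g}" "r - 1 < r" using r(1) by auto
      then show ?thesis using full[of "r - 1"] lt by simp
    qed simp
    moreover have "r = g \<or> part mu (r + 1) \<le> Suc (part mu r)"
      using d(2)[of r "r + 1"] r(1) by (cases "r = g") auto
    ultimately have "mu' \<in> Pfg f g" unfolding mu'_def using lt by (intro update_Pfg[OF mu r(1)]) auto
    then have cov: "covers f g i mu mu'" using mu r(1) unfolding covers_def i_def mu'_def by blast
    have p: "part mu' s = (if s = r then Suc (part mu r) else part mu s)" for s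
      unfolding mu'_def using part_update[OF d(1), of r] r by simp
    have split: "[1..<g+1] = [1..<r] @ r # [Suc r..<g+1]"
      using r(1) by (metis atLeastAtMost_iff le_SucI le_add1 less_Suc_eq_le upt_add_eq_append upt_conv_Cons Suc_eq_plus1 le_Suc_ex)
    have first: "concat (map (?W lam) [1..<r]) = []" if "lam = mu \<or> lam = mu'" for lam
      using that full r(1) p by auto
    have rest: "map (?W mu') [Suc r..<g+1] = map (?W mu) [Suc r..<g+1]" using p by simp
    have "?W mu r = i # ?W mu' r"
      using r(1) lt p by (subst upt_conv_Cons) (auto simp: i_def pos_def Suc_diff_le)
    moreover have "word f g nu = concat (map (?W nu) [1..<r]) @ ?W nu r @ concat (map (?W nu) [Suc r..<g+1])" for nu
      unfolding word_def split by (simp only: map_append list.map concat_append concat.simps)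
    ultimately have "word f g mu = i # word f g mu'"
      using first[of mu, OF disjI1[OF refl]] first[of mu', OF disjI2[OF refl]] rest by (simp only: append.simps)
    moreover have "i \<in> {1..<f+g}" using r(1) lt by (auto simp: i_def pos_def)
    ultimately show ?thesis using that(2) cov by blast
  qed
qed


section \<open>The expansion\<close>

lemma CE_empty: "CE {} = {{}}"
  by (auto simp: CE_def dyck_tiling_def cover_expansive_def partition_on_empty)

lemma posset_full: "posset g (replicate g f) = {f+1..f+g}"
proof -
  have "pos g (replicate g f) r = f + (g + 1 - r)" if "r \<in> {1..g}" for r
    using that by (auto simp: pos_def part_def)
  then have "posset g (replicate g f) = (\<lambda>r. f + (g + 1 - r)) ` {1..g}"
    unfolding posset_def by (intro image_cong) auto
  also have "\<dots> = {f+1..f+g}"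
  proof (intro equalityI subsetI)
    fix x assume "x \<in> {f+1..f+g}"
    then show "x \<in> (\<lambda>r. f + (g + 1 - r)) ` {1..g}" by (intro image_eqI[of _ _ "f + g + 1 - x"]) auto
  qed auto
  finally show ?thesis .
qed

text \<open>Only the full rectangle contains the full rectangle, and the empty region has one
  tiling, the empty one.\<close>

lemma e_coeff_full:
  assumes "lam \<in> Pfg f g"
  shows "e_coeff lam (replicate g f) = (if lam = replicate g f then 1 else 0)"
proof -
  have "lam = replicate g f" if sub: "diagram (replicate g f) \<subseteq> diagram lam"
  proof (rule nth_equalityI)
    fix j assume "j < length lam"
    then have j: "j < g" using Pfg_D(1)[OF assms] by simp
    have "f \<le> part lam (Suc j)"
    proof (cases "f = 0")
      case False
      have n: "nat (int j + 1) = Suc j" "nat (1 + int j) = Suc j" by auto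
      have "(int (Suc j), int f) \<in> diagram (replicate g f)" using j False n by (auto simp: diagram_def part_def)
      then have "(int (Suc j), int f) \<in> diagram lam" using sub by blast
      then show ?thesis using n by (simp add: diagram_def)
    qed simp
    then show "lam ! j = replicate g f ! j"
      using Pfg_D(3)[OF assms, of "Suc j"] j Pfg_D(1)[OF assms] by (simp add: part_def)
  qed (use Pfg_D(1)[OF assms] in simp)
  then show ?thesis using CE_empty by (auto simp: e_coeff_def CE_def)
qed

text \<open>Closure under the generators ensures that no other subsets occur in
  \<open>s_lam m\<close>.\<close>

lemma posset_transpose:
  assumes lam: "lam \<in> Pfg f g" and i: "i \<in> {1..<f+g}"
  shows "\<exists>lam'\<in>Pfg f g. Transposition.transpose i (Suc i) ` posset g lam = posset g lam'"
proof -
  consider "i \<in> posset g lam \<longleftrightarrow> Suc i \<in> posset g lam"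
    | lam' where "covers f g i lam lam'" | lam' where "covers f g i lam' lam"
    using ex_covers[OF lam i] ex_covered[OF lam i] by blast
  then show ?thesis
  proof cases
    case 1
    then have "Transposition.transpose i (Suc i) ` posset g lam = posset g lam" by (rule transpose_image_eq)
    then show ?thesis using lam by blast
  next
    case 2
    then show ?thesis using covers_posset(1)[OF 2] by (auto simp: covers_def)
  next
    case 3
    then show ?thesis using covers_posset(2)[OF 3] by (auto simp: covers_def)
  qed
qed

lemma transpose_image_swap: "Transposition.transpose i j ` S = T \<longleftrightarrow> S = Transposition.transpose i j ` T"
proof -
  have tt: "Transposition.transpose i j ` Transposition.transpose i j ` A = A" for A by (simp add: image_comp)
  show ?thesis using tt[of S] tt[of T] by metis
qed

lemma orbit_sum_t_lam:
  assumes "mu \<in> Pfg f g"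
  shows "orbit_sum f g (t_lam f g mu :: (nat \<Rightarrow> nat) \<Rightarrow> 'a::field) S = (if S = posset g mu then 1 else 0)"
  using assms
proof (induction "length (word f g mu)" arbitrary: mu S rule: less_induct)
  case less
  from less.prems show ?case
  proof (cases rule: word_cases)
    case 1
    then show ?thesis using posset_full[of g f] by (simp add: orbit_sum_one t_lam_def ga_prod_def)
  next
    case (2 i mu')
    have "orbit_sum f g (t_lam f g mu :: (nat \<Rightarrow> nat) \<Rightarrow> 'a) S = orbit_sum f g (t_lam f g mu') (Transposition.transpose i (Suc i) ` S)"
      unfolding t_lam_def 2(3) list.map ga_prod_Cons orbit_sum_gen_t[OF 2(1)] ..
    also have "\<dots> = (if Transposition.transpose i (Suc i) ` S = posset g mu' then 1 else 0)"
      using 2 by (intro less.hyps) (auto simp: covers_def)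
    also have "Transposition.transpose i (Suc i) ` S = posset g mu' \<longleftrightarrow> S = posset g mu"
      unfolding transpose_image_swap covers_posset(2)[OF 2(2)] ..
    finally show ?thesis .
  qed
qed

lemma orbit_sum_s_lam_eq_0:
  assumes "mu \<in> Pfg f g" "S \<notin> posset g ` Pfg f g"
  shows "orbit_sum f g (s_lam f g mu :: (nat \<Rightarrow> nat) \<Rightarrow> 'a::field) S = 0"
  using assms
proof (induction "length (word f g mu)" arbitrary: mu S rule: less_induct)
  case less
  from less.prems(1) show ?case
  proof (cases rule: word_cases)
    case 1
    then have "S \<noteq> {f+1..f+g}" using less.prems posset_full by (metis image_eqI)
    then show ?thesis using 1 by (simp add: orbit_sum_one s_lam_def ga_prod_def)
  next
    case (2 i mu')
    have mu': "mu' \<in> Pfg f g" using 2(2) by (simp add: covers_def)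
    have "Transposition.transpose i (Suc i) ` S \<notin> posset g ` Pfg f g"
    proof
      assume "Transposition.transpose i (Suc i) ` S \<in> posset g ` Pfg f g"
      then obtain nu where nu: "nu \<in> Pfg f g" "Transposition.transpose i (Suc i) ` S = posset g nu" by blast
      have "S = Transposition.transpose i (Suc i) ` posset g nu" using nu(2) by (rule transpose_image_swap[THEN iffD1])
      then show False using posset_transpose[OF nu(1) 2(1)] less.prems(2) by auto
    qed
    then have "orbit_sum f g (s_lam f g mu' :: (nat \<Rightarrow> nat) \<Rightarrow> 'a) (Transposition.transpose i (Suc i) ` S) = 0"
      "orbit_sum f g (s_lam f g mu' :: (nat \<Rightarrow> nat) \<Rightarrow> 'a) S = 0"
      using less.hyps[of mu'] mu' less.prems(2) 2(3) by simp_all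
    then show ?thesis
      unfolding s_lam_def 2(3) list.map ga_prod_Cons orbit_sum_gen_s[OF 2(1) ga_prod_in_ga] by simp
  qed
qed

text \<open>Passing from \<open>mu\<close> to \<open>mu'\<close> flips the sign, and so does passing
  between \<open>lam\<close> and \<open>lam'\<close>. Hence the difference produced by
  \<open>s_i\<close> carries, up to a common sign, the sum of the two coefficients in the
  recursion.\<close>

lemma orbit_sum_s_lam:
  assumes "mu \<in> Pfg f g" "lam \<in> Pfg f g"
  shows "orbit_sum f g (s_lam f g mu :: (nat \<Rightarrow> nat) \<Rightarrow> 'a::field) (posset g lam) =
    (-1) ^ (sum_list lam + sum_list mu) * of_nat (e_coeff lam mu)"
  using assms
proof (induction "length (word f g mu)" arbitrary: mu lam rule: less_induct)
  case less
  note lam = less.prems(2)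
  from less.prems(1) show ?case
  proof (cases rule: word_cases)
    case 1
    have "posset g lam = {f+1..f+g} \<longleftrightarrow> lam = mu"
      using posset_inj[OF lam less.prems(1)] 1(1) posset_full by metis
    then show ?thesis
      using 1 e_coeff_full[OF lam] posset_full[of g f] by (simp add: orbit_sum_one s_lam_def ga_prod_def)
  next
    case (2 i mu')
    let ?t = "Transposition.transpose i (Suc i)" and ?s = "s_lam f g mu' :: (nat \<Rightarrow> nat) \<Rightarrow> 'a"
    have mu': "mu' \<in> Pfg f g" using 2(2) by (simp add: covers_def)
    have IH: "orbit_sum f g ?s (posset g nu) = (-1) ^ (sum_list nu + sum_list mu') * of_nat (e_coeff nu mu')"
      if "nu \<in> Pfg f g" for nu
      using less.hyps[of mu' nu] mu' that 2(3) by simp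
    have m: "sum_list mu' = Suc (sum_list mu)" using covers_sum[OF 2(2)] .
    have eq: "orbit_sum f g (s_lam f g mu :: (nat \<Rightarrow> nat) \<Rightarrow> 'a) (posset g lam) =
        orbit_sum f g ?s (?t ` posset g lam) - orbit_sum f g ?s (posset g lam)"
      unfolding s_lam_def 2(3) list.map ga_prod_Cons orbit_sum_gen_s[OF 2(1) ga_prod_in_ga] ..
    consider "i \<in> posset g lam \<longleftrightarrow> Suc i \<in> posset g lam"
      | lam' where "covers f g i lam lam'" | lam' where "covers f g i lam' lam"
      using ex_covers[OF lam 2(1)] ex_covered[OF lam 2(1)] by blast
    then show ?thesis
    proof cases
      case a: 1
      have "?t ` posset g lam = posset g lam" using a by (rule transpose_image_eq)
      then show ?thesis unfolding eq using e_coeff_straight[OF lam 2(2,1) a] by simp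
    next
      case b: (2 lam')
      have "lam' \<in> Pfg f g" "sum_list lam' = Suc (sum_list lam)" using b covers_sum[OF b] by (auto simp: covers_def)
      then show ?thesis
        unfolding eq covers_posset(1)[OF b, symmetric] e_coeff_covers(2)[OF b 2(2)]
        by (simp add: IH lam m algebra_simps)
    next
      case c: (3 lam')
      have "lam' \<in> Pfg f g" "sum_list lam = Suc (sum_list lam')" using c covers_sum[OF c] by (auto simp: covers_def)
      \<comment> \<open>Here \<open>lam\<close> is the larger partition, so its coefficient is first
        replaced by that of \<open>lam'\<close>, to which the recursion applies.\<close>
      then show ?thesis
        unfolding eq covers_posset(2)[OF c, symmetric] e_coeff_covers(1)[OF c 2(2)] e_coeff_covers(2)[OF c 2(2)]
        by (simp add: IH lam m algebra_simps)
    qed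
  qed
qed

lemma finite_Pfg: "finite (Pfg f g)"
proof (rule finite_subset)
  show "Pfg f g \<subseteq> {xs. set xs \<subseteq> {..f} \<and> length xs = g}" by (auto simp: Pfg_def)
qed (rule finite_lists_length_eq, simp)

theorem theorem5p2:
  fixes f g :: nat and mu :: "nat list"
  assumes "mu \<in> Pfg f g"
  shows "Meq f g (s_lam f g mu :: (nat \<Rightarrow> nat) \<Rightarrow> 'a::field)
           (\<Sum>lam\<in>Pfg f g. (\<lambda>\<sigma>. (-1) ^ (sum_list lam + sum_list mu) *
                of_nat (e_coeff lam mu) * t_lam f g lam \<sigma>))"
proof -
  define c where "c lam = ((-1) ^ (sum_list lam + sum_list mu) * of_nat (e_coeff lam mu) :: 'a)" for lam
  let ?R = "\<Sum>lam\<in>Pfg f g. (\<lambda>\<sigma>. c lam * t_lam f g lam \<sigma>)"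
  have s: "sum F A \<sigma> = (\<Sum>i\<in>A. F i \<sigma>)" for F :: "nat list \<Rightarrow> (nat \<Rightarrow> nat) \<Rightarrow> 'a" and A \<sigma>
    by (induction A rule: infinite_finite_induct) auto
  have R: "orbit_sum f g ?R S = (\<Sum>lam\<in>Pfg f g. c lam * orbit_sum f g (t_lam f g lam) S)" for S
    unfolding orbit_sum_def s sum_distrib_left by (rule sum.swap)
  \<comment> \<open>Equality in \<open>M\<close> is tested on orbit sums. On subsets of partitions
    both sides give the coefficient \<open>c\<close>, and on all other sets both vanish.\<close>
  have eq: "orbit_sum f g (s_lam f g mu) S = orbit_sum f g ?R S" for S
  proof (cases "S \<in> posset g ` Pfg f g")
    case True
    then obtain nu where nu: "nu \<in> Pfg f g" "S = posset g nu" by blast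
    have "orbit_sum f g ?R S = (\<Sum>lam\<in>Pfg f g. if lam = nu then c nu else 0)"
      unfolding R using posset_inj[OF nu(1)] nu(2) by (intro sum.cong) (auto simp: orbit_sum_t_lam)
    also have "\<dots> = c nu" using nu(1) by (simp add: finite_Pfg)
    finally show ?thesis using orbit_sum_s_lam[OF assms nu(1)] nu(2) by (simp add: c_def)
  next
    case False
    then have "orbit_sum f g ?R S = 0"
      unfolding R by (intro sum.neutral) (auto simp: orbit_sum_t_lam)
    then show ?thesis using orbit_sum_s_lam_eq_0[OF assms False] by simp
  qed
  have "orbit_sum f g (s_lam f g mu - ?R) S = 0" for S
    using eq[of S] by (simp add: orbit_sum_def sum_subtractf)
  moreover have "t_lam f g lam \<sigma> = (0::'a)" if "\<not> \<sigma> permutes {1..f+g}" for lam \<sigma>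
    using ga_prod_in_ga that unfolding t_lam_def ga_def by blast
  then have "?R \<in> ga (f+g)" by (simp add: ga_def s)
  then have "s_lam f g mu - ?R \<in> ga (f+g)"
    by (intro ga_diff) (auto simp: s_lam_def ga_prod_in_ga)
  ultimately have "s_lam f g mu - ?R \<in> Mrel f g" by (intro Mrel_if_orbit_sum_eq_0)
  then show ?thesis unfolding Meq_def c_def .
qed

end
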